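(* Let $A$ be a real $n\times n$ matrix and $0<\varepsilon<1$. There is a deterministic polynomial time algorithm that, given $A$ and $\varepsilon$, outputs a matrix $\widetilde A\in\mathbb{R}^{n\times n}$ with at most $28\,n\ln(\sqrt{2n})\,\mathrm{sr}(A)/\varepsilon^2$ non-zero entries such that $\|A-\widetilde A\|\le\varepsilon\|A\|$.
   Context: $\|\cdot\|$ is the operator norm, $\|A\|_F$ the Frobenius norm, and $\mathrm{sr}(A)=\|A\|_F^2/\|A\|^2$ is the stable rank of $A$. *)

theory Defs
  imports
    Complex_Main
    "HOL-Computational_Algebra.Polynomial"
    "Jordan_Normal_Form.Matrix"
begin

text \<open>
  Matrices are those of \<^theory>\<open>Jordan_Normal_Form.Matrix\<close>, whose dimensions are terms: a single
  algorithm has to handle all dimensions.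
\<close>

definition euclidean_norm :: "real vec \<Rightarrow> real" where
  "euclidean_norm x = sqrt (x \<bullet> x)"

text \<open>The set is nonempty and bounded above whenever \<^term>\<open>A\<close> has at least one column.\<close>

definition operator_norm :: "real mat \<Rightarrow> real" where
  "operator_norm A =
     Sup {euclidean_norm (A *\<^sub>v x) | x. x \<in> carrier_vec (dim_col A) \<and> euclidean_norm x = 1}"

definition frobenius_norm :: "real mat \<Rightarrow> real" where
  "frobenius_norm A = sqrt (\<Sum>i<dim_row A. \<Sum>j<dim_col A. (A $$ (i, j))\<^sup>2)"

text \<open>For the zero matrix this is \<open>0 / 0 = 0\<close>.\<close>

definition stable_rank :: "real mat \<Rightarrow> real" where
  "stable_rank A = (frobenius_norm A)\<^sup>2 / (operator_norm A)\<^sup>2"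

definition num_nonzero :: "'a::zero mat \<Rightarrow> nat" where
  "num_nonzero A = card {(i, j). i < dim_row A \<and> j < dim_col A \<and> A $$ (i, j) \<noteq> 0}"

text \<open>
  Algorithms on real data are programs for a real random access machine (the uniform model of
  Blum, Shub and Smale, with indirect addressing): memory cells hold exact real numbers, and an
  arithmetic operation or a comparison takes one step. Index registers hold natural numbers and
  serve as addresses and loop counters.

  The instruction set is kept weak so that counting steps is meaningful. There is no rounding and
  no conversion from cells to index registers. Index registers can only be added and subtracted,
  so in \<open>t\<close> steps they grow by at most a factor of \<open>2 ^ t\<close> over the input and the constants.
  The only real constants in a program are integers, and roots, exponentials and logarithms are
  not primitive.

  Operands other than constants and jump targets are numbers of index registers. An instruction on
  reals acts on the cells whose addresses are stored in these registers. Except in comparisons,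
  the first operand is the destination.
\<close>

datatype instr =
    ISet nat nat
  | IAdd nat nat nat
  | ISub nat nat nat
  | IJumpLess nat nat nat
  | RSet nat int
  | RCopy nat nat
  | RAdd nat nat nat
  | RSub nat nat nat
  | RMul nat nat nat
  | RDiv nat nat nat
  | RJumpLess nat nat nat
  | Jump nat

type_synonym program = "instr list"

record config =
  pc :: nat
  idx :: "nat \<Rightarrow> nat"
  mem :: "nat \<Rightarrow> real"

definition set_idx :: "nat \<Rightarrow> nat \<Rightarrow> config \<Rightarrow> config" where
  "set_idx a v s = s\<lparr>pc := Suc (pc s), idx := (idx s)(a := v)\<rparr>"

definition cell :: "config \<Rightarrow> nat \<Rightarrow> real" where
  "cell s a = mem s (idx s a)"

definition set_cell :: "nat \<Rightarrow> real \<Rightarrow> config \<Rightarrow> config" where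
  "set_cell a v s = s\<lparr>pc := Suc (pc s), mem := (mem s)(idx s a := v)\<rparr>"

definition branch :: "bool \<Rightarrow> nat \<Rightarrow> config \<Rightarrow> config" where
  "branch b l s = s\<lparr>pc := (if b then l else Suc (pc s))\<rparr>"

text \<open>
  Subtraction of indices is truncated and division by zero yields zero; both conventions can be
  replaced by others at the cost of one comparison.
\<close>

fun exec :: "instr \<Rightarrow> config \<Rightarrow> config" where
  "exec (ISet a k) s = set_idx a k s"
| "exec (IAdd a b c) s = set_idx a (idx s b + idx s c) s"
| "exec (ISub a b c) s = set_idx a (idx s b - idx s c) s"
| "exec (IJumpLess a b l) s = branch (idx s a < idx s b) l s"
| "exec (RSet a k) s = set_cell a (of_int k) s"
| "exec (RCopy a b) s = set_cell a (cell s b) s"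
| "exec (RAdd a b c) s = set_cell a (cell s b + cell s c) s"
| "exec (RSub a b c) s = set_cell a (cell s b - cell s c) s"
| "exec (RMul a b c) s = set_cell a (cell s b * cell s c) s"
| "exec (RDiv a b c) s = set_cell a (cell s b / cell s c) s"
| "exec (RJumpLess a b l) s = branch (cell s a < cell s b) l s"
| "exec (Jump l) s = branch True l s"

definition halted :: "program \<Rightarrow> config \<Rightarrow> bool" where
  "halted P s \<longleftrightarrow> length P \<le> pc s"

definition step :: "program \<Rightarrow> config \<Rightarrow> config" where
  "step P s = (if halted P s then s else exec (P ! pc s) s)"

text \<open>
  The input is presented as follows: index register \<open>0\<close> holds \<open>n\<close>, cell \<open>0\<close> holds \<open>\<epsilon>\<close> and the cells
  \<open>1, \<dots>, n\<^sup>2\<close> hold the entries of the matrix row by row; everything else is zero.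
  The output is read from the same cells \<open>1, \<dots>, n\<^sup>2\<close>.
\<close>

definition initial_config :: "nat \<Rightarrow> real mat \<Rightarrow> real \<Rightarrow> config" where
  "initial_config n A \<epsilon> =
     \<lparr>pc = 0,
      idx = (\<lambda>r. if r = 0 then n else 0),
      mem = (\<lambda>c. if c = 0 then \<epsilon>
                 else if c \<le> n * n then A $$ ((c - 1) div n, (c - 1) mod n)
                 else 0)\<rparr>"

definition output_mat :: "nat \<Rightarrow> config \<Rightarrow> real mat" where
  "output_mat n s = mat n n (\<lambda>(i, j). mem s (1 + i * n + j))"

definition outputs_within :: "program \<Rightarrow> nat \<Rightarrow> real mat \<Rightarrow> real \<Rightarrow> nat \<Rightarrow> real mat \<Rightarrow> bool" where
  "outputs_within P n A \<epsilon> t B \<longleftrightarrow>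
     (\<exists>k\<le>t. let s = (step P ^^ k) (initial_config n A \<epsilon>) in halted P s \<and> output_mat n s = B)"

end

theory Submission
  imports Defs
begin

text \<open>
  Let \<open>c\<^sub>j\<close> be the norm of the \<open>j\<close>-th column of \<open>A\<close> and \<open>F\<close> the Frobenius norm. The vectors
  \<open>c\<^sub>j (e\<^sub>i, (A\<^sub>i\<^sub>j / c\<^sub>j\<^sup>2) e\<^sub>j)\<close> in \<open>\<real>\<^sup>2\<^sup>n\<close> have rank-one matrices with off-diagonal
  block \<open>A\<^sub>i\<^sub>j e\<^sub>i e\<^sub>j\<^sup>T\<close>, and their sum is \<open>M = [F\<^sup>2 I, A; A\<^sup>T, I]\<close> (up to zero columns). So
  a sparse reweighted sum \<open>S\<close> with \<open>\<plusminus>(S - k M) \<le> u G + k \<alpha> M\<close>, where \<open>G = diag(F\<^sup>2 I, I)\<close>, yields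
  a sparse approximation of \<open>A\<close> with operator norm error \<open>(u / k + \<alpha>) F\<close>.

  Such a sum is found with the two barriers of Batson, Spielman and Srivastava: the potentials
  \<open>tr (M U\<^sup>-\<^sup>1)\<close> of \<open>U = u G + t (1 + \<alpha>) M - S\<close> and \<open>tr (M L\<^sup>-\<^sup>1)\<close> of \<open>L = u G - t (1 - \<alpha>) M + S\<close>
  are kept small. An averaging argument gives in every step a rank-one term that can be added without
  increasing the sum of the potentials. This needs about \<open>n (F / \<epsilon>\<parallel>A\<parallel>)\<^sup>2\<close> steps and no logarithm;
  the logarithm of the bound only absorbs the constant, and in small dimensions \<open>A\<close> itself is sparse
  enough. All quantities are rational in the input: inverses are maintained by the
  Sherman--Morrison formula, and \<open>\<parallel>A\<parallel> / F\<close> is estimated by testing multiples of \<open>G\<close> minus \<open>M\<close> for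
  positive definiteness with the same rank-one updates.
\<close>

section \<open>A structured language of array programs\<close>

text \<open>The integer r measures the accuracy. If the potentials sum to at most 1 / (r + 2),
  shifting both barriers leaves a sum T \<le> 1 / (r + 1), and the rates 1 + 1 / r and 1 - 1 / r are
  what the averaging tolerates: 1 / (1 - T) \<le> 1 + 1 / r and 1 / (1 + T) \<ge> 1 - 1 / r. With u
  = 4 n (r + 2) and k = 2 n r^2 the error (u / k + 1 / r) F is at most 4 F / r for r \<ge> 4, so r
  should be about 4 F / (\<epsilon> ||A||). As ||A|| is not a rational function of the entries, r is
  the first integer that a definiteness test rejects; it is at most 5 F / (\<epsilon> ||A||), whence
  2 n r^2 \<le> 50 n sr(A) / \<epsilon>^2. The factor 28 ln (sqrt (2 n)) = 14 ln (2 n) is at least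
  50 for n \<ge> 32. G carries F^2 in one block because a bound x^T C y \<le> K (F^2 |x|^2 + |y|^2),
  applied to t x and y / t for the best t, becomes 2 K F |x| |y|. The machine neither multiplies
  indices nor turns reals into indices. Hence the source language has only loops over 0, ..., n - 1,
  and searches and data-dependent step counts are expressed by flags and guards.\<close>

datatype rop = Plus | Minus | Times | Over

datatype rexp = Const int | Arr nat nat nat | Bin rop rexp rexp

text \<open>Positions in arrays are loop variables, and the only loop runs its variable through 0,
  ..., n - 1. Hence accesses stay in range, every program terminates, and its running time is
  bounded by a polynomial in n read off the syntax.\<close>

datatype com =
    Skip
  | Assign nat nat nat rexp
  | Seq com com
  | IfLess rexp rexp com com
  | For nat com

type_synonym store = "nat \<Rightarrow> nat \<Rightarrow> nat \<Rightarrow> real"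

fun rop_fun :: "rop \<Rightarrow> real \<Rightarrow> real \<Rightarrow> real" where
  "rop_fun Plus x y = x + y"
| "rop_fun Minus x y = x - y"
| "rop_fun Times x y = x * y"
| "rop_fun Over x y = x / y"

primrec rval :: "(nat \<Rightarrow> nat) \<Rightarrow> store \<Rightarrow> rexp \<Rightarrow> real" where
  "rval \<rho> \<sigma> (Const z) = of_int z"
| "rval \<rho> \<sigma> (Arr k p q) = \<sigma> k (\<rho> p) (\<rho> q)"
| "rval \<rho> \<sigma> (Bin f e1 e2) = rop_fun f (rval \<rho> \<sigma> e1) (rval \<rho> \<sigma> e2)"

definition upd :: "nat \<Rightarrow> nat \<Rightarrow> nat \<Rightarrow> real \<Rightarrow> store \<Rightarrow> store" where
  "upd k p q v \<sigma> = \<sigma>(k := (\<sigma> k)(p := (\<sigma> k p)(q := v)))"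

primrec sem :: "com \<Rightarrow> nat \<Rightarrow> (nat \<Rightarrow> nat) \<Rightarrow> store \<Rightarrow> store" where
  "sem Skip n \<rho> \<sigma> = \<sigma>"
| "sem (Assign k p q e) n \<rho> \<sigma> = upd k (\<rho> p) (\<rho> q) (rval \<rho> \<sigma> e) \<sigma>"
| "sem (Seq c1 c2) n \<rho> \<sigma> = sem c2 n \<rho> (sem c1 n \<rho> \<sigma>)"
| "sem (IfLess e1 e2 c1 c2) n \<rho> \<sigma> =
     (if rval \<rho> \<sigma> e1 < rval \<rho> \<sigma> e2 then sem c1 n \<rho> \<sigma> else sem c2 n \<rho> \<sigma>)"
| "sem (For i c) n \<rho> \<sigma> = fold (\<lambda>m. sem c n (\<rho>(i := m))) [0..<n] \<sigma>"

primrec rvars :: "rexp \<Rightarrow> nat set" where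
  "rvars (Const z) = {}"
| "rvars (Arr k p q) = {p, q}"
| "rvars (Bin f e1 e2) = rvars e1 \<union> rvars e2"

text \<open>\<open>V\<close> is the set of variables in scope. A loop variable must be fresh because
  its two registers would otherwise be overwritten while an enclosing loop still uses them.\<close>

primrec wf_com :: "nat set \<Rightarrow> com \<Rightarrow> bool" where
  "wf_com V Skip = True"
| "wf_com V (Assign k p q e) = (p \<in> V \<and> q \<in> V \<and> rvars e \<subseteq> V)"
| "wf_com V (Seq c1 c2) = (wf_com V c1 \<and> wf_com V c2)"
| "wf_com V (IfLess e1 e2 c1 c2) = (rvars e1 \<subseteq> V \<and> rvars e2 \<subseteq> V \<and> wf_com V c1 \<and> wf_com V c2)"
| "wf_com V (For i c) = (i \<notin> V \<and> wf_com (insert i V) c)"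

section \<open>Compilation to the random access machine\<close>

text \<open>
  Index registers 0, 1, 2 hold \<open>n\<close>, \<open>1\<close> and \<open>n\<^sup>2\<close>; registers 3 and 4 hold addresses; loop variable
  \<open>i\<close> occupies register \<open>6 + 2i\<close> and register \<open>7 + 2i\<close> holds \<open>n\<close> times its value, so that
  addresses need no multiplication. Array \<open>k\<close> is the block with number \<open>2k\<close> of size \<open>n\<^sup>2\<close>; the
  blocks with odd numbers form the evaluation stack.
\<close>

definition lay :: "nat \<Rightarrow> nat \<Rightarrow> nat \<Rightarrow> nat \<Rightarrow> nat" where
  "lay n k p q = 1 + k * (n * n) + p * n + q"

definition load_block :: "nat \<Rightarrow> nat \<Rightarrow> program" where
  "load_block a k = ISet a 1 # replicate k (IAdd a a 2)"

definition load_entry :: "nat \<Rightarrow> nat \<Rightarrow> nat \<Rightarrow> nat \<Rightarrow> program" where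
  "load_entry a k p q = load_block a (2 * k) @ [IAdd a a (7 + 2 * p), IAdd a a (6 + 2 * q)]"

fun rop_instr :: "rop \<Rightarrow> nat \<Rightarrow> nat \<Rightarrow> nat \<Rightarrow> instr" where
  "rop_instr Plus = RAdd"
| "rop_instr Minus = RSub"
| "rop_instr Times = RMul"
| "rop_instr Over = RDiv"

text \<open>\<open>d\<close> is the stack depth. The value is left in the first cell of block
  \<open>2 * d + 1\<close>; code for depth \<open>d\<close> writes to no stack block of smaller
  depth, so the left operand survives the evaluation of the right one.\<close>

primrec compile_rexp :: "rexp \<Rightarrow> nat \<Rightarrow> program" where
  "compile_rexp (Const z) d = load_block 3 (2 * d + 1) @ [RSet 3 z]"
| "compile_rexp (Arr k p q) d = load_block 3 (2 * d + 1) @ load_entry 4 k p q @ [RCopy 3 4]"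
| "compile_rexp (Bin f e1 e2) d =
     compile_rexp e1 d @ compile_rexp e2 (Suc d) @
     load_block 3 (2 * d + 1) @ load_block 4 (2 * Suc d + 1) @ [rop_instr f 3 3 4]"

text \<open>Jump targets are absolute, and forward jumps need the size of code not yet produced; so
  the length is defined first, independently of the base address.\<close>

primrec compile_len :: "com \<Rightarrow> nat" where
  "compile_len Skip = 0"
| "compile_len (Assign k p q e) =
     length (compile_rexp e 0 @ load_entry 3 k p q @ load_block 4 1 @ [RCopy 3 4])"
| "compile_len (Seq c1 c2) = compile_len c1 + compile_len c2"
| "compile_len (IfLess e1 e2 c1 c2) =
     length (compile_rexp e1 0 @ compile_rexp e2 1 @ load_block 3 1 @ load_block 4 3)
     + compile_len c1 + compile_len c2 + 2"
| "compile_len (For i c) = compile_len c + 7"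

text \<open>\<open>b\<close> is the absolute address of the first instruction. In a conditional the
  else branch comes first, because the jump is taken when the comparison holds; in a loop
  \<open>b + 2\<close> is the test and \<open>b + 4\<close> the start of the body.\<close>

primrec compile :: "com \<Rightarrow> nat \<Rightarrow> program" where
  "compile Skip b = []"
| "compile (Assign k p q e) b = compile_rexp e 0 @ load_entry 3 k p q @ load_block 4 1 @ [RCopy 3 4]"
| "compile (Seq c1 c2) b = compile c1 b @ compile c2 (b + compile_len c1)"
| "compile (IfLess e1 e2 c1 c2) b =
     (let t = compile_rexp e1 0 @ compile_rexp e2 1 @ load_block 3 1 @ load_block 4 3;
          b2 = b + length t + 1; b1 = b2 + compile_len c2 + 1
      in t @ [RJumpLess 3 4 b1] @ compile c2 b2 @ [Jump (b1 + compile_len c1)] @ compile c1 b1)"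
| "compile (For i c) b =
     [ISet (6 + 2 * i) 0, ISet (7 + 2 * i) 0, IJumpLess (6 + 2 * i) 0 (b + 4),
      Jump (b + compile_len c + 7)] @ compile c (b + 4) @
     [IAdd (6 + 2 * i) (6 + 2 * i) 1, IAdd (7 + 2 * i) (7 + 2 * i) 0, Jump (b + 2)]"

text \<open>Only an upper bound: both branches of a conditional are charged. A loop takes two steps
  to initialise, two to leave, and per round one for the test and three for the increments and the
  jump back.\<close>

primrec cost :: "com \<Rightarrow> nat poly" where
  "cost Skip = 0"
| "cost (Assign k p q e) = [:compile_len (Assign k p q e):]"
| "cost (Seq c1 c2) = cost c1 + cost c2"
| "cost (IfLess e1 e2 c1 c2) =
     [:length (compile_rexp e1 0 @ compile_rexp e2 1 @ load_block 3 1 @ load_block 4 3) + 2:]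
     + cost c1 + cost c2"
| "cost (For i c) = [:4:] + [:0, 1:] * (cost c + [:4:])"

lemma length_compile: "length (compile c b) = compile_len c"
  by (induction c arbitrary: b) (auto simp: Let_def)

definition code_at :: "program \<Rightarrow> nat \<Rightarrow> program \<Rightarrow> bool" where
  "code_at P b xs \<longleftrightarrow> (\<forall>j < length xs. b + j < length P \<and> P ! (b + j) = xs ! j)"

lemma code_at_Nil [simp]: "code_at P b []"
  by (simp add: code_at_def)

lemma code_at_Cons [simp]:
  "code_at P b (x # xs) \<longleftrightarrow> b < length P \<and> P ! b = x \<and> code_at P (Suc b) xs"
  by (auto simp: code_at_def less_Suc_eq_0_disj nth_Cons')

lemma code_at_append [simp]:
  "code_at P b (xs @ ys) \<longleftrightarrow> code_at P b xs \<and> code_at P (b + length xs) ys"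
  by (induction xs arbitrary: b) auto

lemma code_at_self: "code_at (xs @ P @ ys) (length xs) P"
  by (auto simp: code_at_def nth_append)

primrec straight :: "instr \<Rightarrow> bool" where
  "straight (ISet a k) = True"
| "straight (IAdd a b c) = True"
| "straight (ISub a b c) = True"
| "straight (IJumpLess a b l) = False"
| "straight (RSet a z) = True"
| "straight (RCopy a b) = True"
| "straight (RAdd a b c) = True"
| "straight (RSub a b c) = True"
| "straight (RMul a b c) = True"
| "straight (RDiv a b c) = True"
| "straight (RJumpLess a b l) = False"
| "straight (Jump l) = False"

lemma pc_exec: "straight x \<Longrightarrow> pc (exec x s) = Suc (pc s)"
  by (cases x) (auto simp: set_idx_def set_cell_def)

lemma pc_fold_exec: "\<forall>x \<in> set xs. straight x \<Longrightarrow> pc (fold exec xs s) = pc s + length xs"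
  by (induction xs arbitrary: s) (auto simp: pc_exec)

lemma step_exec: "pc s < length P \<Longrightarrow> step P s = exec (P ! pc s) s"
  by (simp add: step_def halted_def)

lemma funpow_step_straight:
  assumes "\<forall>x \<in> set xs. straight x" "code_at P (pc s) xs"
  shows "(step P ^^ length xs) s = fold exec xs s"
  using assms
proof (induction xs arbitrary: s)
  case (Cons x xs)
  have "(step P ^^ length xs) (exec x s) = fold exec xs (exec x s)"
    using Cons by (intro Cons.IH) (auto simp: pc_exec)
  then show ?case
    using Cons.prems by (simp del: funpow.simps add: funpow_Suc_right step_exec)
qed simp

lemma straight_load_block: "\<forall>x \<in> set (load_block a k). straight x"
  by (auto simp: load_block_def)

lemma straight_load_entry: "\<forall>x \<in> set (load_entry a k p q). straight x"
  using straight_load_block by (auto simp: load_entry_def)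

lemma straight_compile_rexp: "\<forall>x \<in> set (compile_rexp e d). straight x"
proof (induction e arbitrary: d)
  case (Bin f e1 e2)
  moreover have "straight (rop_instr f 3 3 4)"
    by (cases f) auto
  ultimately show ?case
    using straight_load_block by auto
qed (use straight_load_block straight_load_entry in auto)

text \<open>Nothing is said about the program counter, the address registers 3 and 4 and the blocks
  with odd numbers, so address computations and stack operations preserve this relation.\<close>

definition matches :: "nat \<Rightarrow> nat set \<Rightarrow> (nat \<Rightarrow> nat) \<Rightarrow> store \<Rightarrow> config \<Rightarrow> bool" where
  "matches n V \<rho> \<sigma> s \<longleftrightarrow>
     idx s 0 = n \<and> idx s 1 = 1 \<and> idx s 2 = n * n \<and>
     (\<forall>i \<in> V. \<rho> i < n \<and> idx s (6 + 2 * i) = \<rho> i \<and> idx s (7 + 2 * i) = \<rho> i * n) \<and>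
     (\<forall>k p q. p < n \<longrightarrow> q < n \<longrightarrow> mem s (lay n (2 * k) p q) = \<sigma> k p q)"

text \<open>Since p * n + q < n * n, division by n * n separates the block number from the position
  inside the block, and division by n separates row from column.\<close>

lemma lay_inject:
  assumes "p < n" "q < n" "p' < n" "q' < n"
  shows "lay n k p q = lay n k' p' q' \<longleftrightarrow> k = k' \<and> p = p' \<and> q = q'"
proof
  assume eq: "lay n k p q = lay n k' p' q'"
  have *: "p * n + q < n * n" if "p < n" "q < n" for p q
  proof -
    have "p * n + q < Suc p * n" using that by simp
    also have "\<dots> \<le> n * n" using that by (intro mult_right_mono) auto
    finally show ?thesis .
  qed
  have "k * (n * n) + (p * n + q) = k' * (n * n) + (p' * n + q')"
    using eq by (simp add: lay_def)
  then have "(k * (n * n) + (p * n + q)) div (n * n) = (k' * (n * n) + (p' * n + q')) div (n * n)"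
    "(k * (n * n) + (p * n + q)) mod (n * n) = (k' * (n * n) + (p' * n + q')) mod (n * n)"
    by simp_all
  then have "k = k'" "p * n + q = p' * n + q'"
    using *[OF assms(1,2)] *[OF assms(3,4)] assms by auto
  then have "(p * n + q) div n = (p' * n + q') div n" "(p * n + q) mod n = (p' * n + q') mod n"
    by simp_all
  then show "k = k' \<and> p = p' \<and> q = q'"
    using assms \<open>k = k'\<close> by auto
qed auto

lemma fold_load_block:
  assumes "idx s 2 = n * n" "a \<noteq> 2"
  shows "fold exec (load_block a k) s =
    s\<lparr>pc := pc s + length (load_block a k), idx := (idx s)(a := lay n k 0 0)\<rparr>"
proof -
  have "fold exec (replicate k (IAdd a a 2)) t =
      t\<lparr>pc := pc t + k, idx := (idx t)(a := idx t a + k * (n * n))\<rparr>"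
    if "idx t 2 = n * n" for t
    using that
  proof (induction k arbitrary: t)
    case (Suc k)
    then show ?case using assms by (cases t) (simp add: set_idx_def fun_eq_iff)
  qed simp
  then show ?thesis
    using assms by (simp add: load_block_def set_idx_def lay_def)
qed

lemma fold_load_entry:
  assumes "matches n V \<rho> \<sigma> s" "p \<in> V" "q \<in> V" "a \<in> {3, 4}"
  shows "fold exec (load_entry a k p q) s =
    s\<lparr>pc := pc s + length (load_entry a k p q), idx := (idx s)(a := lay n (2 * k) (\<rho> p) (\<rho> q))\<rparr>"
proof -
  have "idx s 2 = n * n" "a \<noteq> 2" "a \<noteq> 7 + 2 * p" "a \<noteq> 6 + 2 * q"
    "idx s (6 + 2 * q) = \<rho> q" "idx s (7 + 2 * p) = \<rho> p * n"
    using assms by (auto simp: matches_def)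
  then show ?thesis
    by (simp add: load_entry_def fold_load_block set_idx_def lay_def)
qed

lemma matches_addr [simp]:
  "a \<in> {3, 4} \<Longrightarrow> matches n V \<rho> \<sigma> (s\<lparr>pc := x, idx := (idx s)(a := y)\<rparr>) = matches n V \<rho> \<sigma> s"
  by (auto simp: matches_def)

lemma matches_pc [simp]: "matches n V \<rho> \<sigma> (s\<lparr>pc := x\<rparr>) = matches n V \<rho> \<sigma> s"
  by (auto simp: matches_def)

lemma matches_stack [simp]:
  assumes "n \<ge> 1"
  shows "matches n V \<rho> \<sigma> (s\<lparr>mem := (mem s)(lay n (Suc (2 * d)) 0 0 := y)\<rparr>) = matches n V \<rho> \<sigma> s"
proof -
  have "lay n (2 * k) p q \<noteq> lay n (Suc (2 * d)) 0 0" if "p < n" "q < n" for k p q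
    using that assms by (subst lay_inject) presburger+
  then show ?thesis by (auto simp: matches_def)
qed

text \<open>The last claim is what makes binary operations work in the induction: evaluating the
  second operand at depth \<open>Suc d\<close> must not destroy the first one at depth
  \<open>d\<close>. It serves once more for the two sides of a conditional.\<close>

lemma fold_compile_rexp:
  fixes d :: nat
  assumes "n \<ge> 1" "matches n V \<rho> \<sigma> s" "rvars e \<subseteq> V"
  defines "s' \<equiv> fold exec (compile_rexp e d) s"
  shows "matches n V \<rho> \<sigma> s'"
    and "mem s' (lay n (Suc (2 * d)) 0 0) = rval \<rho> \<sigma> e"
    and "\<And>d'. d' < d \<Longrightarrow> mem s' (lay n (Suc (2 * d')) 0 0) = mem s (lay n (Suc (2 * d')) 0 0)"
proof -
  have "matches n V \<rho> \<sigma> (fold exec (compile_rexp e d) s) \<and>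
    mem (fold exec (compile_rexp e d) s) (lay n (Suc (2 * d)) 0 0) = rval \<rho> \<sigma> e \<and>
    (\<forall>d'<d. mem (fold exec (compile_rexp e d) s) (lay n (Suc (2 * d')) 0 0) =
      mem s (lay n (Suc (2 * d')) 0 0))"
    using assms(2,3)
  proof (induction e arbitrary: s d)
    case (Const z)
    define s1 where "s1 = fold exec (load_block 3 (Suc (2 * d))) s"
    have s1: "s1 = s\<lparr>pc := pc s + length (load_block 3 (Suc (2 * d))), idx := (idx s)(3 := lay n (Suc (2 * d)) 0 0)\<rparr>"
      using Const by (simp add: s1_def fold_load_block matches_def)
    have m1: "matches n V \<rho> \<sigma> s1"
      using Const by (simp add: s1)
    have i1: "idx s1 3 = lay n (Suc (2 * d)) 0 0" "mem s1 = mem s"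
      by (simp_all add: s1)
    have "fold exec (compile_rexp (Const z) d) s = set_cell 3 (of_int z) s1"
      by (simp add: s1_def)
    also have "\<dots> = s1\<lparr>mem := (mem s1)(lay n (Suc (2 * d)) 0 0 := of_int z)\<rparr>\<lparr>pc := Suc (pc s1)\<rparr>"
      by (simp add: set_cell_def i1)
    finally show ?case
      using assms(1) m1 matches_stack[OF assms(1), of V \<rho> \<sigma> s1 d "of_int z"]
      by (auto simp: i1 lay_inject[of 0 n 0 0 0])
  next
    case (Arr k p q)
    then have *: "idx s 2 = n * n" "\<rho> p < n" "\<rho> q < n" "mem s (lay n (2 * k) (\<rho> p) (\<rho> q)) = \<sigma> k (\<rho> p) (\<rho> q)"
      by (auto simp: matches_def)
    define s1 where "s1 = fold exec (load_block 3 (Suc (2 * d))) s"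
    have s1: "s1 = s\<lparr>pc := pc s + length (load_block 3 (Suc (2 * d))), idx := (idx s)(3 := lay n (Suc (2 * d)) 0 0)\<rparr>"
      using * by (simp add: s1_def fold_load_block)
    have m1: "matches n V \<rho> \<sigma> s1"
      using Arr by (simp add: s1)
    define s2 where "s2 = fold exec (load_entry 4 k p q) s1"
    have s2: "s2 = s1\<lparr>pc := pc s1 + length (load_entry 4 k p q), idx := (idx s1)(4 := lay n (2 * k) (\<rho> p) (\<rho> q))\<rparr>"
      unfolding s2_def using Arr by (intro fold_load_entry[OF m1]) auto
    have m2: "matches n V \<rho> \<sigma> s2"
      using m1 by (simp add: s2)
    have i2: "idx s2 3 = lay n (Suc (2 * d)) 0 0" "idx s2 4 = lay n (2 * k) (\<rho> p) (\<rho> q)" "mem s2 = mem s"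
      by (simp_all add: s2 s1)
    have "fold exec (compile_rexp (Arr k p q) d) s = set_cell 3 (\<sigma> k (\<rho> p) (\<rho> q)) s2"
      using * i2 by (simp add: s1_def s2_def cell_def)
    also have "\<dots> = s2\<lparr>mem := (mem s2)(lay n (Suc (2 * d)) 0 0 := \<sigma> k (\<rho> p) (\<rho> q))\<rparr>\<lparr>pc := Suc (pc s2)\<rparr>"
      by (simp add: set_cell_def i2)
    finally show ?case
      using assms(1) m2 matches_stack[OF assms(1), of V \<rho> \<sigma> s2 d "\<sigma> k (\<rho> p) (\<rho> q)"]
      by (auto simp: i2 lay_inject[of 0 n 0 0 0])
  next
    case (Bin f e1 e2)
    define s1 where "s1 = fold exec (compile_rexp e1 d) s"
    define s2 where "s2 = fold exec (compile_rexp e2 (Suc d)) s1"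
    have 1: "matches n V \<rho> \<sigma> s1" "mem s1 (lay n (Suc (2 * d)) 0 0) = rval \<rho> \<sigma> e1"
      "\<forall>d'<d. mem s1 (lay n (Suc (2 * d')) 0 0) = mem s (lay n (Suc (2 * d')) 0 0)"
      using Bin.IH(1)[of s d] Bin.prems by (auto simp: s1_def)
    have 2: "matches n V \<rho> \<sigma> s2" "mem s2 (lay n (Suc (2 * Suc d)) 0 0) = rval \<rho> \<sigma> e2"
      "\<forall>d'<Suc d. mem s2 (lay n (Suc (2 * d')) 0 0) = mem s1 (lay n (Suc (2 * d')) 0 0)"
      using Bin.IH(2)[of s1 "Suc d"] Bin.prems 1 by (auto simp: s2_def)
    define s3 where "s3 = fold exec (load_block 3 (Suc (2 * d))) s2"
    have s3: "s3 = s2\<lparr>pc := pc s2 + length (load_block 3 (Suc (2 * d))), idx := (idx s2)(3 := lay n (Suc (2 * d)) 0 0)\<rparr>"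
      using 2(1) by (simp add: s3_def fold_load_block matches_def)
    define s4 where "s4 = fold exec (load_block 4 (Suc (2 * Suc d))) s3"
    have "idx s3 2 = n * n" using 2(1) by (simp add: s3 matches_def)
    then have s4: "s4 = s3\<lparr>pc := pc s3 + length (load_block 4 (Suc (2 * Suc d))), idx := (idx s3)(4 := lay n (Suc (2 * Suc d)) 0 0)\<rparr>"
      unfolding s4_def by (subst fold_load_block) auto
    have "matches n V \<rho> \<sigma> s3" using 2(1) by (simp add: s3)
    then have m4: "matches n V \<rho> \<sigma> s4" by (simp add: s4)
    have i4: "idx s4 3 = lay n (Suc (2 * d)) 0 0" "idx s4 4 = lay n (Suc (2 * Suc d)) 0 0" "mem s4 = mem s2"
      by (simp_all add: s4 s3)
    have ex: "exec (rop_instr f 3 3 4) s4 = set_cell 3 (rop_fun f (cell s4 3) (cell s4 4)) s4"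
      by (cases f) auto
    have "fold exec (compile_rexp (Bin f e1 e2) d) s = exec (rop_instr f 3 3 4) s4"
      by (simp add: s1_def s2_def s3_def s4_def)
    also have "\<dots> = set_cell 3 (rval \<rho> \<sigma> (Bin f e1 e2)) s4"
      using 1 2 unfolding ex by (simp add: cell_def i4)
    also have "\<dots> = s4\<lparr>mem := (mem s4)(lay n (Suc (2 * d)) 0 0 := rval \<rho> \<sigma> (Bin f e1 e2))\<rparr>\<lparr>pc := Suc (pc s4)\<rparr>"
      by (simp add: set_cell_def i4)
    finally show ?case
      using assms(1) m4 1 2 matches_stack[OF assms(1), of V \<rho> \<sigma> s4 d "rval \<rho> \<sigma> (Bin f e1 e2)"]
      by (auto simp: i4 lay_inject[of 0 n 0 0 0])
  qed
  then show "matches n V \<rho> \<sigma> s'"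
    and "mem s' (lay n (Suc (2 * d)) 0 0) = rval \<rho> \<sigma> e"
    and "\<And>d'. d' < d \<Longrightarrow> mem s' (lay n (Suc (2 * d')) 0 0) = mem s (lay n (Suc (2 * d')) 0 0)"
    by (auto simp: s'_def)
qed

lemma matches_upd:
  assumes "matches n V \<rho> \<sigma> s" "p < n" "q < n"
  shows "matches n V \<rho> (upd k p q v \<sigma>) (s\<lparr>mem := (mem s)(lay n (2 * k) p q := v)\<rparr>)"
  using assms by (auto simp: matches_def upd_def lay_inject)

definition runs :: "program \<Rightarrow> nat \<Rightarrow> config \<Rightarrow> config \<Rightarrow> bool" where
  "runs P t s s' \<longleftrightarrow> (\<exists>k\<le>t. (step P ^^ k) s = s')"

lemma runs_refl: "runs P t s s"
  unfolding runs_def by (intro exI[of _ 0]) auto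

lemma runs_trans: "runs P t s s' \<Longrightarrow> runs P t' s' s'' \<Longrightarrow> runs P (t + t') s s''"
  unfolding runs_def
proof safe
  fix k k' assume "k \<le> t" "k' \<le> t'"
  then show "\<exists>j\<le>t + t'. (step P ^^ j) s = (step P ^^ k') ((step P ^^ k) s)"
    by (intro exI[of _ "k' + k"]) (auto simp: funpow_add)
qed

lemma runs_mono: "runs P t s s' \<Longrightarrow> t \<le> t' \<Longrightarrow> runs P t' s s'"
  unfolding runs_def using order_trans by blast

lemma runs_step: "pc s < length P \<Longrightarrow> runs P 1 s (exec (P ! pc s) s)"
  unfolding runs_def by (intro exI[of _ 1]) (auto simp: step_exec)

lemma runs_straight:
  assumes "\<forall>x \<in> set xs. straight x" "code_at P (pc s) xs"
  shows "runs P (length xs) s (fold exec xs s)"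
  unfolding runs_def using funpow_step_straight[OF assms] by auto

definition executes :: "program \<Rightarrow> nat \<Rightarrow> nat \<Rightarrow> nat set \<Rightarrow> (nat \<Rightarrow> nat) \<Rightarrow> store \<Rightarrow> nat \<Rightarrow> config \<Rightarrow> bool" where
  "executes P t n V \<rho> \<sigma> b s \<longleftrightarrow> (\<exists>s'. runs P t s s' \<and> pc s' = b \<and> matches n V \<rho> \<sigma> s')"

lemma executes_mono: "executes P t n V \<rho> \<sigma> b s \<Longrightarrow> t \<le> t' \<Longrightarrow> executes P t' n V \<rho> \<sigma> b s"
  unfolding executes_def using runs_mono by blast

lemma runs_executes: "runs P t s s' \<Longrightarrow> executes P t' n V \<rho> \<sigma> b s' \<Longrightarrow> executes P (t + t') n V \<rho> \<sigma> b s"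
  unfolding executes_def using runs_trans by blast

text \<open>Simulation by induction on the program, for all start addresses, scopes and stores at
  once. The two registers of a loop variable are covered by the relation only inside the body, where
  the variable is in scope.\<close>

lemma compile_correct:
  assumes "n \<ge> 1" "wf_com V c" "matches n V \<rho> \<sigma> s" "code_at P (pc s) (compile c (pc s))"
  shows "executes P (poly (cost c) n) n V \<rho> (sem c n \<rho> \<sigma>) (pc s + compile_len c) s"
  using assms(2-)
proof (induction c arbitrary: V \<rho> \<sigma> s)
  case Skip
  then show ?case by (auto simp: executes_def intro: runs_refl)
next
  case (Assign k p q e)
  define s1 where "s1 = fold exec (compile_rexp e 0) s"
  define s2 where "s2 = fold exec (load_entry 3 k p q) s1"
  define s3 where "s3 = fold exec (load_block 4 1) s2"
  have m1: "matches n V \<rho> \<sigma> s1" and v1: "mem s1 (lay n 1 0 0) = rval \<rho> \<sigma> e"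
    using fold_compile_rexp[of n V \<rho> \<sigma> s e 0] assms(1) Assign by (auto simp: s1_def)
  have s2: "s2 = s1\<lparr>pc := pc s1 + length (load_entry 3 k p q), idx := (idx s1)(3 := lay n (2 * k) (\<rho> p) (\<rho> q))\<rparr>"
    unfolding s2_def using Assign by (intro fold_load_entry[OF m1]) auto
  have "idx s2 2 = n * n" using m1 by (simp add: s2 matches_def)
  then have s3: "s3 = s2\<lparr>pc := pc s2 + length (load_block 4 1), idx := (idx s2)(4 := lay n 1 0 0)\<rparr>"
    unfolding s3_def by (subst fold_load_block) auto
  have m2: "matches n V \<rho> \<sigma> s2" using m1 by (simp add: s2)
  then have m3: "matches n V \<rho> \<sigma> s3" by (simp add: s3)
  have i3: "idx s3 3 = lay n (2 * k) (\<rho> p) (\<rho> q)" "idx s3 4 = lay n 1 0 0" "mem s3 = mem s1"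
    by (simp_all add: s3 s2)
  let ?xs = "compile (Assign k p q e) (pc s)"
  have "fold exec ?xs s = set_cell 3 (rval \<rho> \<sigma> e) s3"
    using v1 by (simp add: s1_def[symmetric] s2_def[symmetric] s3_def[symmetric, simplified] i3[simplified] cell_def)
  also have "\<dots> = s3\<lparr>mem := (mem s3)(lay n (2 * k) (\<rho> p) (\<rho> q) := rval \<rho> \<sigma> e)\<rparr>\<lparr>pc := Suc (pc s3)\<rparr>"
    by (simp add: set_cell_def i3)
  finally have "matches n V \<rho> (sem (Assign k p q e) n \<rho> \<sigma>) (fold exec ?xs s)"
    using matches_upd[OF m3, of "\<rho> p" "\<rho> q"] Assign.prems by (auto simp: matches_def)
  moreover have str: "\<forall>x \<in> set ?xs. straight x"
    using straight_compile_rexp straight_load_block straight_load_entry by auto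
  moreover have "length ?xs = compile_len (Assign k p q e)"
    by (rule length_compile)
  ultimately show ?case
    using runs_straight[OF str] Assign.prems pc_fold_exec[OF str]
    unfolding executes_def by (intro exI[of _ "fold exec ?xs s"]) auto
next
  case (Seq c1 c2)
  have "executes P (poly (cost c1) n) n V \<rho> (sem c1 n \<rho> \<sigma>) (pc s + compile_len c1) s"
    using Seq.prems by (intro Seq.IH) auto
  then obtain s1 where s1: "runs P (poly (cost c1) n) s s1" "pc s1 = pc s + compile_len c1"
    "matches n V \<rho> (sem c1 n \<rho> \<sigma>) s1"
    by (auto simp: executes_def)
  have "executes P (poly (cost c2) n) n V \<rho> (sem c2 n \<rho> (sem c1 n \<rho> \<sigma>)) (pc s1 + compile_len c2) s1"
    using Seq.prems s1 by (intro Seq.IH) (auto simp: length_compile)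
  with runs_executes[OF s1(1)] show ?case
    using s1(2) by (fastforce simp: add.assoc)
next
  case (IfLess e1 e2 c1 c2)
  define s1 where "s1 = fold exec (compile_rexp e1 0) s"
  define s2 where "s2 = fold exec (compile_rexp e2 1) s1"
  define s3 where "s3 = fold exec (load_block 3 1) s2"
  define s4 where "s4 = fold exec (load_block 4 3) s3"
  have m1: "matches n V \<rho> \<sigma> s1" and v1: "mem s1 (lay n 1 0 0) = rval \<rho> \<sigma> e1"
    using fold_compile_rexp[of n V \<rho> \<sigma> s e1 0] assms(1) IfLess.prems by (auto simp: s1_def)
  have m2: "matches n V \<rho> \<sigma> s2" and v2: "mem s2 (lay n 3 0 0) = rval \<rho> \<sigma> e2"
     and v21: "mem s2 (lay n 1 0 0) = rval \<rho> \<sigma> e1"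
    using fold_compile_rexp(1)[of n V \<rho> \<sigma> s1 e2 1] fold_compile_rexp(2)[of n V \<rho> \<sigma> s1 e2 1]
      fold_compile_rexp(3)[of n V \<rho> \<sigma> s1 e2 0 1] assms(1) IfLess.prems(1) m1 v1
    unfolding s2_def[symmetric] by (simp_all add: numeral_3_eq_3)
  have "idx s2 2 = n * n" using m2 by (simp add: matches_def)
  then have s3: "s3 = s2\<lparr>pc := pc s2 + length (load_block 3 1), idx := (idx s2)(3 := lay n 1 0 0)\<rparr>"
    unfolding s3_def by (subst fold_load_block) auto
  have "idx s3 2 = n * n" using m2 by (simp add: s3 matches_def)
  then have s4: "s4 = s3\<lparr>pc := pc s3 + length (load_block 4 3), idx := (idx s3)(4 := lay n 3 0 0)\<rparr>"
    unfolding s4_def by (subst fold_load_block) auto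
  have m3: "matches n V \<rho> \<sigma> s3" using m2 by (simp add: s3)
  then have m4: "matches n V \<rho> \<sigma> s4" by (simp add: s4)
  have i4: "idx s4 3 = lay n 1 0 0" "idx s4 4 = lay n 3 0 0" "mem s4 = mem s2"
    by (simp_all add: s4 s3)
  define xs where "xs = compile_rexp e1 0 @ compile_rexp e2 1 @ load_block 3 1 @ load_block 4 3"
  define b2 where "b2 = pc s + length xs + 1"
  define b1 where "b1 = b2 + compile_len c2 + 1"
  have code: "code_at P (pc s) xs" "pc s + length xs < length P"
    "P ! (pc s + length xs) = RJumpLess 3 4 b1"
    "code_at P b2 (compile c2 b2)" "b2 + compile_len c2 < length P" "P ! (b2 + compile_len c2) = Jump (b1 + compile_len c1)"
    "code_at P b1 (compile c1 b1)"
    using IfLess.prems(3)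
    by (simp_all add: Let_def xs_def[symmetric, simplified] b2_def[symmetric, simplified]
          b1_def[symmetric, simplified] length_compile add.assoc)
       (simp_all add: Let_def xs_def b2_def b1_def length_compile add.assoc)
  have xs4: "s4 = fold exec xs s"
    by (simp add: xs_def s1_def s2_def s3_def s4_def)
  have str: "\<forall>x \<in> set xs. straight x"
    using straight_compile_rexp straight_load_block by (auto simp: xs_def)
  have r4: "runs P (length xs) s s4" and pc4: "pc s4 = pc s + length xs"
    using runs_straight[OF str code(1)] pc_fold_exec[OF str] by (simp_all add: xs4)
  define s5 where "s5 = exec (RJumpLess 3 4 b1) s4"
  have "runs P 1 s4 s5"
    using runs_step[of s4 P] code(2,3) pc4 by (simp add: s5_def)
  with r4 have r5: "runs P (length xs + 1) s s5"
    by (rule runs_trans)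
  have s5: "s5 = s4\<lparr>pc := (if rval \<rho> \<sigma> e1 < rval \<rho> \<sigma> e2 then b1 else b2)\<rparr>"
    using v21 v2 i4 pc4 by (simp add: s5_def branch_def cell_def b2_def)
  have m5: "matches n V \<rho> \<sigma> s5" using m4 by (simp add: s5)
  have len: "pc s + compile_len (IfLess e1 e2 c1 c2) = b1 + compile_len c1"
    by (simp add: b1_def b2_def xs_def)
  have cst: "poly (cost (IfLess e1 e2 c1 c2)) n = length xs + 2 + poly (cost c1) n + poly (cost c2) n"
    by (simp add: xs_def)
  show ?case
  proof (cases "rval \<rho> \<sigma> e1 < rval \<rho> \<sigma> e2")
    case True
    have "executes P (poly (cost c1) n) n V \<rho> (sem c1 n \<rho> \<sigma>) (pc s5 + compile_len c1) s5"
      using IfLess.prems m5 True code by (intro IfLess.IH) (auto simp: s5)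
    from runs_executes[OF r5 this] show ?thesis
      using True unfolding len cst by (auto simp: s5 elim!: executes_mono)
  next
    case False
    have "executes P (poly (cost c2) n) n V \<rho> (sem c2 n \<rho> \<sigma>) (pc s5 + compile_len c2) s5"
      using IfLess.prems m5 False code by (intro IfLess.IH) (auto simp: s5)
    then obtain s6 where s6: "runs P (poly (cost c2) n) s5 s6" "pc s6 = b2 + compile_len c2"
      "matches n V \<rho> (sem c2 n \<rho> \<sigma>) s6"
      using False by (auto simp: executes_def s5)
    have "runs P 1 s6 (s6\<lparr>pc := b1 + compile_len c1\<rparr>)"
      using runs_step[of s6 P] code(5,6) s6(2) by (simp add: branch_def)
    with s6(1) have "runs P (poly (cost c2) n + 1) s5 (s6\<lparr>pc := b1 + compile_len c1\<rparr>)"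
      by (rule runs_trans)
    from runs_trans[OF r5 this] have "runs P (length xs + 1 + (poly (cost c2) n + 1)) s (s6\<lparr>pc := b1 + compile_len c1\<rparr>)" .
    then have "executes P (length xs + 1 + (poly (cost c2) n + 1)) n V \<rho> (sem c2 n \<rho> \<sigma>) (b1 + compile_len c1) s"
      unfolding executes_def using s6(3) by (intro exI[of _ "s6\<lparr>pc := b1 + compile_len c1\<rparr>"]) auto
    then show ?thesis
      using False unfolding len cst by (auto elim!: executes_mono)
  qed
next
  case (For i c)
  define b where "b = pc s"
  let ?vi = "6 + 2 * i" and ?ri = "7 + 2 * i"
  have code: "b < length P" "P ! b = ISet ?vi 0" "b + 1 < length P" "P ! (b + 1) = ISet ?ri 0"
    "b + 2 < length P" "P ! (b + 2) = IJumpLess ?vi 0 (b + 4)"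
    "b + 3 < length P" "P ! (b + 3) = Jump (b + compile_len c + 7)"
    "code_at P (b + 4) (compile c (b + 4))"
    "b + 4 + compile_len c < length P" "P ! (b + 4 + compile_len c) = IAdd ?vi ?vi 1"
    "b + 5 + compile_len c < length P" "P ! (b + 5 + compile_len c) = IAdd ?ri ?ri 0"
    "b + 6 + compile_len c < length P" "P ! (b + 6 + compile_len c) = Jump (b + 2)"
    using For.prems(3) by (simp_all add: b_def length_compile eval_nat_numeral)
  have wf: "i \<notin> V" "wf_com (insert i V) c" using For.prems by auto
  define body where "body = (\<lambda>m. sem c n (\<rho>(i := m)))"
  \<comment> \<open>The loop variable is not in \<open>V\<close>, so \<open>matches\<close> at the
    loop head says nothing about its registers; their values m and m * n are carried
    separately.\<close>
  have loop: "\<exists>s'. runs P (2 + m * (poly (cost c) n + 4)) s s' \<and> pc s' = b + 2 \<and>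
      matches n V \<rho> (fold body [0..<m] \<sigma>) s' \<and> idx s' ?vi = m \<and> idx s' ?ri = m * n" if "m \<le> n" for m
    using that
  proof (induction m)
    case 0
    let ?s1 = "set_idx ?vi 0 s"
    let ?s2 = "set_idx ?ri 0 ?s1"
    have "runs P (1 + 1) s ?s2"
    proof (rule runs_trans)
      show "runs P 1 s ?s1" using runs_step[of s P] code by (simp add: b_def)
      show "runs P 1 ?s1 ?s2" using runs_step[of ?s1 P] code by (simp add: b_def set_idx_def)
    qed
    then have "runs P (2 + 0 * (poly (cost c) n + 4)) s ?s2"
      by (elim runs_mono) auto
    moreover have "matches n V \<rho> \<sigma> ?s2"
      using For.prems(2) wf(1) by (auto simp: matches_def set_idx_def)
    ultimately show ?case
      by (intro exI[of _ ?s2]) (auto simp: set_idx_def b_def)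
  next
    case (Suc m)
    then obtain s' where s': "runs P (2 + m * (poly (cost c) n + 4)) s s'" "pc s' = b + 2"
      "matches n V \<rho> (fold body [0..<m] \<sigma>) s'" "idx s' ?vi = m" "idx s' ?ri = m * n"
      by auto
    let ?s1 = "branch True (b + 4) s'"
    have r1: "runs P 1 s' ?s1"
      using runs_step[of s' P] code s' Suc.prems by (simp add: matches_def)
    have m1: "matches n (insert i V) (\<rho>(i := m)) (fold body [0..<m] \<sigma>) ?s1"
      using s' wf(1) Suc.prems by (auto simp: matches_def branch_def)
    have "executes P (poly (cost c) n) n (insert i V) (\<rho>(i := m)) (fold body [0..<Suc m] \<sigma>)
        (pc ?s1 + compile_len c) ?s1"
      using For.IH[OF wf(2) m1] code by (simp add: branch_def body_def fun_upd_def)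
    then obtain s2 where s2: "runs P (poly (cost c) n) ?s1 s2" "pc s2 = b + 4 + compile_len c"
      "matches n (insert i V) (\<rho>(i := m)) (fold body [0..<Suc m] \<sigma>) s2"
      by (auto simp: executes_def branch_def)
    let ?s3 = "set_idx ?vi (Suc m) s2"
    let ?s4 = "set_idx ?ri (Suc m * n) ?s3"
    let ?s5 = "branch True (b + 2) ?s4"
    have i2: "idx s2 ?vi = m" "idx s2 1 = 1" "idx s2 ?ri = m * n" "idx s2 0 = n"
      using s2(3) by (auto simp: matches_def)
    have p3: "runs P 1 s2 ?s3"
      using runs_step[of s2 P] code s2(2) i2 by simp
    have pc3: "pc ?s3 = b + 5 + compile_len c" and pc4: "pc ?s4 = b + 6 + compile_len c"
      using s2(2) by (simp_all add: set_idx_def)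
    have "exec (P ! pc ?s3) ?s3 = ?s4"
      using i2 unfolding pc3 code(13) by (simp add: set_idx_def add.commute[of n])
    then have p4: "runs P 1 ?s3 ?s4"
      using runs_step[of ?s3 P] code(12) unfolding pc3 by simp
    have "exec (P ! pc ?s4) ?s4 = ?s5"
      unfolding pc4 code(15) by simp
    then have p5: "runs P 1 ?s4 ?s5"
      using runs_step[of ?s4 P] code(14) unfolding pc4 by simp
    note runs_trans[OF s'(1) runs_trans[OF r1 runs_trans[OF s2(1) runs_trans[OF p3 runs_trans[OF p4 p5]]]]]
    moreover have "matches n V \<rho> (fold body [0..<Suc m] \<sigma>) ?s5"
      using s2(3) wf(1) unfolding matches_def
      by (auto simp: set_idx_def branch_def)
    ultimately show ?case
      by (intro exI[of _ ?s5]) (auto simp: set_idx_def branch_def elim!: runs_mono)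
  qed
  obtain s' where s': "runs P (2 + n * (poly (cost c) n + 4)) s s'" "pc s' = b + 2"
      "matches n V \<rho> (fold body [0..<n] \<sigma>) s'" "idx s' ?vi = n"
    using loop[of n] by auto
  let ?s1 = "branch False 0 s'"
  let ?s2 = "branch True (b + compile_len c + 7) ?s1"
  define t where "t = 2 + n * (poly (cost c) n + 4)"
  have "runs P (t + (1 + 1)) s ?s2"
  proof (intro runs_trans)
    show "runs P 1 s' ?s1"
      using runs_step[of s' P] code s' by (simp add: matches_def branch_def)
    show "runs P 1 ?s1 ?s2"
      using runs_step[of ?s1 P] code s' by (simp add: matches_def branch_def eval_nat_numeral)
  qed (use s'(1) in \<open>auto simp: t_def\<close>)
  moreover have "matches n V \<rho> (sem (For i c) n \<rho> \<sigma>) ?s2"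
    using s'(3) by (simp add: matches_def branch_def body_def)
  ultimately show ?case
    unfolding executes_def by (intro exI[of _ ?s2]) (auto simp: branch_def b_def t_def elim!: runs_mono)
qed

text \<open>Index registers cannot be multiplied, so n^2 is accumulated in register 2 by n
  additions, with register 3 as counter. Then \<epsilon> is copied from cell 0, which belongs to no
  block, to entry (0, 0) of array 1.\<close>

definition prelude :: program where
  "prelude =
     [ISet 1 1, IJumpLess 3 0 3, Jump 6, IAdd 2 2 0, IAdd 3 3 1, Jump 1,
      ISet 3 1, IAdd 3 3 2, IAdd 3 3 2, ISet 4 0, RCopy 3 4]"

text \<open>The scope {0} with value 0 comes for free, since registers 6 and 7 are still zero.
  Variable 0 is how programs address scalars.\<close>

lemma prelude_correct:
  assumes "n \<ge> 1" "code_at P 0 prelude"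
  obtains \<sigma> where "executes P (8 + 4 * n) n {0} (\<lambda>_. 0) \<sigma> 11 (initial_config n A \<epsilon>)"
    "\<sigma> 1 0 0 = \<epsilon>" "\<And>i j. i < n \<Longrightarrow> j < n \<Longrightarrow> \<sigma> 0 i j = A $$ (i, j)"
proof -
  define s0 where "s0 = initial_config n A \<epsilon>"
  define M where "M = mem s0"
  have code: "0 < length P" "P ! 0 = ISet 1 1" "1 < length P" "P ! 1 = IJumpLess 3 0 3"
    "2 < length P" "P ! 2 = Jump 6" "3 < length P" "P ! 3 = IAdd 2 2 0"
    "4 < length P" "P ! 4 = IAdd 3 3 1" "5 < length P" "P ! 5 = Jump 1"
    and code6: "code_at P 6 [ISet 3 1, IAdd 3 3 2, IAdd 3 3 2, ISet 4 0, RCopy 3 4]"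
    using assms(2) by (simp_all add: prelude_def eval_nat_numeral)
  define I where "I = (\<lambda>(m::nat) (r::nat). if r = 0 then n else if r = 1 then 1 else
      if r = 2 then m * n else if r = 3 then m else (0::nat))"
  have loop: "runs P (1 + m * 4) s0 \<lparr>pc = 1, idx = I m, mem = M\<rparr>" if "m \<le> n" for m
    using that
  proof (induction m)
    case 0
    have "exec (P ! pc s0) s0 = \<lparr>pc = 1, idx = I 0, mem = M\<rparr>"
      by (auto simp: code s0_def initial_config_def set_idx_def I_def M_def fun_eq_iff)
    then show ?case
      using runs_step[of s0 P] code by (simp add: s0_def initial_config_def)
  next
    case (Suc m)
    let ?c = "\<lambda>l I. \<lparr>pc = l, idx = I, mem = M\<rparr>"
    let ?I1 = "(I m)(2 := Suc m * n)"
    define t where "t = 1 + m * 4"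
    have "runs P (t + (1 + (1 + (1 + 1)))) s0 (?c 1 (I (Suc m)))"
    proof (intro runs_trans)
      show "runs P t s0 (?c 1 (I m))" using Suc by (simp add: t_def)
      show "runs P 1 (?c 1 (I m)) (?c 3 (I m))"
        using runs_step[of "?c 1 (I m)" P] code Suc.prems by (simp add: branch_def I_def)
      show "runs P 1 (?c 3 (I m)) (?c 4 ?I1)"
        using runs_step[of "?c 3 (I m)" P] code by (simp add: set_idx_def I_def add.commute)
      have "?I1(3 := Suc m) = I (Suc m)" by (auto simp: I_def fun_eq_iff)
      then show "runs P 1 (?c 4 ?I1) (?c 5 (I (Suc m)))"
        using runs_step[of "?c 4 ?I1" P] code by (simp add: set_idx_def) (simp add: I_def)
      show "runs P 1 (?c 5 (I (Suc m))) (?c 1 (I (Suc m)))"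
        using runs_step[of "?c 5 (I (Suc m))" P] code by (simp add: branch_def)
    qed
    then show ?case by (elim runs_mono) (simp add: t_def)
  qed
  let ?c = "\<lambda>l I. \<lparr>pc = l, idx = I, mem = M\<rparr>"
  let ?xs = "[ISet 3 1, IAdd 3 3 2, IAdd 3 3 2, ISet 4 0, RCopy 3 4]"
  define s' where "s' = fold exec ?xs (?c 6 (I n))"
  define t where "t = 1 + n * 4"
  have "runs P (t + (1 + (1 + length ?xs))) s0 s'"
  proof (intro runs_trans)
    show "runs P t s0 (?c 1 (I n))" using loop by (simp add: t_def)
    show "runs P 1 (?c 1 (I n)) (?c 2 (I n))"
      using runs_step[of "?c 1 (I n)" P] code by (simp add: branch_def I_def numeral_2_eq_2)
    show "runs P 1 (?c 2 (I n)) (?c 6 (I n))"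
      using runs_step[of "?c 2 (I n)" P] code by (simp add: branch_def)
    show "runs P (length ?xs) (?c 6 (I n)) s'"
      unfolding s'_def using code6 by (intro runs_straight) auto
  qed
  then have r: "runs P (8 + 4 * n) (initial_config n A \<epsilon>) s'"
    unfolding s0_def[symmetric] by (elim runs_mono) (simp add: t_def)
  have s': "s' = \<lparr>pc = 11, idx = (I n)(3 := lay n 2 0 0, 4 := 0), mem = M(lay n 2 0 0 := \<epsilon>)\<rparr>"
    by (simp add: s'_def set_idx_def set_cell_def cell_def I_def lay_def M_def s0_def initial_config_def
        mult_2)
  define \<sigma> where "\<sigma> = (\<lambda>k p q. mem s' (lay n (2 * k) p q))"
  have "matches n {0} (\<lambda>_. 0) \<sigma> s'"
    using assms(1) by (auto simp: matches_def \<sigma>_def s' I_def)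
  then have "executes P (8 + 4 * n) n {0} (\<lambda>_. 0) \<sigma> 11 (initial_config n A \<epsilon>)"
    unfolding executes_def using r by (intro exI[of _ s']) (auto simp: s')
  moreover have "\<sigma> 1 0 0 = \<epsilon>" by (simp add: \<sigma>_def s')
  moreover have "\<sigma> 0 i j = A $$ (i, j)" if "i < n" "j < n" for i j
  proof -
    have "i * n + j < Suc i * n" using that by simp
    also have "\<dots> \<le> n * n" using that by (intro mult_right_mono) auto
    finally have "i * n + j < n * n" .
    then show ?thesis
      using that lay_inject[of i n j 0 0 0 2] by (auto simp: \<sigma>_def s' M_def s0_def initial_config_def lay_def)
  qed
  ultimately show thesis by (rule that)
qed

text \<open>Only \<epsilon> and the matrix are known about the initial store. The contents of the
  other arrays are left open, so a program has to initialise whatever it reads.\<close>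

lemma compiled_program_outputs:
  assumes "n \<ge> 1" "wf_com {0} c"
  obtains \<sigma> where "outputs_within (prelude @ compile c 11) n A \<epsilon> (poly ([:8, 4:] + cost c) n)
      (mat n n (\<lambda>(i, j). sem c n (\<lambda>_. 0) \<sigma> 0 i j))"
    "\<sigma> 1 0 0 = \<epsilon>" "\<And>i j. i < n \<Longrightarrow> j < n \<Longrightarrow> \<sigma> 0 i j = A $$ (i, j)"
proof -
  let ?P = "prelude @ compile c 11"
  have "code_at ?P 0 prelude" using code_at_self[of "[]" prelude] by simp
  then obtain \<sigma> where
    \<sigma>: "executes ?P (8 + 4 * n) n {0} (\<lambda>_. 0) \<sigma> 11 (initial_config n A \<epsilon>)"
    "\<sigma> 1 0 0 = \<epsilon>" "\<And>i j. i < n \<Longrightarrow> j < n \<Longrightarrow> \<sigma> 0 i j = A $$ (i, j)"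
    using prelude_correct[OF assms(1), of ?P A \<epsilon>] by metis
  from \<sigma>(1) obtain s where s: "runs ?P (8 + 4 * n) (initial_config n A \<epsilon>) s" "pc s = 11"
    "matches n {0} (\<lambda>_. 0) \<sigma> s" by (auto simp: executes_def)
  have "length prelude = 11" by (simp add: prelude_def)
  then have "code_at ?P (pc s) (compile c (pc s))"
    using code_at_self[of prelude "compile c 11" "[]"] s(2) by simp
  from runs_executes[OF s(1) compile_correct[OF assms s(3) this]] obtain s' where
    s': "runs ?P (8 + 4 * n + poly (cost c) n) (initial_config n A \<epsilon>) s'" "pc s' = 11 + compile_len c"
    "matches n {0} (\<lambda>_. 0) (sem c n (\<lambda>_. 0) \<sigma>) s'"
    using s(2) by (auto simp: executes_def)
  have "halted ?P s'"
    using s'(2) by (simp add: halted_def length_compile prelude_def)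
  moreover have "output_mat n s' = mat n n (\<lambda>(i, j). sem c n (\<lambda>_. 0) \<sigma> 0 i j)"
    using s'(3) unfolding output_mat_def matches_def by (intro cong_mat) (auto simp: lay_def dest: spec[of _ 0])
  ultimately have "outputs_within ?P n A \<epsilon> (poly ([:8, 4:] + cost c) n)
      (mat n n (\<lambda>(i, j). sem c n (\<lambda>_. 0) \<sigma> 0 i j))"
    using s'(1) unfolding outputs_within_def runs_def by (auto simp: Let_def mult.commute)
  then show thesis using \<sigma>(2,3) by (rule that)
qed

section \<open>Barrier potentials\<close>

text \<open>The vectors \<open>w e\<close> carry weights \<open>g e\<close>; M stands for the sum of
  g_e w_e w_e^T. A matrix u G plus the sum of c_e w_e w_e^T is always represented by the pair (u,
  c); only inverses are kept as arrays of entries.\<close>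

locale weighted_vectors =
  fixes I :: "'i set" and E :: "'e set" and w :: "'e \<Rightarrow> 'i \<Rightarrow> real" and g :: "'e \<Rightarrow> real"
    and G :: "'i \<Rightarrow> real"
  assumes finite_I: "finite I" and finite_E: "finite E"
    and G_pos: "\<And>i. i \<in> I \<Longrightarrow> 0 < G i" and g_nonneg: "\<And>e. e \<in> E \<Longrightarrow> 0 \<le> g e"
begin

definition dot :: "('i \<Rightarrow> real) \<Rightarrow> ('i \<Rightarrow> real) \<Rightarrow> real" where
  "dot x y = (\<Sum>i\<in>I. x i * y i)"

definition mv :: "('i \<Rightarrow> 'i \<Rightarrow> real) \<Rightarrow> ('i \<Rightarrow> real) \<Rightarrow> 'i \<Rightarrow> real" where
  "mv W v = (\<lambda>i. \<Sum>j\<in>I. W i j * v j)"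

definition form :: "real \<Rightarrow> ('e \<Rightarrow> real) \<Rightarrow> ('i \<Rightarrow> real) \<Rightarrow> ('i \<Rightarrow> real) \<Rightarrow> real" where
  "form u c x y = u * (\<Sum>i\<in>I. G i * x i * y i) + (\<Sum>e\<in>E. c e * dot (w e) x * dot (w e) y)"

definition posdef :: "real \<Rightarrow> ('e \<Rightarrow> real) \<Rightarrow> bool" where
  "posdef u c \<longleftrightarrow> (\<forall>x. (\<exists>i\<in>I. x i \<noteq> 0) \<longrightarrow> 0 < form u c x x)"

text \<open>The weak form (X W v)^T x = v^T x of X W = 1, for the matrix X of
  \<open>form u c\<close>. It avoids writing X entrywise, and Cauchy--Schwarz arguments use it
  directly.\<close>

definition inverse_of :: "real \<Rightarrow> ('e \<Rightarrow> real) \<Rightarrow> ('i \<Rightarrow> 'i \<Rightarrow> real) \<Rightarrow> bool" where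
  "inverse_of u c W \<longleftrightarrow>
     (\<forall>i\<in>I. \<forall>j\<in>I. W i j = W j i) \<and> (\<forall>v x. form u c (mv W v) x = dot v x)"

definition quad :: "('i \<Rightarrow> 'i \<Rightarrow> real) \<Rightarrow> ('i \<Rightarrow> real) \<Rightarrow> real" where
  "quad W v = dot v (mv W v)"

text \<open>The trace tr (M W), written as a sum over the rank-one terms of M.\<close>

definition potential :: "('i \<Rightarrow> 'i \<Rightarrow> real) \<Rightarrow> real" where
  "potential W = (\<Sum>e\<in>E. g e * quad W (w e))"

text \<open>The quadratic form y^T M y.\<close>

definition sq_sum :: "('i \<Rightarrow> real) \<Rightarrow> real" where
  "sq_sum y = (\<Sum>e\<in>E. g e * (dot (w e) y)\<^sup>2)"

text \<open>The Sherman--Morrison formula: if W inverts X, this inverts X + \<delta> w_e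
  w_e^T.\<close>

definition rank_one :: "('i \<Rightarrow> 'i \<Rightarrow> real) \<Rightarrow> real \<Rightarrow> 'e \<Rightarrow> 'i \<Rightarrow> 'i \<Rightarrow> real" where
  "rank_one W \<delta> e = (\<lambda>i j. W i j - \<delta> / (1 + \<delta> * quad W (w e)) * mv W (w e) i * mv W (w e) j)"

section \<open>Forms and their inverses\<close>

lemma dot_lin: "dot x (\<lambda>i. y i + t * z i) = dot x y + t * dot x z"
  by (simp add: dot_def algebra_simps sum.distrib sum_distrib_left)

lemma form_commute: "form u c x y = form u c y x"
  by (simp add: form_def mult.commute mult.left_commute)

lemma form_lin: "form u c (\<lambda>i. x i + t * y i) z = form u c x z + t * form u c y z"
  by (simp add: form_def dot_lin algebra_simps sum.distrib sum_distrib_left)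

lemma form_square:
  "form u c (\<lambda>i. x i + t * y i) (\<lambda>i. x i + t * y i) = form u c x x + 2 * t * form u c x y + t\<^sup>2 * form u c y y"
  using form_lin form_commute by (simp add: algebra_simps power2_eq_square)

lemma form_zero: "(\<And>i. i \<in> I \<Longrightarrow> x i = 0) \<Longrightarrow> form u c x y = 0"
  by (simp add: form_def dot_def)

lemma form_nonneg: "posdef u c \<Longrightarrow> 0 \<le> form u c x x"
  using form_zero[of x u c x] unfolding posdef_def by (metis less_eq_real_def)

lemma form_update:
  assumes "e \<in> E"
  shows "form u (c(e := c e + \<delta>)) x y = form u c x y + \<delta> * dot (w e) x * dot (w e) y"
proof -
  have "(\<Sum>e'\<in>E. (c(e := c e + \<delta>)) e' * dot (w e') x * dot (w e') y) =
        (\<Sum>e'\<in>E. c e' * dot (w e') x * dot (w e') y + (if e' = e then \<delta> * dot (w e') x * dot (w e') y else 0))"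
    by (intro sum.cong) (auto simp: algebra_simps)
  then show ?thesis
    using assms finite_E by (simp add: form_def sum.distrib)
qed

lemma form_shift: "form u (\<lambda>e. c e + \<beta> * g e) x x = form u c x x + \<beta> * sq_sum x"
  by (simp add: form_def sq_sum_def algebra_simps sum.distrib sum_distrib_left power2_eq_square)

lemma posdef_mono:
  assumes "posdef u c" "\<And>e. e \<in> E \<Longrightarrow> c e \<le> c' e"
  shows "posdef u c'"
proof -
  have "form u c x x \<le> form u c' x x" for x
    unfolding form_def mult.assoc
    by (intro add_left_mono sum_mono mult_right_mono assms) auto
  then show ?thesis using assms(1) unfolding posdef_def by (meson less_le_trans)
qed

lemma dot_mv_commute:
  assumes "inverse_of u c W"
  shows "dot x (mv W y) = dot y (mv W x)"
proof -
  have "dot x (mv W y) = (\<Sum>i\<in>I. \<Sum>j\<in>I. x i * W i j * y j)"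
    by (simp add: dot_def mv_def sum_distrib_left mult.assoc)
  also have "\<dots> = (\<Sum>j\<in>I. \<Sum>i\<in>I. x i * W i j * y j)"
    by (rule sum.swap)
  also have "\<dots> = (\<Sum>j\<in>I. \<Sum>i\<in>I. y j * W j i * x i)"
    using assms by (intro sum.cong refl) (simp add: inverse_of_def)
  also have "\<dots> = dot y (mv W x)"
    by (simp add: dot_def mv_def sum_distrib_left mult.assoc)
  finally show ?thesis .
qed

lemma form_mv: "inverse_of u c W \<Longrightarrow> form u c (mv W v) x = dot v x"
  by (simp add: inverse_of_def)

lemma form_mv_mv: "inverse_of u c W \<Longrightarrow> form u c (mv W v) (mv W v) = quad W v"
  by (simp add: form_mv quad_def)

lemma quad_nonneg: "posdef u c \<Longrightarrow> inverse_of u c W \<Longrightarrow> 0 \<le> quad W v"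
  using form_nonneg form_mv_mv by metis

text \<open>If v^T W v = 0, then W v is a zero of a positive definite form, hence 0, and then v^T v,
  the value of the form at W v and v, vanishes as well.\<close>

lemma quad_pos:
  assumes "posdef u c" "inverse_of u c W" "i \<in> I" "v i \<noteq> 0"
  shows "0 < quad W v"
proof (rule ccontr)
  assume "\<not> ?thesis"
  then have "form u c (mv W v) (mv W v) = 0"
    using quad_nonneg[OF assms(1,2), of v] form_mv_mv[OF assms(2), of v] by simp
  then have "\<forall>i\<in>I. mv W v i = 0"
    using assms(1) unfolding posdef_def by (metis less_irrefl)
  then have "dot v v = 0"
    using form_mv[OF assms(2), of v v] form_zero[of "mv W v" u c v] by simp
  moreover have "0 < dot v v"
    unfolding dot_def using assms(3,4) finite_I
    by (intro sum_pos2[of _ i]) (auto simp: zero_less_mult_iff)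
  ultimately show False by simp
qed

text \<open>Cauchy--Schwarz for the inner product given by the form, applied to W v and x: their
  product is v^T x, and W v has square v^T W v.\<close>

lemma dot_square_le:
  assumes "posdef u c" "inverse_of u c W"
  shows "(dot v x)\<^sup>2 \<le> quad W v * form u c x x"
proof (cases "quad W v = 0")
  case True
  then have "form u c (mv W v) (mv W v) = 0"
    using form_mv_mv[OF assms(2)] by simp
  then have "\<forall>i\<in>I. mv W v i = 0"
    using assms(1) unfolding posdef_def by (metis less_irrefl)
  then have "dot v x = 0"
    using form_mv[OF assms(2), of v x] form_zero[of "mv W v" u c x] by simp
  then show ?thesis using True by simp
next
  case False
  let ?q = "quad W v" and ?d = "dot v x"
  have q: "0 < ?q" using False quad_nonneg[OF assms, of v] by simp
  \<comment> \<open>The vector is x minus its projection onto W v in this inner product.\<close>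
  have "0 \<le> form u c (\<lambda>i. x i + (- (?d / ?q)) * mv W v i) (\<lambda>i. x i + (- (?d / ?q)) * mv W v i)"
    by (rule form_nonneg[OF assms(1)])
  also have "\<dots> = form u c x x - ?d\<^sup>2 / ?q"
  proof -
    have *: "form u c x (mv W v) = ?d"
      using form_mv[OF assms(2)] form_commute by metis
    have "(- (?d / ?q))\<^sup>2 * ?q = ?d\<^sup>2 / ?q" "2 * (- (?d / ?q)) * ?d = - 2 * (?d\<^sup>2 / ?q)"
      using q by (simp_all add: power2_eq_square)
    then show ?thesis
      unfolding form_square * form_mv_mv[OF assms(2)] by linarith
  qed
  finally have "?d\<^sup>2 / ?q \<le> form u c x x" by simp
  then show ?thesis using q by (simp only: pos_divide_le_eq mult.commute)
qed

text \<open>The variational inequality \<open>v\<^sup>T U\<^sup>-\<^sup>1 v \<ge> 2 v\<^sup>T y - y\<^sup>T U y\<close> at \<open>y = U'\<^sup>-\<^sup>1 v\<close>.\<close>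

lemma quad_compare:
  fixes v :: "'i \<Rightarrow> real"
  assumes "posdef u c" "inverse_of u c W" "inverse_of u' c' W'"
  defines "y \<equiv> mv W' v"
  shows "quad W' v + (form u' c' y y - form u c y y) \<le> quad W v"
proof -
  have "0 \<le> form u c (\<lambda>i. y i + (- 1) * mv W v i) (\<lambda>i. y i + (- 1) * mv W v i)"
    by (rule form_nonneg[OF assms(1)])
  also have "\<dots> = form u c y y - 2 * dot v y + quad W v"
    unfolding form_square form_mv_mv[OF assms(2)] form_commute[of u c y "mv W v"] form_mv[OF assms(2)]
    by (simp add: quad_def)
  also have "dot v y = quad W' v" by (simp add: quad_def y_def)
  finally show ?thesis
    using form_mv_mv[OF assms(3), of v] by (simp add: y_def)
qed

text \<open>\<open>quad_compare\<close> at every \<open>w e\<close>, summed with weights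
  \<open>g e\<close>: the shifted form exceeds the old one by \<beta> M, so the extra term is
  \<beta> tr (M W' M W'). Both signs of \<beta> are used: a guaranteed decrease for the upper
  barrier, a bound on the increase for the lower one.\<close>

lemma potential_shift:
  assumes "posdef u c" "inverse_of u c W" "inverse_of u (\<lambda>e. c e + \<beta> * g e) W'"
  shows "potential W' + \<beta> * (\<Sum>e\<in>E. g e * sq_sum (mv W' (w e))) \<le> potential W"
proof -
  have "potential W' + \<beta> * (\<Sum>e\<in>E. g e * sq_sum (mv W' (w e))) =
     (\<Sum>e\<in>E. g e * (quad W' (w e) + \<beta> * sq_sum (mv W' (w e))))"
    by (simp add: potential_def algebra_simps sum.distrib sum_distrib_left)
  also have "\<dots> \<le> potential W"
    unfolding potential_def
  proof (intro sum_mono mult_left_mono g_nonneg)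
    fix e
    show "quad W' (w e) + \<beta> * sq_sum (mv W' (w e)) \<le> quad W (w e)"
      using quad_compare[OF assms, of "w e"] by (simp add: form_shift)
  qed auto
  finally show ?thesis .
qed

section \<open>Rank-one updates\<close>

lemma mv_rank_one:
  assumes "inverse_of u c W"
  shows "mv (rank_one W \<delta> e) v =
    (\<lambda>i. mv W v i + (- (\<delta> / (1 + \<delta> * quad W (w e)) * dot (w e) (mv W v))) * mv W (w e) i)"
proof
  fix i
  define k where "k = \<delta> / (1 + \<delta> * quad W (w e))"
  have "mv (rank_one W \<delta> e) v i = (\<Sum>j\<in>I. W i j * v j + (- (k * mv W (w e) i)) * (v j * mv W (w e) j))"
    by (subst mv_def, intro sum.cong refl) (simp add: rank_one_def algebra_simps flip: k_def)
  also have "\<dots> = mv W v i + (- (k * mv W (w e) i)) * dot v (mv W (w e))"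
    unfolding sum.distrib mv_def[of W v] dot_def[of v] sum_distrib_left[symmetric] by (rule refl)
  also have "dot v (mv W (w e)) = dot (w e) (mv W v)"
    by (rule dot_mv_commute[OF assms])
  finally show "mv (rank_one W \<delta> e) v i = mv W v i + (- (k * dot (w e) (mv W v))) * mv W (w e) i"
    by (simp add: mult_ac)
qed

lemma inverse_of_rank_one:
  assumes "inverse_of u c W" "e \<in> E" "1 + \<delta> * quad W (w e) \<noteq> 0"
  shows "inverse_of u (c(e := c e + \<delta>)) (rank_one W \<delta> e)"
  unfolding inverse_of_def
proof (intro conjI allI ballI)
  fix i j assume "i \<in> I" "j \<in> I"
  then show "rank_one W \<delta> e i j = rank_one W \<delta> e j i"
    using assms(1) by (simp add: rank_one_def inverse_of_def)
next
  fix v x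
  define k where "k = \<delta> / (1 + \<delta> * quad W (w e))"
  define d where "d = dot (w e) (mv W v)"
  define q where "q = quad W (w e)"
  have k: "k = \<delta> / (1 + \<delta> * q)" by (simp add: k_def q_def)
  have "form u (c(e := c e + \<delta>)) (mv (rank_one W \<delta> e) v) x =
      dot v x + (- (k * d)) * dot (w e) x + \<delta> * (d + (- (k * d)) * q) * dot (w e) x"
    unfolding form_update[OF assms(2)] mv_rank_one[OF assms(1)] form_lin dot_lin
      form_mv[OF assms(1)] d_def[symmetric] quad_def[symmetric] q_def[symmetric] k[symmetric]
    by (simp add: algebra_simps)
  also have "\<dots> = dot v x + (\<delta> - k * (1 + \<delta> * q)) * d * dot (w e) x"
    by (simp add: algebra_simps)
  also have "k * (1 + \<delta> * q) = \<delta>" using assms(3) by (simp add: k_def q_def)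
  finally show "form u (c(e := c e + \<delta>)) (mv (rank_one W \<delta> e) v) x = dot v x"
    by (simp only: diff_self mult_zero_left add_0_right)
qed

text \<open>Only \<delta> < 0 needs an argument: with q = w_e^T W w_e, Cauchy--Schwarz shows that
  the new form is at least 1 + \<delta> q times the old one.\<close>

lemma posdef_rank_one:
  assumes "posdef u c" "inverse_of u c W" "e \<in> E" "0 < 1 + \<delta> * quad W (w e)"
  shows "posdef u (c(e := c e + \<delta>))"
  unfolding posdef_def
proof (intro allI impI)
  fix x :: "'i \<Rightarrow> real" assume x: "\<exists>i\<in>I. x i \<noteq> 0"
  then have f: "0 < form u c x x" using assms(1) by (auto simp: posdef_def)
  have le: "(dot (w e) x)\<^sup>2 \<le> quad W (w e) * form u c x x"
    by (rule dot_square_le[OF assms(1,2)])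
  have "0 < form u c x x + \<delta> * (dot (w e) x)\<^sup>2"
  proof (cases "0 \<le> \<delta>")
    case True
    then show ?thesis using f by (simp add: add_pos_nonneg)
  next
    case False
    have "0 < (1 + \<delta> * quad W (w e)) * form u c x x" using assms(4) f by simp
    also have "\<dots> = form u c x x + \<delta> * (quad W (w e) * form u c x x)" by (simp add: algebra_simps)
    also have "\<dots> \<le> form u c x x + \<delta> * (dot (w e) x)\<^sup>2"
      using False le by (intro add_left_mono mult_left_mono_neg) auto
    finally show ?thesis .
  qed
  then show "0 < form u (c(e := c e + \<delta>)) x x"
    unfolding form_update[OF assms(3)] by (simp only: power2_eq_square mult.assoc)
qed

text \<open>Evaluate the new form at W w_e: it is q (1 + \<delta> q) with q = w_e^T W w_e. Together
  with \<open>posdef_rank_one\<close>, the sign of one computable number decides whether an update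
  keeps positive definiteness; this is how the program tests it.\<close>

lemma posdef_rank_one_conv:
  assumes "posdef u c" "inverse_of u c W" "e \<in> E" "posdef u (c(e := c e + \<delta>))"
  shows "0 < 1 + \<delta> * quad W (w e)"
proof (cases "\<exists>i\<in>I. mv W (w e) i \<noteq> 0")
  case True
  let ?q = "quad W (w e)"
  have "0 < ?q" using True assms(1) form_mv_mv[OF assms(2), of "w e"] unfolding posdef_def by metis
  moreover have "0 < form u (c(e := c e + \<delta>)) (mv W (w e)) (mv W (w e))"
    using True assms(4) unfolding posdef_def by blast
  then have "0 < ?q * (1 + \<delta> * ?q)"
    unfolding form_update[OF assms(3)] form_mv_mv[OF assms(2)] quad_def[symmetric]
    by (simp add: algebra_simps)
  ultimately show ?thesis by (simp add: zero_less_mult_iff)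
next
  case False
  then have "quad W (w e) = 0" by (simp add: quad_def dot_def)
  then show ?thesis by simp
qed

lemma potential_rank_one:
  assumes "inverse_of u c W"
  shows "potential (rank_one W \<delta> e) =
    potential W - \<delta> * sq_sum (mv W (w e)) / (1 + \<delta> * quad W (w e))"
proof -
  let ?k = "\<delta> / (1 + \<delta> * quad W (w e))"
  have "quad (rank_one W \<delta> e) v = quad W v - ?k * (dot v (mv W (w e)))\<^sup>2" for v
    unfolding quad_def[of "rank_one W \<delta> e"] mv_rank_one[OF assms] dot_lin
    using dot_mv_commute[OF assms, of v "w e"] by (simp add: quad_def power2_eq_square)
  then have "potential (rank_one W \<delta> e) =
    (\<Sum>e'\<in>E. g e' * quad W (w e') - ?k * (g e' * (dot (w e') (mv W (w e)))\<^sup>2))"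
    unfolding potential_def by (simp only: right_diff_distrib mult.left_commute)
  also have "\<dots> = potential W - ?k * sq_sum (mv W (w e))"
    by (simp add: sum_subtractf potential_def sq_sum_def sum_distrib_left)
  finally show ?thesis by simp
qed

lemma sq_sum_nonneg: "0 \<le> sq_sum y"
  unfolding sq_sum_def by (intro sum_nonneg mult_nonneg_nonneg g_nonneg) auto

text \<open>Summing Cauchy--Schwarz gives M \<le> tr (M W) X in the order of forms, where W inverts
  X. A potential below 1 therefore leaves room to subtract M.\<close>

lemma sq_sum_le:
  assumes "posdef u c" "inverse_of u c W"
  shows "sq_sum x \<le> potential W * form u c x x"
proof -
  have "sq_sum x \<le> (\<Sum>e\<in>E. g e * (quad W (w e) * form u c x x))"
    unfolding sq_sum_def by (intro sum_mono mult_left_mono g_nonneg dot_square_le[OF assms]) auto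
  then show ?thesis by (simp add: potential_def sum_distrib_right mult.assoc)
qed

lemma potential_nonneg: "posdef u c \<Longrightarrow> inverse_of u c W \<Longrightarrow> 0 \<le> potential W"
  unfolding potential_def by (intro sum_nonneg mult_nonneg_nonneg g_nonneg quad_nonneg) auto

section \<open>Moving the lower barrier\<close>

context
  fixes u c W and \<beta> :: real
  assumes pos: "posdef u c" and inv: "inverse_of u c W" and \<beta>: "0 \<le> \<beta>" "\<beta> \<le> 1" and small: "potential W < 1"
begin

lemma form_lower_shift:
  "(1 - potential W) * form u c x x \<le> form u (\<lambda>e. c e + (- \<beta>) * g e) x x"
proof -
  have "\<beta> * sq_sum x \<le> 1 * (potential W * form u c x x)"
    using \<beta> sq_sum_nonneg sq_sum_le[OF pos inv] by (intro mult_mono) auto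
  moreover have "form u (\<lambda>e. c e + (- \<beta>) * g e) x x = form u c x x + (- \<beta>) * sq_sum x"
    by (rule form_shift)
  moreover have "(1 - potential W) * form u c x x = form u c x x - potential W * form u c x x"
    by (simp add: left_diff_distrib)
  ultimately show ?thesis by linarith
qed

lemma posdef_lower_shift: "posdef u (\<lambda>e. c e + (- \<beta>) * g e)"
  unfolding posdef_def
proof (intro allI impI)
  fix x :: "'i \<Rightarrow> real" assume "\<exists>i\<in>I. x i \<noteq> 0"
  then have "0 < form u c x x"
    using pos unfolding posdef_def by blast
  then have "0 < (1 - potential W) * form u c x x"
    using small by (intro mult_pos_pos) simp_all
  then show "0 < form u (\<lambda>e. c e + (- \<beta>) * g e) x x"
    using form_lower_shift[of x] by linarith
qed

text \<open>The bound X' \<ge> (1 - \<phi>) X of forms, with \<phi> the old potential, is turned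
  into W' \<le> W / (1 - \<phi>) for the inverses: Cauchy--Schwarz for X at y = W' v bounds (v^T W'
  v)^2 by a multiple of v^T W' v itself, which is then cancelled.\<close>

lemma potential_lower_shift:
  assumes inv': "inverse_of u (\<lambda>e. c e + (- \<beta>) * g e) W'"
  shows "potential W' \<le> potential W / (1 - potential W)"
proof -
  have "(1 - potential W) * quad W' v \<le> quad W v" for v
  proof -
    let ?y = "mv W' v"
    have q: "0 \<le> quad W' v" by (rule quad_nonneg[OF posdef_lower_shift inv'])
    have "(1 - potential W) * (quad W' v)\<^sup>2 = (1 - potential W) * (dot v ?y)\<^sup>2"
      by (simp add: quad_def)
    also have "\<dots> \<le> (1 - potential W) * (quad W v * form u c ?y ?y)"
      using small by (intro mult_left_mono dot_square_le[OF pos inv]) auto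
    also have "\<dots> = quad W v * ((1 - potential W) * form u c ?y ?y)" by simp
    also have "\<dots> \<le> quad W v * quad W' v"
      using form_lower_shift[of ?y] form_mv_mv[OF inv', of v] quad_nonneg[OF pos inv]
      by (intro mult_left_mono) auto
    finally have "(1 - potential W) * quad W' v * quad W' v \<le> quad W v * quad W' v"
      by (simp add: power2_eq_square mult.assoc)
    then show ?thesis
      using q quad_nonneg[OF pos inv, of v] by (cases "quad W' v = 0") auto
  qed
  then have "(\<Sum>e\<in>E. g e * ((1 - potential W) * quad W' (w e))) \<le> potential W"
    unfolding potential_def[of W, symmetric]
    by (subst (2) potential_def) (intro sum_mono mult_left_mono g_nonneg)
  moreover have "(\<Sum>e\<in>E. g e * ((1 - potential W) * quad W' (w e))) = (1 - potential W) * potential W'"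
    by (simp add: potential_def[of W'] sum_distrib_left mult.left_commute)
  ultimately show ?thesis using small by (simp add: field_simps)
qed

end

section \<open>One step of the two-barrier method\<close>

definition step_size :: "('i \<Rightarrow> 'i \<Rightarrow> real) \<Rightarrow> ('i \<Rightarrow> 'i \<Rightarrow> real) \<Rightarrow> 'e \<Rightarrow> real" where
  "step_size W1 W2 e = (potential W1 + potential W2) / (quad W1 (w e) + quad W2 (w e))"

text \<open>The sum of both potentials after h w_e w_e^T has been subtracted from the upper barrier
  and added to the lower one. \<open>potential_rank_one\<close> gives it in closed form, so a
  candidate can be judged before any update.\<close>

definition new_potential :: "('i \<Rightarrow> 'i \<Rightarrow> real) \<Rightarrow> ('i \<Rightarrow> 'i \<Rightarrow> real) \<Rightarrow> 'e \<Rightarrow> real" where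
  "new_potential W1 W2 e =
     (let h = step_size W1 W2 e in
      potential W1 + potential W2 + h * sq_sum (mv W1 (w e)) / (1 - h * quad W1 (w e))
      - h * sq_sum (mv W2 (w e)) / (1 + h * quad W2 (w e)))"

text \<open>Index 1 is the upper and index 2 the lower barrier; primed inverses belong to the
  barriers after their shift by (1 + 1 / r) M and - (1 - 1 / r) M. The bound 1 / (r + 2) is what one
  step has to restore.\<close>

context
  fixes r u c1 c2 W1 W2 W1' W2' and \<phi> :: real
  assumes r: "1 \<le> r"
    and pos: "posdef u c1" "posdef u c2"
    and inv: "inverse_of u c1 W1" "inverse_of u c2 W2"
    and bound: "potential W1 + potential W2 \<le> 1 / (r + 2)"
    and inv': "inverse_of u (\<lambda>e. c1 e + (1 + 1 / r) * g e) W1'"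
      "inverse_of u (\<lambda>e. c2 e + (- (1 - 1 / r)) * g e) W2'"
    and nontrivial: "\<exists>e\<in>E. 0 < g e" "\<forall>e\<in>E. \<exists>i\<in>I. w e i \<noteq> 0"
begin

lemma shifted_posdef:
  "posdef u (\<lambda>e. c1 e + (1 + 1 / r) * g e)" "posdef u (\<lambda>e. c2 e + (- (1 - 1 / r)) * g e)"
proof -
  show "posdef u (\<lambda>e. c1 e + (1 + 1 / r) * g e)"
    using r g_nonneg by (intro posdef_mono[OF pos(1)]) auto
  have "potential W2 \<le> 1 / (r + 2)"
    using bound potential_nonneg[OF pos(1) inv(1)] by simp
  also have "\<dots> < 1" using r by simp
  finally show "posdef u (\<lambda>e. c2 e + (- (1 - 1 / r)) * g e)"
    using r by (intro posdef_lower_shift[OF pos(2) inv(2)]) auto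
qed

text \<open>The upper shift cannot increase its potential, and the lower one replaces b by at most b
  / (1 - b). The total is controlled by x / (1 - x), which sends 1 / (r + 2) to 1 / (r + 1).\<close>

lemma shifted_potential:
  "potential W1' + potential W2' \<le> 1 / (r + 1)"
proof -
  let ?a = "potential W1" and ?b = "potential W2"
  have ab: "0 \<le> ?a" "0 \<le> ?b"
    using potential_nonneg[OF pos(1) inv(1)] potential_nonneg[OF pos(2) inv(2)] by auto
  have lt: "1 / (r + 2) < 1" using r by simp
  have "potential W1' \<le> ?a"
    using potential_shift[OF pos(1) inv(1) inv'(1)] r sq_sum_nonneg g_nonneg
    by (smt (verit) divide_nonneg_nonneg mult_nonneg_nonneg sum_nonneg)
  moreover have "potential W2' \<le> ?b / (1 - ?b)"
  proof (intro potential_lower_shift[OF pos(2) inv(2) _ _ _ inv'(2)])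
    show "?b < 1" using lt bound ab by linarith
  qed (use r in auto)
  moreover have "?a + ?b / (1 - ?b) \<le> (?a + ?b) / (1 - (?a + ?b))"
  proof -
    have "?a \<le> ?a / (1 - (?a + ?b))" "?b / (1 - ?b) \<le> ?b / (1 - (?a + ?b))"
      using ab bound lt by (auto simp: field_simps intro!: divide_left_mono)
    then show ?thesis by (simp add: add_divide_distrib)
  qed
  moreover have "(?a + ?b) / (1 - (?a + ?b)) \<le> (1 / (r + 2)) / (1 - 1 / (r + 2))"
    using ab bound lt r by (intro frac_le) auto
  moreover have "(1 / (r + 2)) / (1 - 1 / (r + 2)) = 1 / (r + 1)"
    using r by (simp add: field_simps)
  ultimately show ?thesis by linarith
qed

lemma shifted_quad_pos:
  assumes "e \<in> E"
  shows "0 < quad W1' (w e)" "0 < quad W2' (w e)"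
  using bspec[OF nontrivial(2) assms] quad_pos[OF shifted_posdef(1) inv'(1)] quad_pos[OF shifted_posdef(2) inv'(2)]
  by blast+

lemma shifted_potential_pos: "0 < potential W1' + potential W2'"
proof -
  obtain e where e: "e \<in> E" "0 < g e" using nontrivial by blast
  have "0 < potential W1'"
    unfolding potential_def using e finite_E shifted_quad_pos(1) g_nonneg
    by (intro sum_pos2[of _ e]) (auto intro: mult_nonneg_nonneg less_imp_le)
  then show ?thesis
    using potential_nonneg[OF shifted_posdef(2) inv'(2)] by simp
qed

lemma step_size_bounds:
  assumes "e \<in> E"
  shows "0 < step_size W1' W2' e" "step_size W1' W2' e * quad W1' (w e) \<le> potential W1' + potential W2'"
    "step_size W1' W2' e * quad W2' (w e) \<le> potential W1' + potential W2'"
proof -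
  note q = shifted_quad_pos[OF assms]
  show "0 < step_size W1' W2' e"
    using q shifted_potential_pos by (simp add: step_size_def)
  show "step_size W1' W2' e * quad W1' (w e) \<le> potential W1' + potential W2'"
    "step_size W1' W2' e * quad W2' (w e) \<le> potential W1' + potential W2'"
    using q mult_left_mono[of "quad W1' (w e) / (quad W1' (w e) + quad W2' (w e))" 1 "potential W1' + potential W2'"]
      mult_left_mono[of "quad W2' (w e) / (quad W1' (w e) + quad W2' (w e))" 1 "potential W1' + potential W2'"]
      shifted_potential_pos by (simp_all add: step_size_def)
qed

text \<open>
  If \<open>e\<close> is drawn with probability \<open>g e * (quad W1' (w e) + quad W2' (w e)) / T\<close>, where \<open>T\<close> is the
  total potential, then the expected new potential does not exceed the old one.
\<close>

lemma exists_good_step: "\<exists>e\<in>E. 0 < g e \<and> new_potential W1' W2' e \<le> 1 / (r + 2)"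
proof (rule ccontr)
  assume "\<not> ?thesis"
  then have bad: "1 / (r + 2) < new_potential W1' W2' e" if "e \<in> E" "0 < g e" for e
    using that by force
  define T where "T = potential W1' + potential W2'"
  define p where "p e = g e * (quad W1' (w e) + quad W2' (w e)) / T" for e
  define y1 where "y1 e = sq_sum (mv W1' (w e))" for e
  define y2 where "y2 e = sq_sum (mv W2' (w e))" for e
  have T: "0 < T" "T \<le> 1 / (r + 1)" "T < 1"
    using shifted_potential_pos shifted_potential r by (auto simp: T_def elim: le_less_trans)
  have sum_p: "(\<Sum>e\<in>E. p e) = 1"
  proof -
    have "(\<Sum>e\<in>E. p e) = (\<Sum>e\<in>E. g e * quad W1' (w e) + g e * quad W2' (w e)) / T"
      by (simp add: p_def sum_divide_distrib distrib_left)
    also have "\<dots> = T / T" by (simp add: sum.distrib T_def potential_def)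
    finally show ?thesis using T by simp
  qed
  obtain e0 where e0: "e0 \<in> E" "0 < g e0" using nontrivial by blast
  have p_pos: "0 < p e" if "e \<in> E" "0 < g e" for e
    using shifted_quad_pos[OF that(1)] that T by (simp add: p_def)
  have p_zero: "p e = 0" if "e \<in> E" "\<not> 0 < g e" for e
    using g_nonneg[OF that(1)] that by (simp add: p_def)
  have "1 / (r + 2) = (\<Sum>e\<in>E. p e) * (1 / (r + 2))"
    using sum_p by simp
  also have "\<dots> = (\<Sum>e\<in>E. p e * (1 / (r + 2)))"
    by (rule sum_distrib_right)
  also have "\<dots> < (\<Sum>e\<in>E. p e * new_potential W1' W2' e)"
  proof (rule sum_strict_mono_ex1[OF finite_E])
    show "\<forall>e\<in>E. p e * (1 / (r + 2)) \<le> p e * new_potential W1' W2' e"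
    proof
      fix e assume e: "e \<in> E"
      show "p e * (1 / (r + 2)) \<le> p e * new_potential W1' W2' e"
        using p_pos[OF e] p_zero[OF e] bad[OF e]
        by (cases "0 < g e") (auto intro!: mult_left_mono simp del: times_divide_eq_right)
    qed
    show "\<exists>e\<in>E. p e * (1 / (r + 2)) < p e * new_potential W1' W2' e"
      using e0 p_pos[OF e0] bad[OF e0] by (intro bexI[of _ e0] mult_strict_left_mono)
  qed
  also have "\<dots> \<le> (\<Sum>e\<in>E. p e * T + 1 / (1 - T) * (g e * y1 e) - 1 / (1 + T) * (g e * y2 e))"
  proof (rule sum_mono)
    fix e assume e: "e \<in> E"
    show "p e * new_potential W1' W2' e \<le> p e * T + 1 / (1 - T) * (g e * y1 e) - 1 / (1 + T) * (g e * y2 e)"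
    proof (cases "0 < g e")
      case True
      define h where "h = step_size W1' W2' e"
      note h = step_size_bounds[OF e, folded h_def T_def]
      have y: "0 \<le> g e * y1 e" "0 \<le> g e * y2 e"
        using True sq_sum_nonneg by (simp_all add: y1_def y2_def)
      \<comment> \<open>This is the reason for the choice of \<open>step_size\<close>: the expected
        rank-one term, the sum of p_e h w_e w_e^T, is exactly M.\<close>
      have ph: "p e * h = g e"
        using shifted_quad_pos[OF e] T(1) by (simp add: p_def h_def step_size_def T_def)
      have "p e * new_potential W1' W2' e =
          p e * T + p e * h * y1 e / (1 - h * quad W1' (w e)) - p e * h * y2 e / (1 + h * quad W2' (w e))"
        by (simp add: new_potential_def Let_def h_def T_def y1_def y2_def right_diff_distrib distrib_left)
      also have "\<dots> = p e * T + g e * y1 e / (1 - h * quad W1' (w e)) - g e * y2 e / (1 + h * quad W2' (w e))"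
        by (simp only: ph)
      \<comment> \<open>Bounding h q_1 and h q_2 by T makes both denominators independent of e, so
        that the sum over e can be taken.\<close>
      also have "g e * y1 e / (1 - h * quad W1' (w e)) \<le> g e * y1 e / (1 - T)"
        using h T y by (intro divide_left_mono mult_pos_pos) auto
      moreover have "0 \<le> h * quad W2' (w e)"
        using h(1) shifted_quad_pos(2)[OF e] by simp
      then have "g e * y2 e / (1 + T) \<le> g e * y2 e / (1 + h * quad W2' (w e))"
        using h(3) T(1) y by (intro divide_left_mono mult_pos_pos) linarith+
      ultimately show ?thesis by simp
    qed (use p_zero[OF e] g_nonneg[OF e] in auto)
  qed
  also have "\<dots> = T + 1 / (1 - T) * (\<Sum>e\<in>E. g e * y1 e) - 1 / (1 + T) * (\<Sum>e\<in>E. g e * y2 e)"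
    unfolding sum_subtractf sum.distrib sum_distrib_left[symmetric] sum_distrib_right[symmetric] sum_p by simp
  \<comment> \<open>The shift rates come from here: the cost of the rank-one term at the upper
    barrier is covered by the gain of the upper shift, and the cost of the lower shift by the gain
    of the rank-one term at the lower barrier.\<close>
  also have "\<dots> \<le> T + (1 + 1 / r) * (\<Sum>e\<in>E. g e * y1 e) - (1 - 1 / r) * (\<Sum>e\<in>E. g e * y2 e)"
  proof -
    have "1 / (1 - T) \<le> 1 / (1 - 1 / (r + 1))"
      using T r by (intro divide_left_mono mult_pos_pos) auto
    also have "\<dots> = 1 + 1 / r" using r by (simp add: field_simps)
    finally have 1: "1 / (1 - T) \<le> 1 + 1 / r" .
    have "1 - 1 / r \<le> 1 / (1 + 1 / (r + 1))" using r by (simp add: field_simps)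
    also have "\<dots> \<le> 1 / (1 + T)"
      using T r by (intro divide_left_mono mult_pos_pos) auto
    finally have 2: "1 - 1 / r \<le> 1 / (1 + T)" .
    have "0 \<le> (\<Sum>e\<in>E. g e * y1 e)" "0 \<le> (\<Sum>e\<in>E. g e * y2 e)"
      unfolding y1_def y2_def by (intro sum_nonneg mult_nonneg_nonneg g_nonneg sq_sum_nonneg; assumption)+
    with 1 2 show ?thesis
      by (intro diff_mono add_left_mono mult_right_mono) auto
  qed
  also have "\<dots> \<le> potential W1 + potential W2"
    using potential_shift[OF pos(1) inv(1) inv'(1)] potential_shift[OF pos(2) inv(2) inv'(2)]
    unfolding T_def y1_def y2_def mult_minus_left by linarith
  also have "\<dots> \<le> 1 / (r + 2)" by (rule bound)
  finally show False by simp
qed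

text \<open>The denominator at the upper barrier is positive because h q is at most the shifted
  total, hence at most 1 / (r + 1) < 1; at the lower barrier both h and q are positive. So both
  updates stay positive definite and have the predicted potential.\<close>

lemma good_step:
  assumes e: "e \<in> E" and good: "new_potential W1' W2' e \<le> 1 / (r + 2)"
  defines "h \<equiv> step_size W1' W2' e"
  defines "c1' \<equiv> \<lambda>e. c1 e + (1 + 1 / r) * g e" and "c2' \<equiv> \<lambda>e. c2 e + (- (1 - 1 / r)) * g e"
  shows "posdef u (c1'(e := c1' e + (- h)))" "posdef u (c2'(e := c2' e + h))"
    "inverse_of u (c1'(e := c1' e + (- h))) (rank_one W1' (- h) e)"
    "inverse_of u (c2'(e := c2' e + h)) (rank_one W2' h e)"
    "potential (rank_one W1' (- h) e) + potential (rank_one W2' h e) \<le> 1 / (r + 2)"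
proof -
  have "1 / (r + 1) < 1" using r by simp
  then have d1: "0 < 1 + (- h) * quad W1' (w e)"
    using step_size_bounds(2)[OF e] shifted_potential by (simp add: h_def)
  have d2: "0 < 1 + h * quad W2' (w e)"
    using step_size_bounds(1)[OF e] shifted_quad_pos(2)[OF e] by (simp add: h_def add_pos_pos)
  show "posdef u (c1'(e := c1' e + (- h)))"
    using shifted_posdef(1) inv'(1) e d1 unfolding c1'_def by (rule posdef_rank_one)
  show "posdef u (c2'(e := c2' e + h))"
    using shifted_posdef(2) inv'(2) e d2 unfolding c2'_def by (rule posdef_rank_one)
  show "inverse_of u (c1'(e := c1' e + (- h))) (rank_one W1' (- h) e)"
    using inv'(1) e d1[THEN less_imp_neq, symmetric] unfolding c1'_def by (rule inverse_of_rank_one)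
  show "inverse_of u (c2'(e := c2' e + h)) (rank_one W2' h e)"
    using inv'(2) e d2[THEN less_imp_neq, symmetric] unfolding c2'_def by (rule inverse_of_rank_one)
  show "potential (rank_one W1' (- h) e) + potential (rank_one W2' h e) \<le> 1 / (r + 2)"
    using good unfolding potential_rank_one[OF inv'(1)] potential_rank_one[OF inv'(2)]
      new_potential_def Let_def h_def by simp
qed

end

text \<open>The coefficients while a multiple of M is added one rank-one term at a time:
  \<open>D\<close> holds the terms already processed.\<close>

definition mix :: "('e \<Rightarrow> real) \<Rightarrow> ('e \<Rightarrow> real) \<Rightarrow> 'e set \<Rightarrow> 'e \<Rightarrow> real" where
  "mix c \<delta> D = (\<lambda>e. if e \<in> D then c e + \<delta> e else c e)"

lemma mix_insert: "e \<notin> D \<Longrightarrow> mix c \<delta> (insert e D) = (mix c \<delta> D)(e := mix c \<delta> D e + \<delta> e)"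
  by (auto simp: mix_def fun_eq_iff)

lemma mix_step:
  assumes "posdef u (mix c \<delta> D)" "inverse_of u (mix c \<delta> D) W" "e \<in> E" "e \<notin> D"
    "posdef u (mix c \<delta> (insert e D))"
  shows "0 < 1 + \<delta> e * quad W (w e)"
    "inverse_of u (mix c \<delta> (insert e D)) (rank_one W (\<delta> e) e)"
proof -
  show *: "0 < 1 + \<delta> e * quad W (w e)"
    using posdef_rank_one_conv[OF assms(1,2,3)] assms(5) unfolding mix_insert[OF assms(4)] by blast
  show "inverse_of u (mix c \<delta> (insert e D)) (rank_one W (\<delta> e) e)"
    using inverse_of_rank_one[OF assms(2,3)] * unfolding mix_insert[OF assms(4)] by simp
qed

lemma posdef_cong: "posdef u c \<Longrightarrow> (\<And>e. e \<in> E \<Longrightarrow> c e = c' e) \<Longrightarrow> posdef u c'"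
  by (erule posdef_mono) simp

lemma form_cong: "(\<And>e. e \<in> E \<Longrightarrow> c e = c' e) \<Longrightarrow> form u c x y = form u c' x y"
  unfolding form_def by (intro arg_cong2[where f = "(+)"] refl sum.cong) simp_all

lemma inverse_of_coeff_cong:
  assumes "inverse_of u c W" "\<And>e. e \<in> E \<Longrightarrow> c e = c' e"
  shows "inverse_of u c' W"
proof -
  have "form u c x y = form u c' x y" for x y
    by (rule form_cong) (rule assms(2))
  then show ?thesis using assms(1) by (simp add: inverse_of_def)
qed

lemma posdef_mix_nonneg:
  assumes "posdef u c" "\<And>e. e \<in> E \<Longrightarrow> 0 \<le> \<delta> e"
  shows "posdef u (mix c \<delta> D)"
  by (rule posdef_mono[OF assms(1)]) (use assms(2) in \<open>auto simp: mix_def\<close>)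

text \<open>With decreasing coefficients every intermediate form dominates the final one, just as
  with increasing ones it dominates the first. So positive definiteness at the two ends of a shift
  covers all stages in between.\<close>

lemma posdef_mix_nonpos:
  assumes "posdef u (\<lambda>e. c e + \<delta> e)" "\<And>e. e \<in> E \<Longrightarrow> \<delta> e \<le> 0"
  shows "posdef u (mix c \<delta> D)"
  by (rule posdef_mono[OF assms(1)]) (use assms(2) in \<open>auto simp: mix_def\<close>)

lemma inverse_of_cong:
  assumes "inverse_of u c W" "\<And>i j. i \<in> I \<Longrightarrow> j \<in> I \<Longrightarrow> W' i j = W i j"
  shows "inverse_of u c W'"
proof -
  have mv: "mv W' v i = mv W v i" if "i \<in> I" for v i
    using assms(2) that by (simp add: mv_def)
  have d: "dot x (mv W' v) = dot x (mv W v)" for x v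
    using mv by (simp add: dot_def)
  have "form u c (mv W' v) x = form u c (mv W v) x" for v x
    unfolding form_def d using mv
    by (intro arg_cong2[where f = "(+)"] arg_cong2[where f = "(*)"] refl sum.cong) simp
  then show ?thesis
    using assms by (simp add: inverse_of_def)
qed

lemma quad_cong: "(\<And>i j. i \<in> I \<Longrightarrow> j \<in> I \<Longrightarrow> W' i j = W i j) \<Longrightarrow> quad W' v = quad W v"
  unfolding quad_def dot_def mv_def by (intro sum.cong arg_cong2[where f = "(*)"] refl) simp

lemma potential_cong: "(\<And>i j. i \<in> I \<Longrightarrow> j \<in> I \<Longrightarrow> W' i j = W i j) \<Longrightarrow> potential W' = potential W"
  unfolding potential_def using quad_cong[of W' W] by simp

lemma posdef_zero:
  assumes "0 < u"
  shows "posdef u (\<lambda>_. 0)"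
  unfolding posdef_def
proof (intro allI impI)
  fix x :: "'i \<Rightarrow> real" assume "\<exists>i\<in>I. x i \<noteq> 0"
  then obtain i where i: "i \<in> I" "x i \<noteq> 0" by blast
  have "0 \<le> G j * (x j * x j)" if "j \<in> I" for j
    using G_pos[OF that] by simp
  moreover have "0 < x i * x i" using i(2) not_real_square_gt_zero by blast
  then have "0 < G i * (x i * x i)"
    by (rule mult_pos_pos[OF G_pos[OF i(1)]])
  ultimately have "0 < (\<Sum>j\<in>I. G j * (x j * x j))"
    using i(1) finite_I by (intro sum_pos2)
  then show "0 < form u (\<lambda>_. 0) x x"
    using assms by (simp add: form_def mult.assoc)
qed

lemma inverse_of_zero:
  assumes "0 < u" "\<And>i j. i \<in> I \<Longrightarrow> j \<in> I \<Longrightarrow> W i j = (if i = j then 1 / (u * G i) else 0)"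
  shows "inverse_of u (\<lambda>_. 0) W"
proof -
  have mv: "mv W v i = v i / (u * G i)" if "i \<in> I" for v i
  proof -
    have "mv W v i = (\<Sum>j\<in>I. if i = j then v j / (u * G i) else 0)"
      unfolding mv_def using assms(2) that by (intro sum.cong) auto
    then show ?thesis using that finite_I by simp
  qed
  have "form u (\<lambda>_. 0) (mv W v) x = dot v x" for v x
  proof -
    have "form u (\<lambda>_. 0) (mv W v) x = (\<Sum>i\<in>I. u * (G i * mv W v i * x i))"
      by (simp add: form_def sum_distrib_left)
    also have "\<dots> = (\<Sum>i\<in>I. v i * x i)"
    proof (intro sum.cong refl)
      fix i assume "i \<in> I"
      then show "u * (G i * mv W v i * x i) = v i * x i"
        using mv G_pos[of i] assms(1) by simp
    qed
    finally show ?thesis by (simp add: dot_def)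
  qed
  then show ?thesis
    using assms by (simp add: inverse_of_def)
qed

end

section \<open>Vectors attached to a matrix\<close>

text \<open>The bilinear form x^T C y. Norms of matrices enter only through bounds of
  \<open>bil\<close> by a multiple of \<open>sqrt (sqn n x) * sqrt (sqn n y)\<close>, which suits
  off-diagonal blocks.\<close>

definition bil :: "nat \<Rightarrow> (nat \<Rightarrow> nat \<Rightarrow> real) \<Rightarrow> (nat \<Rightarrow> real) \<Rightarrow> (nat \<Rightarrow> real) \<Rightarrow> real" where
  "bil n C x y = (\<Sum>i<n. \<Sum>j<n. C i j * x i * y j)"

definition sqn :: "nat \<Rightarrow> (nat \<Rightarrow> real) \<Rightarrow> real" where
  "sqn n x = (\<Sum>i<n. (x i)\<^sup>2)"

definition col_sq :: "nat \<Rightarrow> (nat \<Rightarrow> nat \<Rightarrow> real) \<Rightarrow> nat \<Rightarrow> real" where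
  "col_sq n A j = (\<Sum>i<n. (A i j)\<^sup>2)"

definition fro_sq :: "nat \<Rightarrow> (nat \<Rightarrow> nat \<Rightarrow> real) \<Rightarrow> real" where
  "fro_sq n A = (\<Sum>j<n. col_sq n A j)"

lemma sqn_nonneg: "0 \<le> sqn n x"
  by (simp add: sqn_def sum_nonneg)

lemma sqn_eq_0: "sqn n x = 0 \<Longrightarrow> i < n \<Longrightarrow> x i = 0"
  by (simp add: sqn_def sum_nonneg_eq_0_iff)

lemma bil_scale: "bil n C (\<lambda>i. s * x i) (\<lambda>j. t * y j) = s * t * bil n C x y"
  by (simp add: bil_def sum_distrib_left mult_ac)

lemma sqn_scale: "sqn n (\<lambda>i. s * x i) = s\<^sup>2 * sqn n x"
  by (simp add: sqn_def sum_distrib_left power_mult_distrib)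

text \<open>Optimize over the rescalings \<open>(t x, y / t)\<close>.\<close>

lemma bil_le_geometric:
  assumes F: "0 < F" and le: "\<And>x y. bil n C x y \<le> K * (F\<^sup>2 * sqn n x + sqn n y)"
  shows "bil n C x y \<le> 2 * K * F * (sqrt (sqn n x) * sqrt (sqn n y))"
proof (cases "sqn n x = 0 \<or> sqn n y = 0")
  case True
  then have "bil n C x y = 0"
    unfolding bil_def by (auto intro!: sum.neutral dest: sqn_eq_0)
  then show ?thesis using True by auto
next
  case False
  define X where "X = sqrt (sqn n x)"
  define Y where "Y = sqrt (sqn n y)"
  have XY: "0 < X" "0 < Y" "X\<^sup>2 = sqn n x" "Y\<^sup>2 = sqn n y"
    using False sqn_nonneg[of n x] sqn_nonneg[of n y] by (auto simp: X_def Y_def)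
  \<comment> \<open>The value for which both terms of the rescaled bound become equal.\<close>
  define t where "t = sqrt (Y / (F * X))"
  have t: "0 < t" "t\<^sup>2 = Y / (F * X)" using XY F by (simp_all add: t_def)
  have "bil n C x y = bil n C (\<lambda>i. t * x i) (\<lambda>j. (1 / t) * y j)"
    unfolding bil_scale using t by simp
  also have "\<dots> \<le> K * (F\<^sup>2 * (t\<^sup>2 * X\<^sup>2) + (1 / t)\<^sup>2 * Y\<^sup>2)"
    using le[of "\<lambda>i. t * x i" "\<lambda>j. (1 / t) * y j"] by (simp only: sqn_scale XY)
  also have "F\<^sup>2 * (t\<^sup>2 * X\<^sup>2) = F * (X * Y)"
    unfolding t(2) using XY(1,2) F by (simp add: power2_eq_square)
  also have "(1 / t)\<^sup>2 * Y\<^sup>2 = F * (X * Y)"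
    unfolding power_divide t(2) using XY(1,2) F by (simp add: power2_eq_square)
  finally show ?thesis by (simp add: X_def Y_def algebra_simps)
qed

text \<open>Coordinates of the 2n-dimensional space are pairs of a block number 0 or 1 and a
  position. The factor c_j of the overview is moved into the weight \<open>wt\<close>, where it
  appears as c_j^2, so no square root occurs.\<close>

definition vec_of :: "(nat \<Rightarrow> nat \<Rightarrow> real) \<Rightarrow> nat \<times> nat \<Rightarrow> nat \<times> nat \<Rightarrow> real" where
  "vec_of ratio e ap = (if fst ap = 0 then (if snd ap = fst e then 1 else 0)
     else if snd ap = snd e then ratio (fst e) (snd e) else 0)"

locale sampled_matrix =
  fixes n :: nat and A :: "nat \<Rightarrow> nat \<Rightarrow> real"
  assumes fro_pos: "0 < fro_sq n A"
begin

definition ratio :: "nat \<Rightarrow> nat \<Rightarrow> real" where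
  "ratio i j = A i j / col_sq n A j"

definition wt :: "nat \<times> nat \<Rightarrow> real" where
  "wt e = col_sq n A (snd e)"

definition Gd :: "nat \<times> nat \<Rightarrow> real" where
  "Gd ap = (if fst ap = 0 then fro_sq n A else 1)"

abbreviation I2 :: "(nat \<times> nat) set" where "I2 \<equiv> {..<2} \<times> {..<n}"
abbreviation E2 :: "(nat \<times> nat) set" where "E2 \<equiv> {..<n} \<times> {..<n}"

sublocale weighted_vectors I2 E2 "vec_of ratio" wt Gd
proof
  show "0 \<le> wt e" for e by (simp add: wt_def col_sq_def sum_nonneg)
qed (auto simp: Gd_def fro_pos)

lemma sum_I2: "(\<Sum>ap\<in>I2. f ap) = (\<Sum>p<n. f (0, p)) + (\<Sum>p<n. f (1, p))"
proof -
  have "(\<Sum>ap\<in>I2. f ap) = (\<Sum>a<2. \<Sum>p<n. f (a, p))"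
    by (simp add: sum.cartesian_product)
  then show ?thesis by (simp add: numeral_2_eq_2)
qed

lemma sum_E2: "(\<Sum>e\<in>E2. f e) = (\<Sum>i<n. \<Sum>j<n. f (i, j))"
  by (simp add: sum.cartesian_product)

lemma dot_vec_of:
  assumes "e \<in> E2"
  shows "dot (vec_of ratio e) x = x (0, fst e) + ratio (fst e) (snd e) * x (1, snd e)"
proof -
  have "(\<Sum>p<n. (if p = fst e then 1 else 0) * x (0, p)) = (\<Sum>p<n. if p = fst e then x (0, p) else 0)"
    "(\<Sum>p<n. (if p = snd e then ratio (fst e) (snd e) else 0) * x (1, p)) =
     (\<Sum>p<n. if p = snd e then ratio (fst e) (snd e) * x (1, p) else 0)"
    by (intro sum.cong; simp)+
  then show ?thesis
    using assms unfolding dot_def sum_I2 vec_of_def by auto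
qed

lemma mv_vec_of:
  assumes "e \<in> E2"
  shows "mv W (vec_of ratio e) ap = W ap (0, fst e) + ratio (fst e) (snd e) * W ap (1, snd e)"
  using dot_vec_of[OF assms, of "W ap"] by (simp add: mv_def dot_def mult.commute)

text \<open>A column of norm zero has only zero entries, so the convention x / 0 = 0 gives the right
  value there.\<close>

lemma wt_ratio: "i < n \<Longrightarrow> col_sq n A j * ratio i j = A i j"
  by (cases "col_sq n A j = 0") (auto simp: ratio_def col_sq_def sum_nonneg_eq_0_iff)

lemma sum_wt_ratio_sq: "(\<Sum>i<n. col_sq n A j * (ratio i j)\<^sup>2) = (if col_sq n A j = 0 then 0 else 1)"
proof (cases "col_sq n A j = 0")
  case False
  have "(\<Sum>i<n. col_sq n A j * (ratio i j)\<^sup>2) = (\<Sum>i<n. (A i j)\<^sup>2 / col_sq n A j)"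
    using False by (intro sum.cong refl) (simp add: ratio_def power_divide power2_eq_square)
  also have "\<dots> = col_sq n A j / col_sq n A j"
    unfolding sum_divide_distrib[symmetric] col_sq_def by (rule refl)
  finally show ?thesis using False by simp
qed simp

lemma sum_G: "(\<Sum>ap\<in>I2. Gd ap * z ap * z ap) =
    fro_sq n A * sqn n (\<lambda>i. z (0, i)) + sqn n (\<lambda>j. z (1, j))"
  by (simp add: sum_I2 Gd_def sqn_def sum_distrib_left power2_eq_square mult.assoc)

text \<open>The blocks of M: the upper left one is the sum of all c_j^2 times the identity, the
  mixed terms give A by \<open>wt_ratio\<close>, and the lower right one is a diagonal of ones with
  zeros at zero columns by \<open>sum_wt_ratio_sq\<close>.\<close>

lemma sq_sum_eq:
  "sq_sum z = fro_sq n A * sqn n (\<lambda>i. z (0, i)) + 2 * bil n A (\<lambda>i. z (0, i)) (\<lambda>j. z (1, j))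
     + (\<Sum>j<n. if col_sq n A j = 0 then 0 else (z (1, j))\<^sup>2)"
proof -
  let ?x = "\<lambda>i. z (0, i)" and ?y = "\<lambda>j. z (1, j)" and ?c = "col_sq n A"
  have "sq_sum z = (\<Sum>i<n. \<Sum>j<n. ?c j * (?x i + ratio i j * ?y j)\<^sup>2)"
    unfolding sq_sum_def sum_E2 by (intro sum.cong refl) (simp add: dot_vec_of wt_def)
  also have "\<dots> = (\<Sum>i<n. \<Sum>j<n. ?c j * (?x i)\<^sup>2 + 2 * (A i j * ?x i * ?y j) + ?c j * (ratio i j)\<^sup>2 * (?y j)\<^sup>2)"
  proof (intro sum.cong refl)
    fix i j assume "i \<in> {..<n}"
    then have "A i j = ?c j * ratio i j" using wt_ratio by simp
    then show "?c j * (?x i + ratio i j * ?y j)\<^sup>2 =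
        ?c j * (?x i)\<^sup>2 + 2 * (A i j * ?x i * ?y j) + ?c j * (ratio i j)\<^sup>2 * (?y j)\<^sup>2"
      by (simp add: power2_eq_square algebra_simps)
  qed
  also have "\<dots> = (\<Sum>i<n. \<Sum>j<n. ?c j * (?x i)\<^sup>2) + 2 * bil n A ?x ?y
      + (\<Sum>i<n. \<Sum>j<n. ?c j * (ratio i j)\<^sup>2 * (?y j)\<^sup>2)"
    by (simp add: sum.distrib bil_def sum_distrib_left)
  also have "(\<Sum>i<n. \<Sum>j<n. ?c j * (?x i)\<^sup>2) = fro_sq n A * sqn n ?x"
    unfolding fro_sq_def sqn_def sum_product by (rule sum.swap)
  also have "(\<Sum>i<n. \<Sum>j<n. ?c j * (ratio i j)\<^sup>2 * (?y j)\<^sup>2) = (\<Sum>j<n. (\<Sum>i<n. ?c j * (ratio i j)\<^sup>2) * (?y j)\<^sup>2)"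
    by (subst sum.swap) (simp add: sum_distrib_right)
  also have "\<dots> = (\<Sum>j<n. if ?c j = 0 then 0 else (?y j)\<^sup>2)"
    unfolding sum_wt_ratio_sq by (intro sum.cong) auto
  finally show ?thesis .
qed

definition pair :: "(nat \<Rightarrow> real) \<Rightarrow> (nat \<Rightarrow> real) \<Rightarrow> nat \<times> nat \<Rightarrow> real" where
  "pair x y ap = (if fst ap = 0 then x (snd ap) else y (snd ap))"

lemma pair_simps [simp]: "pair x y (0, i) = x i" "pair x y (1, i) = y i" "pair x y (Suc 0, i) = y i"
  by (simp_all add: pair_def)

lemma form_wt: "form u (\<lambda>e. \<beta> * wt e) z z =
    u * (fro_sq n A * sqn n (\<lambda>i. z (0, i)) + sqn n (\<lambda>j. z (1, j))) + \<beta> * sq_sum z"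
  using form_shift[of u "\<lambda>_. 0" \<beta> z] sum_G[of z] by (simp add: form_def)

lemma sq_sum_pair:
  "sq_sum (pair x y) = fro_sq n A * sqn n x + 2 * bil n A x y
     + (\<Sum>j<n. if col_sq n A j = 0 then 0 else (y j)\<^sup>2)"
  by (simp add: sq_sum_eq cong: if_cong)

lemma sq_sum_le_norms:
  "sq_sum (pair x y) \<le> fro_sq n A * sqn n x + 2 * bil n A x y + sqn n y"
proof -
  have "(\<Sum>j<n. if col_sq n A j = 0 then 0 else (y j)\<^sup>2) \<le> sqn n y"
    unfolding sqn_def by (intro sum_mono) auto
  then show ?thesis by (simp add: sq_sum_pair)
qed

text \<open>Let D be the form of G at (x, y). Then (s + 4) G - s M is at least 4 D - 2 s x^T A y,
  and x^T A y \<le> N |x| |y| \<le> N D / (2 F) by the arithmetic-geometric mean inequality. The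
  slack 4 D absorbs this when s N < 4 F.\<close>

lemma posdef_test:
  assumes "0 \<le> s" "\<And>x y. bil n A x y \<le> N * (sqrt (sqn n x) * sqrt (sqn n y))" "0 \<le> N"
    and lt: "s * N < 4 * sqrt (fro_sq n A)"
  shows "posdef (s + 4) (\<lambda>e. (- s) * wt e)"
  unfolding posdef_def
proof (intro allI impI)
  fix z :: "nat \<times> nat \<Rightarrow> real" assume z: "\<exists>ap\<in>I2. z ap \<noteq> 0"
  define x where "x = (\<lambda>i. z (0, i))"
  define y where "y = (\<lambda>j. z (1, j))"
  define F where "F = sqrt (fro_sq n A)"
  have F: "0 < F" "F\<^sup>2 = fro_sq n A" using fro_pos by (simp_all add: F_def)
  define D where "D = F\<^sup>2 * sqn n x + sqn n y"
  have "0 < D"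
  proof (rule ccontr)
    assume "\<not> ?thesis"
    moreover have "0 \<le> F\<^sup>2 * sqn n x" by (simp add: sqn_nonneg)
    ultimately have "F\<^sup>2 * sqn n x = 0" "sqn n y = 0"
      using sqn_nonneg[of n y] unfolding D_def by linarith+
    then have "\<forall>i<n. z (0, i) = 0" "\<forall>i<n. z (1, i) = 0"
      using F sqn_eq_0[of n x] sqn_eq_0[of n y] by (auto simp: x_def y_def)
    then show False using z by (auto simp: less_2_cases_iff)
  qed
  define X where "X = sqrt (sqn n x)"
  define Y where "Y = sqrt (sqn n y)"
  have XY: "0 \<le> X" "0 \<le> Y" "D = F\<^sup>2 * X\<^sup>2 + Y\<^sup>2"
    by (auto simp: X_def Y_def sqn_nonneg D_def)
  have "2 * F * (X * Y) \<le> D"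
    using zero_le_power2[of "F * X - Y"] by (simp add: XY(3) power2_eq_square algebra_simps)
  then have 1: "X * Y \<le> D / (2 * F)" using F by (simp add: field_simps)
  have "2 * s * bil n A x y \<le> 2 * s * (N * (X * Y))"
    using assms(1,2) by (intro mult_left_mono) (auto simp: X_def Y_def)
  also have "\<dots> \<le> 2 * s * (N * (D / (2 * F)))"
    using assms(1,3) 1 by (intro mult_left_mono) auto
  also have "\<dots> = s * N * (D / F)" by simp
  also have "\<dots> < 4 * F * (D / F)"
    using lt \<open>0 < D\<close> F by (intro mult_strict_right_mono) (auto simp: F_def)
  also have "\<dots> = 4 * D" using F by simp
  finally have 2: "2 * s * bil n A x y < 4 * D" .
  have zz: "sq_sum z = sq_sum (pair x y)"
    unfolding sq_sum_pair by (simp add: sq_sum_eq x_def y_def cong: if_cong)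
  have "s * sq_sum z \<le> s * (D + 2 * bil n A x y)"
    using assms(1) sq_sum_le_norms[of x y] unfolding zz D_def F(2) by (intro mult_left_mono) auto
  moreover have "form (s + 4) (\<lambda>e. (- s) * wt e) z z = (s + 4) * D + (- s) * sq_sum z"
    unfolding form_wt D_def F(2) x_def y_def by (rule refl)
  ultimately show "0 < form (s + 4) (\<lambda>e. (- s) * wt e) z z"
    using 2 by (simp add: algebra_simps)
qed

text \<open>Converse of \<open>posdef_test\<close> up to strictness: nonnegativity of the form gives
  s x^T A y \<le> 2 D, and balancing the two halves of D turns this into 4 F |x| |y|.\<close>

lemma bil_le_of_posdef:
  assumes "posdef (s + 4) (\<lambda>e. (- s) * wt e)" "0 \<le> s"
  shows "s * bil n A x y \<le> 4 * sqrt (fro_sq n A) * (sqrt (sqn n x) * sqrt (sqn n y))"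
proof -
  define F where "F = sqrt (fro_sq n A)"
  have F: "0 < F" "F\<^sup>2 = fro_sq n A" using fro_pos by (simp_all add: F_def)
  have "bil n (\<lambda>i j. s * A i j) x y \<le> 2 * (F\<^sup>2 * sqn n x + sqn n y)" for x y
  proof -
    \<comment> \<open>Coordinates at zero columns do not affect x^T A y, but the lower right block
      of M vanishes there; after cutting them off that block acts as the identity.\<close>
    define y' where "y' j = (if col_sq n A j = 0 then 0 else y j)" for j
    have y': "sqn n y' \<le> sqn n y" unfolding sqn_def y'_def by (intro sum_mono) auto
    have "bil n A x y' = bil n A x y"
      unfolding bil_def y'_def by (intro sum.cong refl) (auto simp: col_sq_def sum_nonneg_eq_0_iff)
    moreover have "(\<Sum>j<n. if col_sq n A j = 0 then 0 else (y' j)\<^sup>2) = sqn n y'"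
      unfolding sqn_def y'_def by (intro sum.cong) auto
    ultimately have "sq_sum (pair x y') = F\<^sup>2 * sqn n x + 2 * bil n A x y + sqn n y'"
      by (simp add: sq_sum_pair F)
    then have "0 \<le> (s + 4) * (F\<^sup>2 * sqn n x + sqn n y') - s * (F\<^sup>2 * sqn n x + 2 * bil n A x y + sqn n y')"
      using form_nonneg[OF assms(1), of "pair x y'"] unfolding form_wt by (simp add: F)
    then have "s * bil n A x y \<le> 2 * (F\<^sup>2 * sqn n x + sqn n y')"
      by (simp add: algebra_simps)
    also have "\<dots> \<le> 2 * (F\<^sup>2 * sqn n x + sqn n y)" using y' by simp
    also have "s * bil n A x y = bil n (\<lambda>i j. s * A i j) x y"
      by (simp add: bil_def sum_distrib_left mult.assoc)
    finally show ?thesis .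
  qed
  from bil_le_geometric[OF F(1) this, of x y]
  have "bil n (\<lambda>i j. s * A i j) x y \<le> 4 * F * (sqrt (sqn n x) * sqrt (sqn n y))" by simp
  moreover have "s * bil n A x y = bil n (\<lambda>i j. s * A i j) x y"
    by (simp add: bil_def sum_distrib_left mult.assoc)
  ultimately show ?thesis by (simp add: F_def)
qed

text \<open>The trace of M against the inverse of G is n from the upper block, where both are F^2 I,
  plus one for every nonzero column.\<close>

lemma initial_potential:
  assumes "0 < u" "\<And>p q. p \<in> I2 \<Longrightarrow> q \<in> I2 \<Longrightarrow> W p q = (if p = q then 1 / (u * Gd p) else 0)"
  shows "potential W \<le> 2 * n / u"
proof -
  have "quad W (vec_of ratio e) = 1 / (u * fro_sq n A) + (ratio (fst e) (snd e))\<^sup>2 / u" if e: "e \<in> E2" for e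
  proof -
    have "(0, fst e) \<in> I2" "(1, snd e) \<in> I2" using e by auto
    then show ?thesis
      unfolding quad_def dot_vec_of[OF e] mv_vec_of[OF e]
      by (simp add: assms(2) Gd_def power2_eq_square)
  qed
  then have "potential W = (\<Sum>i<n. \<Sum>j<n. col_sq n A j * (1 / (u * fro_sq n A) + (ratio i j)\<^sup>2 / u))"
    unfolding potential_def sum_E2 by (intro sum.cong refl) (simp add: wt_def)
  also have "\<dots> = (\<Sum>i<n. (\<Sum>j<n. col_sq n A j) / (u * fro_sq n A)) +
      (\<Sum>i<n. \<Sum>j<n. col_sq n A j * (ratio i j)\<^sup>2) / u"
    by (simp add: distrib_left sum.distrib sum_divide_distrib)
  also have "(\<Sum>i<n. (\<Sum>j<n. col_sq n A j) / (u * fro_sq n A)) = n / u"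
    using fro_pos by (simp add: fro_sq_def)
  also have "(\<Sum>i<n. \<Sum>j<n. col_sq n A j * (ratio i j)\<^sup>2) = (\<Sum>j<n. if col_sq n A j = 0 then 0 else 1)"
    by (subst sum.swap) (simp add: sum_wt_ratio_sq)
  also have "\<dots> \<le> (\<Sum>j<n. 1)" by (intro sum_mono) auto
  finally show ?thesis using assms(1) by (simp add: divide_right_mono field_simps)
qed

text \<open>The upper barrier is used at (x, y) and the lower one at (x, - y). In the difference the
  diagonal blocks cancel, both for the sparse sum and for k M, leaving four times the off-diagonal
  bilinear forms; what remains on the right is 2 u D and k \<alpha> times two values of M, which sum
  to at most 2 D.\<close>

lemma final_error:
  assumes p1: "posdef u (\<lambda>e. k * (1 + \<alpha>) * wt e - H e)" and p2: "posdef u (\<lambda>e. H e - k * (1 - \<alpha>) * wt e)"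
    and k: "0 \<le> k" "0 \<le> \<alpha>"
  shows "\<bar>bil n (\<lambda>i j. H (i, j) * ratio i j - k * A i j) x y\<bar> \<le>
    (u + k * \<alpha>) * sqrt (fro_sq n A) * (sqrt (sqn n x) * sqrt (sqn n y))"
proof -
  define F where "F = sqrt (fro_sq n A)"
  have F: "0 < F" "F\<^sup>2 = fro_sq n A" using fro_pos by (simp_all add: F_def)
  let ?C = "\<lambda>i j. H (i, j) * ratio i j - k * A i j"
  define h where "h z = (\<Sum>e\<in>E2. H e * (dot (vec_of ratio e) z)\<^sup>2)" for z
  define D where "D x y = F\<^sup>2 * sqn n x + sqn n y" for x y
  have h1: "form u (\<lambda>e. \<beta> * wt e + s * H e) z z = u * D (\<lambda>i. z (0, i)) (\<lambda>j. z (1, j)) + \<beta> * sq_sum z + s * h z" for \<beta> s z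
    unfolding form_def sum_G D_def F(2) sq_sum_def h_def
    by (simp add: algebra_simps sum.distrib sum_distrib_left power2_eq_square)
  have up: "0 \<le> u * D x y + k * (1 + \<alpha>) * sq_sum (pair x y) - h (pair x y)"
    and lo: "0 \<le> u * D x y + h (pair x y) - k * (1 - \<alpha>) * sq_sum (pair x y)" for x y
    using form_nonneg[OF p1, of "pair x y"] h1[of "k * (1 + \<alpha>)" "-1" "pair x y"]
      form_nonneg[OF p2, of "pair x y"] h1[of "- (k * (1 - \<alpha>))" 1 "pair x y"]
    by simp_all
  have hh: "h (pair x y) - h (pair x (\<lambda>j. - y j)) = 4 * bil n (\<lambda>i j. H (i, j) * ratio i j) x y" for x y
    unfolding h_def sum_E2 bil_def sum_subtractf[symmetric] sum_distrib_left
    by (intro sum.cong refl) (simp add: dot_vec_of power2_eq_square algebra_simps)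
  have neg: "bil n C x (\<lambda>j. - y j) = - bil n C x y" "sqn n (\<lambda>j. - y j) = sqn n y" for C x y
    by (simp_all add: bil_def sqn_def sum_negf)
  have le: "bil n ?C x y \<le> (u + k * \<alpha>) / 2 * (F\<^sup>2 * sqn n x + sqn n y)" for x y
  proof -
    define m1 where "m1 = sq_sum (pair x y)"
    define m2 where "m2 = sq_sum (pair x (\<lambda>j. - y j))"
    have m: "m1 - m2 = 4 * bil n A x y"
      by (simp add: m1_def m2_def sq_sum_pair neg cong: if_cong)
    have m': "m1 + m2 \<le> 2 * D x y"
      using sq_sum_le_norms[of x y] sq_sum_le_norms[of x "\<lambda>j. - y j"]
      by (simp add: m1_def m2_def neg D_def F)
    have "D x (\<lambda>j. - y j) = D x y" by (simp add: D_def neg)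
    then have "h (pair x y) - h (pair x (\<lambda>j. - y j)) \<le> 2 * u * D x y + k * (m1 - m2) + k * \<alpha> * (m1 + m2)"
      using up[of x y] lo[of x "\<lambda>j. - y j"] by (simp add: m1_def m2_def algebra_simps)
    also have "k * \<alpha> * (m1 + m2) \<le> k * \<alpha> * (2 * D x y)"
      using m' k by (intro mult_left_mono) auto
    finally have "4 * bil n (\<lambda>i j. H (i, j) * ratio i j) x y - k * (4 * bil n A x y) \<le> 2 * (u + k * \<alpha>) * D x y"
      unfolding hh m by (simp add: algebra_simps)
    moreover have "bil n ?C x y = bil n (\<lambda>i j. H (i, j) * ratio i j) x y - k * bil n A x y"
      by (simp add: bil_def sum_subtractf left_diff_distrib sum_distrib_left mult.assoc)
    moreover have "(u + k * \<alpha>) / 2 * D x y * 4 = 2 * (u + k * \<alpha>) * D x y" by simp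
    ultimately show ?thesis unfolding D_def by linarith
  qed
  have "bil n ?C x y \<le> (u + k * \<alpha>) * F * (sqrt (sqn n x) * sqrt (sqn n y))" for x y
  proof -
    have "2 * ((u + k * \<alpha>) / 2) = u + k * \<alpha>" by simp
    then show ?thesis using bil_le_geometric[OF F(1) le, of x y] by metis
  qed
  from this[of x y] this[of x "\<lambda>j. - y j"] show ?thesis
    unfolding neg F_def by linarith
qed

end

section \<open>Frames and loop invariants\<close>

primrec writes :: "com \<Rightarrow> nat set" where
  "writes Skip = {}"
| "writes (Assign k p q e) = {k}"
| "writes (Seq c1 c2) = writes c1 \<union> writes c2"
| "writes (IfLess e1 e2 c1 c2) = writes c1 \<union> writes c2"
| "writes (For i c) = writes c"

lemma sem_frame: "k \<notin> writes c \<Longrightarrow> sem c n \<rho> \<sigma> k = \<sigma> k"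
proof (induction c arbitrary: \<rho> \<sigma>)
  case (For i c)
  have "fold (\<lambda>m. sem c n (\<rho>(i := m))) xs \<sigma> k = \<sigma> k" for xs
    using For by (induction xs rule: rev_induct) auto
  then show ?case by simp
qed (auto simp: upd_def)

lemma upd_apply: "upd k p q v \<sigma> k' p' q' = (if k' = k \<and> p' = p \<and> q' = q then v else \<sigma> k' p' q')"
  by (simp add: upd_def)

lemma upd_other: "k' \<noteq> k \<Longrightarrow> upd k p q v \<sigma> k' = \<sigma> k'"
  by (simp add: upd_def)

text \<open>The invariant sees only the set of indices already treated. This fits sums over sets and
  \<open>mix\<close>, and lets two nested loops be handled as one loop over pairs.\<close>

lemma sem_For_set:
  assumes "P {} \<sigma>"
    "\<And>D m \<sigma>. D \<subseteq> {..<n} \<Longrightarrow> m < n \<Longrightarrow> m \<notin> D \<Longrightarrow> P D \<sigma> \<Longrightarrow> P (insert m D) (sem c n (\<rho>(i := m)) \<sigma>)"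
  shows "P {..<n} (sem (For i c) n \<rho> \<sigma>)"
proof -
  define f where "f m = sem c n (\<rho>(i := m))" for m
  have "P {..<m} (fold f [0..<m] \<sigma>)" if "m \<le> n" for m
    using that
  proof (induction m)
    case (Suc m)
    then show ?case using assms(2)[of "{..<m}" m, folded f_def] by (simp add: lessThan_Suc)
  qed (use assms(1) in simp)
  then show ?thesis by (simp add: f_def[abs_def])
qed

lemma sem_For2_set:
  assumes "P {} \<sigma>"
    "\<And>D x y \<sigma>. D \<subseteq> {..<n} \<times> {..<n} \<Longrightarrow> x < n \<Longrightarrow> y < n \<Longrightarrow> (x, y) \<notin> D \<Longrightarrow> P D \<sigma> \<Longrightarrow>
      P (insert (x, y) D) (sem c n (\<rho>(i := x, j := y)) \<sigma>)"
  shows "P ({..<n} \<times> {..<n}) (sem (For i (For j c)) n \<rho> \<sigma>)"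
proof (rule sem_For_set[where P = "\<lambda>D \<sigma>. P (D \<times> {..<n}) \<sigma>"])
  fix D x \<sigma> assume D: "D \<subseteq> {..<n}" "x < n" "x \<notin> D" "P (D \<times> {..<n}) \<sigma>"
  have "P (D \<times> {..<n} \<union> {x} \<times> {..<n}) (sem (For j c) n (\<rho>(i := x)) \<sigma>)"
  proof (rule sem_For_set[where P = "\<lambda>D' \<sigma>. P (D \<times> {..<n} \<union> {x} \<times> D') \<sigma>"])
    fix D' y \<sigma> assume "D' \<subseteq> {..<n}" "y < n" "y \<notin> D'" "P (D \<times> {..<n} \<union> {x} \<times> D') \<sigma>"
    then show "P (D \<times> {..<n} \<union> {x} \<times> insert y D') (sem c n ((\<rho>(i := x))(j := y)) \<sigma>)"
      using assms(2)[of "D \<times> {..<n} \<union> {x} \<times> D'" x y \<sigma>] D by auto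
  qed (use D in simp)
  moreover have "D \<times> {..<n} \<union> {x} \<times> {..<n} = insert x D \<times> {..<n}" by auto
  ultimately show "P (insert x D \<times> {..<n}) (sem (For j c) n (\<rho>(i := x)) \<sigma>)" by simp
qed (use assms(1) in simp)

text \<open>For loops in which only the number of rounds counts: \<open>s\<close> is the increment
  per round, so nested loops multiply.\<close>

lemma sem_For_count:
  assumes "P t \<sigma>" "\<And>t m \<sigma>. P t \<sigma> \<Longrightarrow> P (t + s) (sem c n (\<rho>(i := m)) \<sigma>)"
  shows "P (t + n * s) (sem (For i c) n \<rho> \<sigma>)"
proof -
  define f where "f m = sem c n (\<rho>(i := m))" for m
  have "P (t + m * s) (fold f [0..<m] \<sigma>)" for m
  proof (induction m)
    case (Suc m)
    then show ?case
      using assms(2)[of "t + m * s", folded f_def] by (simp add: add.assoc add.commute[of s])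
  qed (use assms(1) in simp)
  then show ?thesis by (simp add: f_def[abs_def])
qed

section \<open>The sparsification program\<close>

notation Seq (infixr ";;" 60)

abbreviation rplus (infixl "+." 65) where "x +. y \<equiv> Bin Plus x y"
abbreviation rminus (infixl "-." 65) where "x -. y \<equiv> Bin Minus x y"
abbreviation rtimes (infixl "*." 70) where "x *. y \<equiv> Bin Times x y"
abbreviation rover (infixl "'/." 70) where "x /. y \<equiv> Bin Over x y"

text \<open>Variable 0 is never assigned and holds 0; scalars live in the entry \<open>(0, 0)\<close> and vectors in row 0.\<close>

abbreviation scal :: "nat \<Rightarrow> rexp" where "scal k \<equiv> Arr k 0 0"
abbreviation put :: "nat \<Rightarrow> rexp \<Rightarrow> com" where "put k \<equiv> Assign k 0 0"

abbreviation (input) "aA \<equiv> 0 :: nat"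
abbreviation (input) "aEps \<equiv> 1 :: nat"
abbreviation (input) "aCol \<equiv> 2 :: nat"
abbreviation (input) "aFro \<equiv> 3 :: nat"
abbreviation (input) "aN \<equiv> 4 :: nat"
abbreviation (input) "aR \<equiv> 5 :: nat"
abbreviation (input) "aDone \<equiv> 6 :: nat"
abbreviation (input) "aBad \<equiv> 7 :: nat"
abbreviation (input) "aH \<equiv> 8 :: nat"
abbreviation (input) "aT \<equiv> 9 :: nat"
abbreviation (input) "aFound \<equiv> 10 :: nat"
abbreviation (input) "aB \<equiv> 11 :: nat"
abbreviation (input) "aY0 \<equiv> 12 :: nat"
abbreviation (input) "aY1 \<equiv> 13 :: nat"
abbreviation (input) "aKap \<equiv> 14 :: nat"
abbreviation (input) "aCnt \<equiv> 15 :: nat"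
abbreviation (input) "aLim \<equiv> 16 :: nat"
abbreviation (input) "aU \<equiv> 17 :: nat"
abbreviation (input) "aX \<equiv> 18 :: nat"
abbreviation (input) "aQ1 \<equiv> 19 :: nat"
abbreviation (input) "aQ2 \<equiv> 20 :: nat"
abbreviation (input) "aPhi \<equiv> 21 :: nat"
abbreviation (input) "aStep \<equiv> 22 :: nat"
abbreviation (input) "aW1 \<equiv> 24 :: nat"
abbreviation (input) "aW2 \<equiv> 28 :: nat"

text \<open>The number w_e^T W w_e' for e = (i, j) and e' = (i', j'). The arrays \<open>w\<close> to
  \<open>w + 3\<close> hold the upper left, upper right, lower left and lower right block of W; each
  vector has at most two nonzero coordinates, hence four terms.\<close>

definition bil_exp :: "nat \<Rightarrow> nat \<Rightarrow> nat \<Rightarrow> nat \<Rightarrow> nat \<Rightarrow> rexp" where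
  "bil_exp w i j i' j' =
     Arr w i i' +. Arr aB i' j' *. Arr (w + 1) i j' +.
     Arr aB i j *. (Arr (w + 2) j i' +. Arr aB i' j' *. Arr (w + 3) j j')"

text \<open>The factor and the vector W w_e are saved before any entry of W changes, since the
  update of every entry refers to the old matrix.\<close>

definition rank_one_com :: "nat \<Rightarrow> rexp \<Rightarrow> nat \<Rightarrow> nat \<Rightarrow> com" where
  "rank_one_com w c i j =
     put aKap (c /. (Const 1 +. c *. bil_exp w i j i j)) ;;
     For 9 (Assign aY0 0 9 (Arr w 9 i +. Arr aB i j *. Arr (w + 1) 9 j) ;;
            Assign aY1 0 9 (Arr (w + 2) 9 i +. Arr aB i j *. Arr (w + 3) 9 j)) ;;
     For 9 (For 10
       (Assign w 9 10 (Arr w 9 10 -. scal aKap *. Arr aY0 0 9 *. Arr aY0 0 10) ;;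
        Assign (w + 1) 9 10 (Arr (w + 1) 9 10 -. scal aKap *. Arr aY0 0 9 *. Arr aY1 0 10) ;;
        Assign (w + 2) 9 10 (Arr (w + 2) 9 10 -. scal aKap *. Arr aY1 0 9 *. Arr aY0 0 10) ;;
        Assign (w + 3) 9 10 (Arr (w + 3) 9 10 -. scal aKap *. Arr aY1 0 9 *. Arr aY1 0 10)))"

text \<open>Adds \<open>aX\<close> times M to the form by n^2 rank-one updates. A nonpositive pivot
  sets \<open>aBad\<close>, but the loop cannot be left; the later entries are then meaningless,
  though defined, because division is total.\<close>

definition shift_com :: "nat \<Rightarrow> com" where
  "shift_com w =
     For 5 (For 6
       (IfLess (Const 0) (Const 1 +. scal aX *. Arr aCol 0 6 *. bil_exp w 5 6 5 6) Skip (put aBad (Const 1)) ;;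
        rank_one_com w (scal aX *. Arr aCol 0 6) 5 6))"

definition init_com :: "nat \<Rightarrow> com" where
  "init_com w =
     For 9 (For 10
       (Assign w 9 10 (Const 0) ;; Assign (w + 1) 9 10 (Const 0) ;;
        Assign (w + 2) 9 10 (Const 0) ;; Assign (w + 3) 9 10 (Const 0))) ;;
     For 9 (Assign w 9 9 (Const 1 /. (scal aU *. scal aFro)) ;;
            Assign (w + 3) 9 9 (Const 1 /. scal aU))"

definition potential_com :: com where
  "potential_com =
     put aT (Const 0) ;;
     For 5 (For 6
       (put aT (scal aT +. Arr aCol 0 6 *. (bil_exp aW1 5 6 5 6 +. bil_exp aW2 5 6 5 6))))"

text \<open>\<open>aQ1\<close> and \<open>aQ2\<close> become y^T M y at y = W1 w_e and y = W2 w_e.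
  The candidate is taken if its new potential does not exceed \<open>aPhi\<close>, a test by
  rational operations.\<close>

definition try_com :: com where
  "try_com =
     put aStep (scal aT /. (bil_exp aW1 5 6 5 6 +. bil_exp aW2 5 6 5 6)) ;;
     put aQ1 (Const 0) ;; put aQ2 (Const 0) ;;
     For 7 (For 8
       (put aQ1 (scal aQ1 +. Arr aCol 0 8 *. (bil_exp aW1 7 8 5 6 *. bil_exp aW1 7 8 5 6)) ;;
        put aQ2 (scal aQ2 +. Arr aCol 0 8 *. (bil_exp aW2 7 8 5 6 *. bil_exp aW2 7 8 5 6)))) ;;
     IfLess (scal aPhi)
       (scal aT +. scal aStep *. scal aQ1 /. (Const 1 -. scal aStep *. bil_exp aW1 5 6 5 6)
        -. scal aStep *. scal aQ2 /. (Const 1 +. scal aStep *. bil_exp aW2 5 6 5 6))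
       Skip
       (put aFound (Const 1) ;;
        Assign aH 5 6 (Arr aH 5 6 +. scal aStep) ;;
        rank_one_com aW1 (Const 0 -. scal aStep) 5 6 ;;
        rank_one_com aW2 (scal aStep) 5 6)"

text \<open>\<open>aFound\<close> disables the rest of the search, since a loop cannot be left
  early. The second shift, by 1 / r - 1, moves the lower barrier.\<close>

definition step_com :: com where
  "step_com =
     put aBad (Const 0) ;;
     put aX (Const 1 +. Const 1 /. scal aR) ;; shift_com aW1 ;;
     put aX (Const 1 /. scal aR -. Const 1) ;; shift_com aW2 ;;
     potential_com ;;
     put aFound (Const 0) ;;
     For 5 (For 6
       (IfLess (scal aFound) (Const 1) (IfLess (Const 0) (Arr aCol 0 6) try_com Skip) Skip)) ;;
     put aCnt (scal aCnt +. Const 1)"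

text \<open>The number 2 n r^2 of steps depends on the data while every loop has n rounds. So 2 n^3
  slots are provided, and those beyond the limit do nothing.\<close>

definition guarded_step :: com where
  "guarded_step = IfLess (scal aCnt) (scal aLim) step_com Skip"

text \<open>
  In round \<open>r\<close> the parameters are \<open>\<alpha> = 1 / r\<close>, \<open>k = 2 n r\<^sup>2\<close> and \<open>u = 4 n (r + 2)\<close>; the last choice makes
  the initial potential at most \<open>1 / (r + 2)\<close>.
\<close>

definition main_com :: com where
  "main_com =
     put aU (Const 4 *. scal aN *. (scal aR +. Const 2)) ;;
     init_com aW1 ;; init_com aW2 ;;
     For 9 (For 10 (Assign aH 9 10 (Const 0))) ;;
     put aPhi (Const 1 /. (scal aR +. Const 2)) ;;
     put aCnt (Const 0) ;;
     put aLim (Const 2 *. scal aN *. scal aR *. scal aR) ;;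
     For 2 (For 3 (For 4 (guarded_step ;; guarded_step))) ;;
     For 9 (For 10 (Assign aA 9 10 (Arr aB 9 10 *. Arr aH 9 10 /. scal aLim)))"

text \<open>
  With \<open>s = r \<epsilon>\<close>, the matrix \<open>(s + 4) G - s M\<close> is positive definite roughly iff \<open>s \<parallel>A\<parallel> < 4 F\<close>; the
  first round in which this fails has \<open>r\<close> between \<open>4 F / \<epsilon>\<parallel>A\<parallel>\<close> and \<open>5 F / \<epsilon>\<parallel>A\<parallel>\<close>.
\<close>

definition test_com :: com where
  "test_com =
     put aU (scal aR *. scal aEps +. Const 4) ;;
     init_com aW1 ;;
     put aBad (Const 0) ;;
     put aX (Const 0 -. scal aR *. scal aEps) ;;
     shift_com aW1"

text \<open>The first failing test triggers \<open>main_com\<close> and sets \<open>aDone\<close>,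
  which freezes the output; if all n rounds pass, \<open>aA\<close> still holds the input.\<close>

definition round_com :: com where
  "round_com =
     IfLess (scal aDone) (Const 1)
       (test_com ;; IfLess (scal aBad) (Const 1) Skip (main_com ;; put aDone (Const 1))) Skip ;;
     put aR (scal aR +. Const 1)"

text \<open>The dimension exists only as an index and has to be counted to become a real number.
  Rounds start at 0, where the test always passes.\<close>

definition setup_com :: com where
  "setup_com =
     put aN (Const 0) ;; For 5 (put aN (scal aN +. Const 1)) ;;
     For 6 (Assign aCol 0 6 (Const 0)) ;;
     For 5 (For 6 (Assign aCol 0 6 (Arr aCol 0 6 +. Arr aA 5 6 *. Arr aA 5 6))) ;;
     put aFro (Const 0) ;; For 6 (put aFro (scal aFro +. Arr aCol 0 6)) ;;
     For 5 (For 6 (Assign aB 5 6 (Arr aA 5 6 /. Arr aCol 0 6))) ;;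
     put aR (Const 0) ;; put aDone (Const 0)"

text \<open>Up to dimension 31 the bound allows all n^2 entries, and the zero matrix is already
  sparse; in both cases the input is returned.\<close>

definition sparsify_com :: com where
  "sparsify_com =
     setup_com ;;
     IfLess (Const 31) (scal aN) (IfLess (Const 0) (scal aFro) (For 1 round_com) Skip) Skip"

lemmas com_defs = sparsify_com_def setup_com_def round_com_def test_com_def main_com_def
  guarded_step_def step_com_def try_com_def potential_com_def init_com_def shift_com_def
  rank_one_com_def bil_exp_def

lemma wf_sparsify: "wf_com {0} sparsify_com"
  by (simp add: com_defs)

definition blocks :: "store \<Rightarrow> nat \<Rightarrow> nat \<times> nat \<Rightarrow> nat \<times> nat \<Rightarrow> real" where
  "blocks \<sigma> w p q =
     \<sigma> (w + (if fst p = 0 then if fst q = 0 then 0 else 1 else if fst q = 0 then 2 else 3)) (snd p) (snd q)"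

lemma writes_rank_one: "writes (rank_one_com w c i j) = {aKap, aY0, aY1, w, w + 1, w + 2, w + 3}"
  by (auto simp: rank_one_com_def)

lemma writes_shift: "writes (shift_com w) = {aBad, aKap, aY0, aY1, w, w + 1, w + 2, w + 3}"
  by (auto simp: shift_com_def writes_rank_one)

lemma writes_init: "writes (init_com w) = {w, w + 1, w + 2, w + 3}"
  by (auto simp: init_com_def)

lemma lessThan_2: "{..<2::nat} = {0, 1}"
  by auto

context sampled_matrix
begin

text \<open>Facts established by \<open>setup_com\<close> about arrays that no later command
  writes.\<close>

definition env :: "store \<Rightarrow> bool" where
  "env \<sigma> \<longleftrightarrow> (\<forall>i<n. \<forall>j<n. \<sigma> aB i j = ratio i j) \<and> (\<forall>j<n. \<sigma> aCol 0 j = col_sq n A j) \<and>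
     \<sigma> aFro 0 0 = fro_sq n A \<and> \<sigma> aN 0 0 = n"

lemma env_frame:
  assumes "env \<sigma>" "writes c \<inter> {aB, aCol, aFro, aN} = {}"
  shows "env (sem c n \<rho> \<sigma>)"
proof -
  have "sem c n \<rho> \<sigma> k = \<sigma> k" if "k \<in> {aB, aCol, aFro, aN}" for k
    using sem_frame[of k c] that assms(2) by blast
  then show ?thesis using assms(1) by (simp add: env_def)
qed

lemma env_upd: "env \<sigma> \<Longrightarrow> k \<notin> {aB, aCol, aFro, aN} \<Longrightarrow> env (upd k p q v \<sigma>)"
  by (simp add: env_def upd_apply)

lemma rval_bil_exp:
  assumes "env \<sigma>" "\<rho> i < n" "\<rho> j < n" "\<rho> i' < n" "\<rho> j' < n"
  shows "rval \<rho> \<sigma> (bil_exp w i j i' j') =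
    dot (vec_of ratio (\<rho> i, \<rho> j)) (mv (blocks \<sigma> w) (vec_of ratio (\<rho> i', \<rho> j')))"
  using assms by (simp add: bil_exp_def env_def dot_vec_of mv_vec_of blocks_def)

lemma rval_quad:
  assumes "env \<sigma>" "\<rho> i < n" "\<rho> j < n"
  shows "rval \<rho> \<sigma> (bil_exp w i j i j) = quad (blocks \<sigma> w) (vec_of ratio (\<rho> i, \<rho> j))"
  using rval_bil_exp[of \<sigma> \<rho> i j i j w] assms by (simp add: quad_def)

text \<open>Stated on \<open>I2\<close>, since entries outside the range are not updated;
  \<open>inverse_of_cong\<close> bridges the gap. \<open>24 \<le> w\<close> separates the four
  blocks from all scratch arrays, and \<open>i\<close>, \<open>j\<close> must survive the inner
  loops over 9 and 10.\<close>

lemma sem_rank_one: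
  assumes env: "env \<sigma>" and ij: "\<rho> i < n" "\<rho> j < n" "i \<notin> {9, 10}" "j \<notin> {9, 10}"
    and "\<rho> 0 = 0" "24 \<le> w" and pq: "p \<in> I2" "q \<in> I2"
  shows "blocks (sem (rank_one_com w c i j) n \<rho> \<sigma>) w p q =
    rank_one (blocks \<sigma> w) (rval \<rho> \<sigma> c) (\<rho> i, \<rho> j) p q"
proof -
  define e where "e = (\<rho> i, \<rho> j)"
  define W where "W = blocks \<sigma> w"
  define \<kappa> where "\<kappa> = rval \<rho> \<sigma> c / (1 + rval \<rho> \<sigma> c * quad W (vec_of ratio e))"
  define y where "y = mv W (vec_of ratio e)"
  have e: "e \<in> E2" using ij by (simp add: e_def)
  define \<sigma>1 where "\<sigma>1 = upd aKap 0 0 \<kappa> \<sigma>"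
  define c2 where "c2 = (Assign aY0 0 9 (Arr w 9 i +. Arr aB i j *. Arr (w + 1) 9 j) ;;
            Assign aY1 0 9 (Arr (w + 2) 9 i +. Arr aB i j *. Arr (w + 3) 9 j))"
  define \<sigma>2 where "\<sigma>2 = sem (For 9 c2) n \<rho> \<sigma>1"
  have y: "y (0, m) = W (0, m) (0, \<rho> i) + ratio (\<rho> i) (\<rho> j) * W (0, m) (1, \<rho> j)"
    "y (1, m) = W (1, m) (0, \<rho> i) + ratio (\<rho> i) (\<rho> j) * W (1, m) (1, \<rho> j)" for m
    by (simp_all add: y_def mv_vec_of[OF e]) (simp_all add: e_def)
  define R where "R D \<sigma>2 \<longleftrightarrow> (\<forall>m\<in>D. \<sigma>2 aY0 0 m = y (0, m) \<and> \<sigma>2 aY1 0 m = y (1, m)) \<and>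
     (\<forall>k. k \<noteq> aY0 \<longrightarrow> k \<noteq> aY1 \<longrightarrow> \<sigma>2 k = \<sigma>1 k)" for D :: "nat set" and \<sigma>2 :: store
  have "R {..<n} \<sigma>2"
    unfolding \<sigma>2_def
  proof (rule sem_For_set)
    fix D m \<sigma>' assume "m < n" and P: "R D \<sigma>'"
    have \<sigma>': "\<sigma>' k = \<sigma>1 k" if "k \<noteq> aY0" "k \<noteq> aY1" for k
      using P that by (simp add: R_def)
    have 1: "\<sigma>' (w + l) p q = \<sigma> (w + l) p q" for l p q
      using assms(7) by (simp add: \<sigma>' \<sigma>1_def upd_other)
    have 2: "\<sigma>' aB (\<rho> i) (\<rho> j) = ratio (\<rho> i) (\<rho> j)"
      using env ij by (simp add: \<sigma>' \<sigma>1_def upd_other env_def)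
    have 3: "w + l \<noteq> aY0" for l using assms(7) by simp
    have "sem c2 n (\<rho>(9 := m)) \<sigma>' = upd aY1 0 m (y (1, m)) (upd aY0 0 m (y (0, m)) \<sigma>')"
      using assms(6) ij(3,4) 1[of 0] 1[of 1] 1[of 2] 1[of 3] 3[of 0] 3[of 2] 3[of 3] y[of m]
      by (simp add: c2_def upd_other 2 W_def blocks_def)
    then show "R (insert m D) (sem c2 n (\<rho>(9 := m)) \<sigma>')"
      using P by (simp add: R_def upd_apply upd_other)
  qed (simp add: R_def)
  then have Y: "\<And>m. m < n \<Longrightarrow> \<sigma>2 aY0 0 m = y (0, m)" "\<And>m. m < n \<Longrightarrow> \<sigma>2 aY1 0 m = y (1, m)"
    and fr2: "\<And>k. k \<noteq> aY0 \<Longrightarrow> k \<noteq> aY1 \<Longrightarrow> \<sigma>2 k = \<sigma>1 k"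
    by (auto simp: R_def)
  have K2: "\<sigma>2 aKap 0 0 = \<kappa>" by (simp add: fr2 \<sigma>1_def upd_apply)
  have W2: "\<sigma>2 (w + l) p q = \<sigma> (w + l) p q" for l p q
    using assms(7) by (simp add: fr2 \<sigma>1_def upd_apply)
  define c3 where "c3 = (Assign w 9 10 (Arr w 9 10 -. scal aKap *. Arr aY0 0 9 *. Arr aY0 0 10) ;;
        Assign (w + 1) 9 10 (Arr (w + 1) 9 10 -. scal aKap *. Arr aY0 0 9 *. Arr aY1 0 10) ;;
        Assign (w + 2) 9 10 (Arr (w + 2) 9 10 -. scal aKap *. Arr aY1 0 9 *. Arr aY0 0 10) ;;
        Assign (w + 3) 9 10 (Arr (w + 3) 9 10 -. scal aKap *. Arr aY1 0 9 *. Arr aY1 0 10))"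
  define Q where "Q D \<sigma>3 \<longleftrightarrow> (\<forall>m l.
      \<sigma>3 w m l = (if (m, l) \<in> D then W (0, m) (0, l) - \<kappa> * y (0, m) * y (0, l) else W (0, m) (0, l)) \<and>
      \<sigma>3 (w + 1) m l = (if (m, l) \<in> D then W (0, m) (1, l) - \<kappa> * y (0, m) * y (1, l) else W (0, m) (1, l)) \<and>
      \<sigma>3 (w + 2) m l = (if (m, l) \<in> D then W (1, m) (0, l) - \<kappa> * y (1, m) * y (0, l) else W (1, m) (0, l)) \<and>
      \<sigma>3 (w + 3) m l = (if (m, l) \<in> D then W (1, m) (1, l) - \<kappa> * y (1, m) * y (1, l) else W (1, m) (1, l))) \<and>
      \<sigma>3 aKap = \<sigma>2 aKap \<and> \<sigma>3 aY0 = \<sigma>2 aY0 \<and> \<sigma>3 aY1 = \<sigma>2 aY1" for D \<sigma>3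
  have "Q E2 (sem (For 9 (For 10 c3)) n \<rho> \<sigma>2)"
  proof (rule sem_For2_set)
    show "Q {} \<sigma>2"
      using W2[of 0] W2[of 1] W2[of 2] W2[of 3] by (auto simp: Q_def W_def blocks_def)
  next
    fix D x y' \<sigma>3 assume a: "x < n" "y' < n" "(x, y') \<notin> D" "Q D \<sigma>3"
    have "\<sigma>3 w x y' = W (0, x) (0, y')" "\<sigma>3 (w + 1) x y' = W (0, x) (1, y')"
      "\<sigma>3 (w + 2) x y' = W (1, x) (0, y')" "\<sigma>3 (w + 3) x y' = W (1, x) (1, y')"
      "\<sigma>3 aKap 0 0 = \<kappa>" "\<sigma>3 aY0 0 x = y (0, x)" "\<sigma>3 aY0 0 y' = y (0, y')"
      "\<sigma>3 aY1 0 x = y (1, x)" "\<sigma>3 aY1 0 y' = y (1, y')"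
      using a K2 Y by (simp_all add: Q_def)
    then have s: "sem c3 n (\<rho>(9 := x, 10 := y')) \<sigma>3 =
       upd (w + 3) x y' (W (1, x) (1, y') - \<kappa> * y (1, x) * y (1, y'))
       (upd (w + 2) x y' (W (1, x) (0, y') - \<kappa> * y (1, x) * y (0, y'))
       (upd (w + 1) x y' (W (0, x) (1, y') - \<kappa> * y (0, x) * y (1, y'))
       (upd w x y' (W (0, x) (0, y') - \<kappa> * y (0, x) * y (0, y')) \<sigma>3)))"
      using assms(6,7) by (simp add: c3_def upd_apply)
    show "Q (insert (x, y') D) (sem c3 n (\<rho>(9 := x, 10 := y')) \<sigma>3)"
      using a(4) assms(7) unfolding s Q_def by (auto simp: upd_apply fun_eq_iff)
  qed
  moreover have "sem (rank_one_com w c i j) n \<rho> \<sigma> = sem (For 9 (For 10 c3)) n \<rho> \<sigma>2"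
    using assms(6) rval_quad[of \<sigma> \<rho> i j w] env ij(1,2)
    by (simp add: rank_one_com_def c3_def \<sigma>2_def c2_def \<sigma>1_def \<kappa>_def W_def e_def)
  ultimately have "blocks (sem (rank_one_com w c i j) n \<rho> \<sigma>) w p q = W p q - \<kappa> * y p * y q"
    using pq by (auto simp: Q_def blocks_def lessThan_2)
  then show ?thesis
    by (simp add: rank_one_def W_def[symmetric] \<kappa>_def y_def e_def)
qed

text \<open>The test is sound and complete: if all pivots are positive,
  \<open>posdef_rank_one\<close> carries definiteness to the end; if the target is positive
  definite, so are all intermediate forms, and \<open>posdef_rank_one_conv\<close> makes every pivot
  positive. Once \<open>aBad\<close> is set, the invariant claims nothing about the inverse.\<close>

lemma sem_shift:
  assumes env: "env \<sigma>" and "\<rho> 0 = 0" "24 \<le> w" and bad: "\<sigma> aBad 0 0 = 0"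
    and pos: "posdef u c" and inv: "inverse_of u c (blocks \<sigma> w)"
  defines "x \<equiv> \<sigma> aX 0 0"
  defines "\<sigma>' \<equiv> sem (shift_com w) n \<rho> \<sigma>"
  shows "\<sigma>' aBad 0 0 \<in> {0, 1}"
    and "\<sigma>' aBad 0 0 = 0 \<Longrightarrow> posdef u (\<lambda>e. c e + x * wt e)"
    and "posdef u (\<lambda>e. c e + x * wt e) \<Longrightarrow> \<sigma>' aBad 0 0 = 0"
    and "posdef u (\<lambda>e. c e + x * wt e) \<Longrightarrow> inverse_of u (\<lambda>e. c e + x * wt e) (blocks \<sigma>' w)"
proof -
  define \<delta> where "\<delta> e = x * wt e" for e
  define f where "f = (\<lambda>e. c e + x * wt e)"
  have mixE: "mix c \<delta> E2 e = f e" if "e \<in> E2" for e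
    using that by (simp add: mix_def \<delta>_def f_def)
  \<comment> \<open>Depending on the sign of \<open>x\<close>, the intermediate forms lie above the
    start or above the target.\<close>
  have mono: "posdef u (mix c \<delta> D)" if "posdef u f" for D
  proof (cases "0 \<le> x")
    case True
    then show ?thesis using pos g_nonneg by (intro posdef_mix_nonneg) (auto simp: \<delta>_def)
  next
    case False
    then show ?thesis using that g_nonneg unfolding f_def
      by (intro posdef_mix_nonpos) (auto simp: \<delta>_def intro: mult_nonpos_nonneg)
  qed
  define body where "body = (IfLess (Const 0) (Const 1 +. scal aX *. Arr aCol 0 6 *. bil_exp w 5 6 5 6) Skip (put aBad (Const 1)) ;;
        rank_one_com w (scal aX *. Arr aCol 0 6) 5 6)"
  define Q where "Q D s \<longleftrightarrow> env s \<and> s aX 0 0 = x \<and> s aBad 0 0 \<in> {0, 1} \<and>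
     (s aBad 0 0 = 0 \<longrightarrow> posdef u (mix c \<delta> D) \<and> inverse_of u (mix c \<delta> D) (blocks s w)) \<and>
     (posdef u f \<longrightarrow> s aBad 0 0 = 0)" for D s
  have "Q E2 \<sigma>'"
    unfolding \<sigma>'_def shift_com_def body_def[symmetric]
  proof (rule sem_For2_set)
    show "Q {} \<sigma>"
      using env bad pos inv by (simp add: Q_def x_def mix_def)
  next
    fix D i j s assume ij: "i < n" "j < n" "(i, j) \<notin> D" and Q: "Q D s"
    let ?\<rho> = "\<rho>(5 := i, 6 := j)"
    let ?e = "(i, j)" and ?D = "insert (i, j) D"
    have e: "?e \<in> E2" using ij by simp
    have env_s: "env s" "s aX 0 0 = x" using Q by (simp_all add: Q_def)
    define s1 where "s1 = (if 0 < 1 + \<delta> ?e * quad (blocks s w) (vec_of ratio ?e) then s else upd aBad 0 0 1 s)"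
    define s2 where "s2 = sem (rank_one_com w (scal aX *. Arr aCol 0 6) 5 6) n ?\<rho> s1"
    have v: "rval ?\<rho> t (scal aX *. Arr aCol 0 6) = \<delta> ?e" if "env t" "t aX 0 0 = x" for t
      using that ij assms(2) by (simp add: env_def \<delta>_def wt_def)
    have sem_body: "sem body n ?\<rho> s = s2"
      using env_s ij assms(2) v[OF env_s] rval_quad[of s ?\<rho> 5 6 w] by (simp add: body_def s2_def s1_def)
    have env1: "env s1" "s1 aX 0 0 = x" and blk: "blocks s1 w = blocks s w"
      using env_s assms(3) by (auto simp: s1_def env_upd upd_apply blocks_def fun_eq_iff)
    have env2: "env s2" "s2 aX 0 0 = x" and bad2: "s2 aBad = s1 aBad"
      using env1 assms(3) unfolding s2_def
      by (auto intro!: env_frame simp: writes_rank_one sem_frame)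
    have blk2: "blocks s2 w p q = rank_one (blocks s w) (\<delta> ?e) ?e p q" if "p \<in> I2" "q \<in> I2" for p q
      using sem_rank_one[of s1 ?\<rho> 5 6 w p q "scal aX *. Arr aCol 0 6"] env1 ij assms(2,3) that v[OF env1]
      by (simp add: s2_def blk)
    show "Q ?D (sem body n ?\<rho> s)"
      unfolding sem_body Q_def
    proof (intro conjI impI env2)
      assume "s2 aBad 0 0 = 0"
      then have h: "s aBad 0 0 = 0" "0 < 1 + \<delta> ?e * quad (blocks s w) (vec_of ratio ?e)"
        by (auto simp: bad2 s1_def upd_apply split: if_splits)
      then have P: "posdef u (mix c \<delta> D)" "inverse_of u (mix c \<delta> D) (blocks s w)"
        using Q by (simp_all add: Q_def)
      show "posdef u (mix c \<delta> ?D)"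
        unfolding mix_insert[OF ij(3)] by (rule posdef_rank_one[OF P e h(2)])
      have "inverse_of u (mix c \<delta> ?D) (rank_one (blocks s w) (\<delta> ?e) ?e)"
        unfolding mix_insert[OF ij(3)] using h(2) by (intro inverse_of_rank_one[OF P(2) e]) simp
      then show "inverse_of u (mix c \<delta> ?D) (blocks s2 w)"
        by (rule inverse_of_cong) (rule blk2)
    next
      show "s2 aBad 0 0 \<in> {0, 1}" using Q by (simp add: bad2 s1_def upd_apply Q_def)
    next
      assume f: "posdef u f"
      then have h: "s aBad 0 0 = 0" using Q by (simp add: Q_def)
      then have P: "posdef u (mix c \<delta> D)" "inverse_of u (mix c \<delta> D) (blocks s w)"
        using Q by (simp_all add: Q_def)
      have "0 < 1 + \<delta> ?e * quad (blocks s w) (vec_of ratio ?e)"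
        by (rule mix_step(1)[OF P e ij(3) mono[OF f]])
      then show "s2 aBad 0 0 = 0" using h by (simp add: bad2 s1_def)
    qed
  qed
  then have Q: "Q E2 \<sigma>'" .
  have c1: "posdef u f" if "\<sigma>' aBad 0 0 = 0"
    using Q that posdef_cong[of u "mix c \<delta> E2" f] mixE unfolding Q_def by blast
  have c2: "\<sigma>' aBad 0 0 = 0" "inverse_of u f (blocks \<sigma>' w)" if "posdef u f"
    using Q that inverse_of_coeff_cong[of u "mix c \<delta> E2" _ f] mixE unfolding Q_def by blast+
  show "\<sigma>' aBad 0 0 \<in> {0, 1}" using Q by (simp add: Q_def)
  show "\<sigma>' aBad 0 0 = 0 \<Longrightarrow> posdef u (\<lambda>e. c e + x * wt e)"
    and "posdef u (\<lambda>e. c e + x * wt e) \<Longrightarrow> \<sigma>' aBad 0 0 = 0"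
    and "posdef u (\<lambda>e. c e + x * wt e) \<Longrightarrow> inverse_of u (\<lambda>e. c e + x * wt e) (blocks \<sigma>' w)"
    using c1 c2 unfolding f_def by blast+
qed

lemma sem_init:
  assumes env: "env \<sigma>" and "\<rho> 0 = 0" "24 \<le> w" and pq: "p \<in> I2" "q \<in> I2"
  shows "blocks (sem (init_com w) n \<rho> \<sigma>) w p q = (if p = q then 1 / (\<sigma> aU 0 0 * Gd p) else 0)"
proof -
  define u where "u = \<sigma> aU 0 0"
  define c1 where "c1 = (Assign w 9 10 (Const 0) ;; Assign (w + 1) 9 10 (Const 0) ;;
        Assign (w + 2) 9 10 (Const 0) ;; Assign (w + 3) 9 10 (Const 0))"
  define c2 where "c2 = (Assign w 9 9 (Const 1 /. (scal aU *. scal aFro)) ;;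
            Assign (w + 3) 9 9 (Const 1 /. scal aU))"
  define \<sigma>1 where "\<sigma>1 = sem (For 9 (For 10 c1)) n \<rho> \<sigma>"
  define Q where "Q D s \<longleftrightarrow> (\<forall>(x, y)\<in>D. s w x y = 0 \<and> s (w + 1) x y = 0 \<and> s (w + 2) x y = 0 \<and> s (w + 3) x y = 0)"
    for D and s :: store
  have "Q E2 \<sigma>1"
    unfolding \<sigma>1_def
  proof (rule sem_For2_set)
    show "Q {} \<sigma>" by (simp add: Q_def)
  next
    fix D x y s assume "Q D s"
    then show "Q (insert (x, y) D) (sem c1 n (\<rho>(9 := x, 10 := y)) s)"
      by (auto simp: Q_def c1_def upd_apply)
  qed
  then have z: "\<sigma>1 w x y = 0" "\<sigma>1 (w + 1) x y = 0" "\<sigma>1 (w + 2) x y = 0" "\<sigma>1 (w + 3) x y = 0"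
    if "x < n" "y < n" for x y
    using that by (auto simp: Q_def)
  have fr: "\<sigma>1 k = \<sigma> k" if "k < 24" for k
    unfolding \<sigma>1_def using that assms(3) by (intro sem_frame) (auto simp: c1_def)
  define R where "R D s \<longleftrightarrow> (\<forall>x y. s w x y = (if x = y \<and> x \<in> D then 1 / (u * fro_sq n A) else \<sigma>1 w x y) \<and>
      s (w + 1) x y = \<sigma>1 (w + 1) x y \<and> s (w + 2) x y = \<sigma>1 (w + 2) x y \<and>
      s (w + 3) x y = (if x = y \<and> x \<in> D then 1 / u else \<sigma>1 (w + 3) x y)) \<and> (\<forall>k<24. s k = \<sigma> k)"
    for D :: "nat set" and s :: store
  define s where "s = sem (For 9 c2) n \<rho> \<sigma>1"
  have "R {..<n} s"
    unfolding s_def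
  proof (rule sem_For_set)
    show "R {} \<sigma>1" by (simp add: R_def fr)
  next
    fix D m t assume "R D t" "m < n"
    then have t: "t aU 0 0 = u" "t aFro 0 0 = fro_sq n A"
      using env by (simp_all add: R_def u_def env_def)
    have "sem c2 n (\<rho>(9 := m)) t = upd (w + 3) m m (1 / u) (upd w m m (1 / (u * fro_sq n A)) t)"
      using assms(2,3) t by (simp add: c2_def upd_other)
    then show "R (insert m D) (sem c2 n (\<rho>(9 := m)) t)"
      using \<open>R D t\<close> assms(3) by (auto simp: R_def upd_apply upd_other)
  qed
  then have "blocks s w p q = (if p = q then 1 / (u * Gd p) else 0)"
    using pq z by (auto simp: R_def blocks_def Gd_def lessThan_2)
  moreover have "s = sem (init_com w) n \<rho> \<sigma>"
    by (simp add: s_def \<sigma>1_def init_com_def c1_def c2_def)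
  ultimately show ?thesis by (simp add: u_def)
qed

lemma sem_potential:
  assumes env: "env \<sigma>" and "\<rho> 0 = 0"
  defines "\<sigma>' \<equiv> sem potential_com n \<rho> \<sigma>"
  shows "\<sigma>' aT 0 0 = potential (blocks \<sigma> aW1) + potential (blocks \<sigma> aW2)" "\<And>k. k \<noteq> aT \<Longrightarrow> \<sigma>' k = \<sigma> k"
proof -
  define body where "body = put aT (scal aT +. Arr aCol 0 6 *. (bil_exp aW1 5 6 5 6 +. bil_exp aW2 5 6 5 6))"
  define f where "f e = wt e * (quad (blocks \<sigma> aW1) (vec_of ratio e) + quad (blocks \<sigma> aW2) (vec_of ratio e))" for e
  define Q where "Q D s \<longleftrightarrow> finite D \<and> (\<forall>k. k \<noteq> aT \<longrightarrow> s k = \<sigma> k) \<and> s aT 0 0 = (\<Sum>e\<in>D. f e)"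
    for D and s :: store
  have "Q E2 (sem (For 5 (For 6 body)) n \<rho> (upd aT 0 0 0 \<sigma>))"
  proof (rule sem_For2_set)
    show "Q {} (upd aT 0 0 0 \<sigma>)" by (simp add: Q_def upd_apply upd_other)
  next
    fix D i j s assume ij: "i < n" "j < n" "(i, j) \<notin> D" and Q: "Q D s"
    let ?\<rho> = "\<rho>(5 := i, 6 := j)"
    have s: "s k = \<sigma> k" if "k \<noteq> aT" for k using Q that by (simp add: Q_def)
    have env_s: "env s" using env by (simp add: env_def s)
    have blk: "blocks s aW1 = blocks \<sigma> aW1" "blocks s aW2 = blocks \<sigma> aW2"
      by (auto simp: blocks_def s fun_eq_iff)
    have "rval ?\<rho> s (Arr aCol 0 6 *. (bil_exp aW1 5 6 5 6 +. bil_exp aW2 5 6 5 6)) = f (i, j)"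
      using rval_quad[OF env_s, of ?\<rho> 5 6] ij env_s assms(2) by (simp add: blk f_def wt_def env_def)
    then have "sem body n ?\<rho> s = upd aT 0 0 (s aT 0 0 + f (i, j)) s"
      using assms(2) by (simp add: body_def)
    then show "Q (insert (i, j) D) (sem body n ?\<rho> s)"
      using Q ij by (simp add: Q_def upd_apply upd_other)
  qed
  moreover have "\<sigma>' = sem (For 5 (For 6 body)) n \<rho> (upd aT 0 0 0 \<sigma>)"
    using assms(2) by (simp add: \<sigma>'_def potential_com_def body_def)
  ultimately have Q: "Q E2 \<sigma>'" by simp
  then have "\<sigma>' aT 0 0 = (\<Sum>e\<in>E2. f e)" by (simp add: Q_def)
  then show "\<sigma>' aT 0 0 = potential (blocks \<sigma> aW1) + potential (blocks \<sigma> aW2)"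
    by (simp add: potential_def f_def distrib_left sum.distrib)
  show "\<And>k. k \<noteq> aT \<Longrightarrow> \<sigma>' k = \<sigma> k" using Q by (simp add: Q_def)
qed

lemma sem_try:
  assumes env: "env \<sigma>" and \<rho>: "\<rho> 0 = 0" "\<rho> 5 = i" "\<rho> 6 = j" and ij: "i < n" "j < n"
  defines "W1 \<equiv> blocks \<sigma> aW1" and "W2 \<equiv> blocks \<sigma> aW2"
  assumes T: "\<sigma> aT 0 0 = potential W1 + potential W2"
  defines "h \<equiv> step_size W1 W2 (i, j)" and "\<sigma>' \<equiv> sem try_com n \<rho> \<sigma>"
  shows "\<sigma> aPhi 0 0 < new_potential W1 W2 (i, j) \<Longrightarrow>
      \<sigma>' aFound = \<sigma> aFound \<and> \<sigma>' aH = \<sigma> aH \<and> blocks \<sigma>' aW1 = W1 \<and> blocks \<sigma>' aW2 = W2"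
    and "\<not> \<sigma> aPhi 0 0 < new_potential W1 W2 (i, j) \<Longrightarrow>
      \<sigma>' aFound 0 0 = 1 \<and> (\<forall>x y. \<sigma>' aH x y = (if (x, y) = (i, j) then \<sigma> aH x y + h else \<sigma> aH x y)) \<and>
      (\<forall>p\<in>I2. \<forall>q\<in>I2. blocks \<sigma>' aW1 p q = rank_one W1 (- h) (i, j) p q \<and>
        blocks \<sigma>' aW2 p q = rank_one W2 h (i, j) p q)"
proof -
  let ?e = "(i, j)"
  have e: "?e \<in> E2" using ij by simp
  define \<sigma>1 where "\<sigma>1 = upd aQ2 0 0 0 (upd aQ1 0 0 0 (upd aStep 0 0 h \<sigma>))"
  define body where "body = (put aQ1 (scal aQ1 +. Arr aCol 0 8 *. (bil_exp aW1 7 8 5 6 *. bil_exp aW1 7 8 5 6)) ;;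
        put aQ2 (scal aQ2 +. Arr aCol 0 8 *. (bil_exp aW2 7 8 5 6 *. bil_exp aW2 7 8 5 6)))"
  define \<sigma>2 where "\<sigma>2 = sem (For 7 (For 8 body)) n \<rho> \<sigma>1"
  have blkI: "blocks s aW1 = W1 \<and> blocks s aW2 = W2 \<and> env s" if "\<And>k. k \<notin> {aQ1, aQ2, aStep} \<Longrightarrow> s k = \<sigma> k" for s
    using that env by (auto simp: W1_def W2_def blocks_def fun_eq_iff env_def)
  define f1 where "f1 e = wt e * (dot (vec_of ratio e) (mv W1 (vec_of ratio ?e)))\<^sup>2" for e
  define f2 where "f2 e = wt e * (dot (vec_of ratio e) (mv W2 (vec_of ratio ?e)))\<^sup>2" for e
  define Q where "Q D s \<longleftrightarrow> finite D \<and> (\<forall>k. k \<notin> {aQ1, aQ2, aStep} \<longrightarrow> s k = \<sigma> k) \<and> s aStep 0 0 = h \<and>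
    s aQ1 0 0 = (\<Sum>e\<in>D. f1 e) \<and> s aQ2 0 0 = (\<Sum>e\<in>D. f2 e)" for D and s :: store
  have "Q E2 \<sigma>2"
    unfolding \<sigma>2_def
  proof (rule sem_For2_set)
    show "Q {} \<sigma>1" by (simp add: Q_def \<sigma>1_def upd_apply upd_other)
  next
    fix D x y s assume xy: "x < n" "y < n" "(x, y) \<notin> D" and Q: "Q D s"
    let ?\<rho> = "\<rho>(7 := x, 8 := y)"
    define s1 where "s1 = upd aQ1 0 0 (s aQ1 0 0 + f1 (x, y)) s"
    have s: "s k = \<sigma> k" "s1 k = \<sigma> k" if "k \<notin> {aQ1, aQ2, aStep}" for k
      using Q that by (simp_all add: Q_def s1_def upd_other)
    have bs: "blocks s aW1 = W1" "env s" and bs1: "blocks s1 aW2 = W2" "env s1"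
      using blkI[of s] blkI[of s1] s by auto
    have "rval ?\<rho> s (Arr aCol 0 8 *. (bil_exp aW1 7 8 5 6 *. bil_exp aW1 7 8 5 6)) = f1 (x, y)"
      using rval_bil_exp[OF bs(2), of ?\<rho> 7 8 5 6 aW1] ij xy bs(2) \<rho>
      by (simp add: bs f1_def wt_def env_def power2_eq_square)
    then have 1: "sem (put aQ1 (scal aQ1 +. Arr aCol 0 8 *. (bil_exp aW1 7 8 5 6 *. bil_exp aW1 7 8 5 6))) n ?\<rho> s = s1"
      using \<rho> by (simp add: s1_def)
    have "rval ?\<rho> s1 (Arr aCol 0 8 *. (bil_exp aW2 7 8 5 6 *. bil_exp aW2 7 8 5 6)) = f2 (x, y)"
      using rval_bil_exp[OF bs1(2), of ?\<rho> 7 8 5 6 aW2] ij xy bs1(2) \<rho>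
      by (simp add: bs1 f2_def wt_def env_def power2_eq_square)
    then have "sem body n ?\<rho> s = upd aQ2 0 0 (s1 aQ2 0 0 + f2 (x, y)) s1"
      unfolding body_def sem.simps(3) 1 using \<rho> by simp
    then show "Q (insert (x, y) D) (sem body n ?\<rho> s)"
      using Q xy by (simp add: Q_def s1_def upd_apply upd_other)
  qed
  then have Q: "Q E2 \<sigma>2" .
  then have fr2: "\<sigma>2 k = \<sigma> k" if "k \<notin> {aQ1, aQ2, aStep}" for k using that by (simp add: Q_def)
  have b2: "blocks \<sigma>2 aW1 = W1" "blocks \<sigma>2 aW2 = W2" "env \<sigma>2"
    using blkI[of \<sigma>2] fr2 by auto
  have q2: "\<sigma>2 aStep 0 0 = h" "\<sigma>2 aQ1 0 0 = sq_sum (mv W1 (vec_of ratio ?e))" "\<sigma>2 aQ2 0 0 = sq_sum (mv W2 (vec_of ratio ?e))"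
    using Q by (simp_all add: Q_def f1_def f2_def sq_sum_def)
  define apply_com where "apply_com = (put aFound (Const 1) ;;
        Assign aH 5 6 (Arr aH 5 6 +. scal aStep) ;;
        rank_one_com aW1 (Const 0 -. scal aStep) 5 6 ;;
        rank_one_com aW2 (scal aStep) 5 6)"
  have "rval \<rho> \<sigma> (scal aT /. (bil_exp aW1 5 6 5 6 +. bil_exp aW2 5 6 5 6)) = h"
    using rval_quad[OF env, of \<rho> 5 6] \<rho> ij T by (simp add: h_def step_size_def W1_def W2_def)
  then have "sem (put aStep (scal aT /. (bil_exp aW1 5 6 5 6 +. bil_exp aW2 5 6 5 6)) ;;
     put aQ1 (Const 0) ;; put aQ2 (Const 0)) n \<rho> \<sigma> = \<sigma>1"
    using \<rho> by (simp add: \<sigma>1_def)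
  moreover have "rval \<rho> \<sigma>2 (scal aT +. scal aStep *. scal aQ1 /. (Const 1 -. scal aStep *. bil_exp aW1 5 6 5 6)
        -. scal aStep *. scal aQ2 /. (Const 1 +. scal aStep *. bil_exp aW2 5 6 5 6)) = new_potential W1 W2 ?e"
    using rval_quad[OF b2(3), of \<rho> 5 6] \<rho> ij T
    by (simp add: b2 q2 fr2 new_potential_def Let_def h_def)
  ultimately have \<sigma>': "\<sigma>' = (if \<sigma> aPhi 0 0 < new_potential W1 W2 ?e then \<sigma>2 else sem apply_com n \<rho> \<sigma>2)"
    using \<rho> fr2[of aPhi] by (simp add: \<sigma>'_def try_com_def \<sigma>2_def body_def apply_com_def)
  show "\<sigma> aPhi 0 0 < new_potential W1 W2 (i, j) \<Longrightarrow>
      \<sigma>' aFound = \<sigma> aFound \<and> \<sigma>' aH = \<sigma> aH \<and> blocks \<sigma>' aW1 = W1 \<and> blocks \<sigma>' aW2 = W2"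
    by (simp add: \<sigma>' fr2 b2)
  show "\<sigma>' aFound 0 0 = 1 \<and> (\<forall>x y. \<sigma>' aH x y = (if (x, y) = (i, j) then \<sigma> aH x y + h else \<sigma> aH x y)) \<and>
      (\<forall>p\<in>I2. \<forall>q\<in>I2. blocks \<sigma>' aW1 p q = rank_one W1 (- h) (i, j) p q \<and>
        blocks \<sigma>' aW2 p q = rank_one W2 h (i, j) p q)"
    if "\<not> \<sigma> aPhi 0 0 < new_potential W1 W2 (i, j)"
  proof -
    define \<sigma>3 where "\<sigma>3 = upd aH i j (\<sigma> aH i j + h) (upd aFound 0 0 1 \<sigma>2)"
    define \<sigma>4 where "\<sigma>4 = sem (rank_one_com aW1 (Const 0 -. scal aStep) 5 6) n \<rho> \<sigma>3"
    have eq: "\<sigma>' = sem (rank_one_com aW2 (scal aStep) 5 6) n \<rho> \<sigma>4"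
      using that \<rho> by (simp add: \<sigma>' apply_com_def \<sigma>4_def \<sigma>3_def fr2 q2 upd_apply)
    have env3: "env \<sigma>3" using b2(3) by (simp add: \<sigma>3_def env_upd)
    then have env4: "env \<sigma>4" unfolding \<sigma>4_def by (rule env_frame) (simp add: writes_rank_one)
    have h3: "\<sigma>3 aStep 0 0 = h" by (simp add: \<sigma>3_def upd_apply q2)
    have fr4: "\<sigma>4 k = \<sigma>3 k" if "k \<notin> {aKap, aY0, aY1, 24, 25, 26, 27}" for k
      unfolding \<sigma>4_def using that by (intro sem_frame) (simp add: writes_rank_one)
    have fr5: "\<sigma>' k = \<sigma>4 k" if "k \<notin> {aKap, aY0, aY1, 28, 29, 30, 31}" for k
      unfolding eq using that by (intro sem_frame) (simp add: writes_rank_one)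
    have b3: "blocks \<sigma>3 aW1 = W1"
      using b2(1) by (simp add: \<sigma>3_def blocks_def fun_eq_iff upd_apply)
    have b4: "blocks \<sigma>4 aW2 = W2"
      using b2(2) by (simp add: \<sigma>3_def blocks_def fun_eq_iff upd_apply fr4)
    have b5: "blocks \<sigma>' aW1 = blocks \<sigma>4 aW1"
      by (simp add: blocks_def fun_eq_iff fr5)
    have "blocks \<sigma>4 aW1 p q = rank_one W1 (- h) ?e p q" if "p \<in> I2" "q \<in> I2" for p q
      unfolding \<sigma>4_def using sem_rank_one[OF env3, of \<rho> 5 6 aW1 p q] that \<rho> ij h3 by (simp add: b3)
    moreover have "blocks \<sigma>' aW2 p q = rank_one W2 h ?e p q" if "p \<in> I2" "q \<in> I2" for p q
      unfolding eq using sem_rank_one[OF env4, of \<rho> 5 6 aW2 p q] that \<rho> ij h3 by (simp add: b4 fr4)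
    moreover have "\<sigma>' aFound 0 0 = 1" by (simp add: fr5 fr4 \<sigma>3_def upd_apply)
    moreover have "\<sigma>' aH x y = (if (x, y) = (i, j) then \<sigma> aH x y + h else \<sigma> aH x y)" for x y
      by (simp add: fr5 fr4 \<sigma>3_def upd_apply fr2)
    ultimately show ?thesis by (simp add: b5)
  qed
qed

end

section \<open>Correctness of the sparsification program\<close>

context sampled_matrix
begin

text \<open>The state after t steps in round r. The array \<open>aH\<close> holds the coefficients
  of the sparse sum S; the two forms are the barriers U and L with \<alpha> = 1 / r. Each step
  changes one coefficient, hence the cardinality bound.\<close>

definition step_inv :: "real \<Rightarrow> nat \<Rightarrow> store \<Rightarrow> bool" where
  "step_inv r t \<sigma> \<longleftrightarrow>
     env \<sigma> \<and> \<sigma> aR 0 0 = r \<and> \<sigma> aPhi 0 0 = 1 / (r + 2) \<and> \<sigma> aCnt 0 0 = real t \<and>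
     posdef (4 * real n * (r + 2)) (\<lambda>e. real t * (1 + 1 / r) * wt e - \<sigma> aH (fst e) (snd e)) \<and>
     posdef (4 * real n * (r + 2)) (\<lambda>e. \<sigma> aH (fst e) (snd e) - real t * (1 - 1 / r) * wt e) \<and>
     inverse_of (4 * real n * (r + 2)) (\<lambda>e. real t * (1 + 1 / r) * wt e - \<sigma> aH (fst e) (snd e)) (blocks \<sigma> aW1) \<and>
     inverse_of (4 * real n * (r + 2)) (\<lambda>e. \<sigma> aH (fst e) (snd e) - real t * (1 - 1 / r) * wt e) (blocks \<sigma> aW2) \<and>
     potential (blocks \<sigma> aW1) + potential (blocks \<sigma> aW2) \<le> 1 / (r + 2) \<and>
     card {e \<in> E2. \<sigma> aH (fst e) (snd e) \<noteq> 0} \<le> t"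

lemma writes_potential: "writes potential_com = {aT}"
  by (simp add: potential_com_def)

lemma writes_try: "writes try_com = {aStep, aQ1, aQ2, aFound, aH, aKap, aY0, aY1} \<union> {24..31}"
  by (auto simp: try_com_def writes_rank_one)

lemma exists_positive_weight: "\<exists>e\<in>E2. 0 < wt e"
proof (rule ccontr)
  assume neg: "\<not> ?thesis"
  have "col_sq n A j \<le> 0" if "j < n" for j
  proof -
    have "(j, j) \<in> E2" using that by simp
    with neg have "\<not> 0 < wt (j, j)" by blast
    then show ?thesis by (simp add: wt_def)
  qed
  then have "fro_sq n A \<le> 0" unfolding fro_sq_def by (intro sum_nonpos) auto
  then show False using fro_pos by simp
qed

lemma vec_of_nonzero: "\<forall>e\<in>E2. \<exists>i\<in>I2. vec_of ratio e i \<noteq> 0"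
proof
  fix e assume "e \<in> E2"
  then show "\<exists>i\<in>I2. vec_of ratio e i \<noteq> 0"
    by (intro bexI[of _ "(0, fst e)"]) (auto simp: vec_of_def)
qed

definition search_com :: com where
  "search_com = IfLess (scal aFound) (Const 1) (IfLess (Const 0) (Arr aCol 0 6) try_com Skip) Skip"

text \<open>Loop invariant: either no pair visited so far is good and the inverses are unchanged, or
  one good pair has been applied and the state is frozen. At the end the first case contradicts the
  existence of a good pair.\<close>

lemma sem_search:
  assumes env: "env \<sigma>" and \<rho>: "\<rho> 0 = 0"
  defines "W1 \<equiv> blocks \<sigma> aW1" and "W2 \<equiv> blocks \<sigma> aW2"
  assumes T: "\<sigma> aT 0 0 = potential W1 + potential W2" and F: "\<sigma> aFound 0 0 = 0"
    and ex: "\<exists>e\<in>E2. 0 < wt e \<and> new_potential W1 W2 e \<le> \<sigma> aPhi 0 0"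
  defines "\<sigma>' \<equiv> sem (For 5 (For 6 search_com)) n \<rho> \<sigma>"
  shows "\<exists>e\<in>E2. new_potential W1 W2 e \<le> \<sigma> aPhi 0 0 \<and>
    (\<forall>p\<in>I2. \<forall>q\<in>I2. blocks \<sigma>' aW1 p q = rank_one W1 (- step_size W1 W2 e) e p q \<and>
      blocks \<sigma>' aW2 p q = rank_one W2 (step_size W1 W2 e) e p q) \<and>
    (\<forall>x y. \<sigma>' aH x y = (if (x, y) = e then \<sigma> aH x y + step_size W1 W2 e else \<sigma> aH x y))"
proof -
  define good where "good e \<longleftrightarrow> 0 < wt e \<and> new_potential W1 W2 e \<le> \<sigma> aPhi 0 0" for e
  define applied where "applied e s \<longleftrightarrow> (\<forall>p\<in>I2. \<forall>q\<in>I2. blocks s aW1 p q = rank_one W1 (- step_size W1 W2 e) e p q \<and>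
        blocks s aW2 p q = rank_one W2 (step_size W1 W2 e) e p q) \<and>
      (\<forall>x y. s aH x y = (if (x, y) = e then \<sigma> aH x y + step_size W1 W2 e else \<sigma> aH x y))" for e and s :: store
  define Q where "Q D s \<longleftrightarrow> env s \<and> s aPhi = \<sigma> aPhi \<and> s aT = \<sigma> aT \<and>
     (s aFound 0 0 = 0 \<and> blocks s aW1 = W1 \<and> blocks s aW2 = W2 \<and> s aH = \<sigma> aH \<and> (\<forall>e\<in>D. \<not> good e) \<or>
      s aFound 0 0 = 1 \<and> (\<exists>e\<in>E2. good e \<and> applied e s))" for D s
  have "Q E2 \<sigma>'"
    unfolding \<sigma>'_def
  proof (rule sem_For2_set)
    show "Q {} \<sigma>" using env F by (simp add: Q_def W1_def W2_def)
  next
    fix D i j s assume ij: "i < n" "j < n" "(i, j) \<notin> D" and Q: "Q D s"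
    let ?\<rho> = "\<rho>(5 := i, 6 := j)"
    define s' where "s' = sem search_com n ?\<rho> s"
    have wt: "s aCol 0 j = wt (i, j)" and env_s: "env s" using Q ij by (simp_all add: Q_def env_def wt_def)
    show "Q (insert (i, j) D) (sem search_com n ?\<rho> s)"
    proof (cases "s aFound 0 0 = 0")
      case False
      then have "sem search_com n ?\<rho> s = s" using Q \<rho> by (simp add: search_com_def Q_def)
      then show ?thesis using False Q by (simp add: Q_def)
    next
      case True
      then have q: "blocks s aW1 = W1" "blocks s aW2 = W2" "s aH = \<sigma> aH" "\<forall>e\<in>D. \<not> good e"
        "s aPhi = \<sigma> aPhi" "s aT = \<sigma> aT"
        using Q by (auto simp: Q_def)
      show ?thesis
      proof (cases "0 < wt (i, j)")
        case False
        then have "sem search_com n ?\<rho> s = s" using True \<rho> wt by (simp add: search_com_def)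
        then show ?thesis using False True Q q by (auto simp: Q_def good_def)
      next
        case pos: True
        define s' where "s' = sem try_com n ?\<rho> s"
        have eq: "sem search_com n ?\<rho> s = s'" using True pos \<rho> wt by (simp add: search_com_def s'_def)
        have env': "env s'" unfolding s'_def using env_s by (rule env_frame) (simp add: writes_try)
        have fr: "s' aPhi = s aPhi" "s' aT = s aT"
          unfolding s'_def by (intro sem_frame; simp add: writes_try)+
        note st = sem_try[OF env_s, of ?\<rho> i j, folded s'_def, unfolded q]
        show ?thesis
        proof (cases "\<sigma> aPhi 0 0 < new_potential W1 W2 (i, j)")
          case True': True
          have "s' aFound = s aFound \<and> s' aH = \<sigma> aH \<and> blocks s' aW1 = W1 \<and> blocks s' aW2 = W2"
            using st(1) \<rho> ij T True' by simp
          then show ?thesis using True q env' fr True' unfolding eq by (auto simp: Q_def good_def)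
        next
          case False
          then have "good (i, j)" using pos by (simp add: good_def)
          moreover have "s' aFound 0 0 = 1 \<and> applied (i, j) s'"
            using st(2) \<rho> ij T False unfolding applied_def by simp
          ultimately show ?thesis using env' fr q ij unfolding eq Q_def by auto
        qed
      qed
    qed
  qed
  moreover have "\<exists>e\<in>E2. good e" using ex by (simp add: good_def)
  ultimately obtain e where "e \<in> E2" "good e" "applied e \<sigma>'" unfolding Q_def by blast
  moreover have "new_potential W1 W2 e \<le> \<sigma> aPhi 0 0" using \<open>good e\<close> by (simp add: good_def)
  ultimately show ?thesis unfolding applied_def by blast
qed

text \<open>Both shifted barriers are known to be positive definite beforehand, so neither
  \<open>shift_com\<close> can fail; the averaging argument then makes the search succeed, and
  \<open>good_step\<close> restores the invariant.\<close>

lemma sem_step: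
  assumes inv: "step_inv r t \<sigma>" and \<rho>: "\<rho> 0 = 0" and r: "1 \<le> r"
  shows "step_inv r (t + 1) (sem step_com n \<rho> \<sigma>)"
proof -
  define u where "u = 4 * real n * (r + 2)"
  define H where "H e = \<sigma> aH (fst e) (snd e)" for e
  define c1 where "c1 e = real t * (1 + 1 / r) * wt e - H e" for e
  define c2 where "c2 e = H e - real t * (1 - 1 / r) * wt e" for e
  have \<sigma>: "env \<sigma>" "\<sigma> aR 0 0 = r" "\<sigma> aPhi 0 0 = 1 / (r + 2)" "\<sigma> aCnt 0 0 = real t"
    and card: "card {e \<in> E2. H e \<noteq> 0} \<le> t"
    and pos: "posdef u c1" "posdef u c2"
    and iv: "inverse_of u c1 (blocks \<sigma> aW1)" "inverse_of u c2 (blocks \<sigma> aW2)"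
    and pot: "potential (blocks \<sigma> aW1) + potential (blocks \<sigma> aW2) \<le> 1 / (r + 2)"
    using inv by (simp_all add: step_inv_def u_def c1_def[abs_def] c2_def[abs_def] H_def)
  define c1' where "c1' = (\<lambda>e. c1 e + (1 + 1 / r) * wt e)"
  define c2' where "c2' = (\<lambda>e. c2 e + (- (1 - 1 / r)) * wt e)"
  have pos': "posdef u c1'" "posdef u c2'"
  proof -
    show "posdef u c1'" unfolding c1'_def using r g_nonneg by (intro posdef_mono[OF pos(1)]) auto
    have "potential (blocks \<sigma> aW2) \<le> 1 / (r + 2)"
      using pot potential_nonneg[OF pos(1) iv(1)] by simp
    also have "\<dots> < 1" using r by simp
    finally show "posdef u c2'"
      unfolding c2'_def using r by (intro posdef_lower_shift[OF pos(2) iv(2)]) auto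
  qed
  define \<sigma>1 where "\<sigma>1 = upd aX 0 0 (1 + 1 / r) (upd aBad 0 0 0 \<sigma>)"
  define \<sigma>2 where "\<sigma>2 = sem (shift_com aW1) n \<rho> \<sigma>1"
  define \<sigma>3 where "\<sigma>3 = upd aX 0 0 (- (1 - 1 / r)) \<sigma>2"
  define \<sigma>4 where "\<sigma>4 = sem (shift_com aW2) n \<rho> \<sigma>3"
  define \<sigma>5 where "\<sigma>5 = sem potential_com n \<rho> \<sigma>4"
  define \<sigma>6 where "\<sigma>6 = upd aFound 0 0 0 \<sigma>5"
  define \<sigma>7 where "\<sigma>7 = sem (For 5 (For 6 search_com)) n \<rho> \<sigma>6"
  have fr2: "\<sigma>2 k = \<sigma>1 k" if "k \<notin> {aBad, aKap, aY0, aY1, 24, 25, 26, 27}" for k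
    unfolding \<sigma>2_def using that by (intro sem_frame) (simp add: writes_shift)
  have fr4: "\<sigma>4 k = \<sigma>3 k" if "k \<notin> {aBad, aKap, aY0, aY1, 28, 29, 30, 31}" for k
    unfolding \<sigma>4_def using that by (intro sem_frame) (simp add: writes_shift)
  have env1: "env \<sigma>1" using \<sigma>(1) by (simp add: \<sigma>1_def env_upd)
  have env2: "env \<sigma>2" unfolding \<sigma>2_def using env1 by (rule env_frame) (simp add: writes_shift)
  have env3: "env \<sigma>3" using env2 by (simp add: \<sigma>3_def env_upd)
  have env4: "env \<sigma>4" unfolding \<sigma>4_def using env3 by (rule env_frame) (simp add: writes_shift)
  have b1: "blocks \<sigma>1 aW1 = blocks \<sigma> aW1"
    by (simp add: \<sigma>1_def blocks_def fun_eq_iff upd_apply)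
  have x1: "\<sigma>1 aX 0 0 = 1 + 1 / r" "\<sigma>1 aBad 0 0 = 0" by (simp_all add: \<sigma>1_def upd_apply)
  note sh1 = sem_shift[of \<sigma>1 \<rho> aW1 u c1, unfolded x1 b1, folded \<sigma>2_def c1'_def, OF env1 \<rho> _ _ pos(1) iv(1)]
  have 2: "\<sigma>2 aBad 0 0 = 0" "inverse_of u c1' (blocks \<sigma>2 aW1)"
    using sh1(3,4) pos'(1) by simp_all
  have b3: "blocks \<sigma>3 aW2 = blocks \<sigma> aW2"
    by (simp add: \<sigma>3_def \<sigma>1_def blocks_def fun_eq_iff upd_apply fr2)
  have x3: "\<sigma>3 aX 0 0 = - (1 - 1 / r)" "\<sigma>3 aBad 0 0 = 0" using 2(1) by (simp_all add: \<sigma>3_def upd_apply)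
  note sh2 = sem_shift[of \<sigma>3 \<rho> aW2 u c2, unfolded x3 b3, folded \<sigma>4_def c2'_def, OF env3 \<rho> _ _ pos(2) iv(2)]
  have 4: "inverse_of u c2' (blocks \<sigma>4 aW2)"
    using sh2(4) pos'(2) by simp
  have b4: "blocks \<sigma>4 aW1 = blocks \<sigma>2 aW1"
    by (simp add: \<sigma>3_def blocks_def fun_eq_iff upd_apply fr4)
  have p5: "\<sigma>5 aT 0 0 = potential (blocks \<sigma>4 aW1) + potential (blocks \<sigma>4 aW2)" "\<And>k. k \<noteq> aT \<Longrightarrow> \<sigma>5 k = \<sigma>4 k"
    using sem_potential[of \<sigma>4 \<rho>] env4 \<rho> by (simp_all add: \<sigma>5_def)
  have env6: "env \<sigma>6" using env4 by (simp add: \<sigma>6_def env_def upd_apply p5)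
  define W1 where "W1 = blocks \<sigma>6 aW1"
  define W2 where "W2 = blocks \<sigma>6 aW2"
  have W: "W1 = blocks \<sigma>4 aW1" "W2 = blocks \<sigma>4 aW2"
    by (simp_all add: W1_def W2_def \<sigma>6_def blocks_def fun_eq_iff upd_apply p5)
  have fr6: "\<sigma>6 k = \<sigma> k" if "k \<in> {aR, aPhi, aCnt, aH}" for k
    using that by (auto simp: \<sigma>6_def upd_other p5 fr4 \<sigma>3_def fr2 \<sigma>1_def)
  have inv': "inverse_of u c1' W1" "inverse_of u c2' W2"
    using 2(2) 4 by (simp_all add: W b4)
  note gs = exists_good_step[OF r pos iv pot inv'[unfolded c1'_def c2'_def] exists_positive_weight vec_of_nonzero]
  have T6: "\<sigma>6 aT 0 0 = potential W1 + potential W2" "\<sigma>6 aFound 0 0 = 0"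
    by (simp_all add: W p5 \<sigma>6_def upd_apply)
  have p6: "\<sigma>6 aPhi 0 0 = 1 / (r + 2)" "\<sigma>6 aH = \<sigma> aH"
    using \<sigma>(3) by (simp_all add: fr6)
  note ss = sem_search[of \<sigma>6 \<rho>, folded \<sigma>7_def W1_def W2_def, unfolded p6, OF env6 \<rho> T6 gs]
  then obtain e where e: "e \<in> E2" "new_potential W1 W2 e \<le> 1 / (r + 2)" and
    upd_W: "\<forall>p\<in>I2. \<forall>q\<in>I2. blocks \<sigma>7 aW1 p q = rank_one W1 (- step_size W1 W2 e) e p q \<and>
      blocks \<sigma>7 aW2 p q = rank_one W2 (step_size W1 W2 e) e p q" and
    upd_H: "\<forall>x y. \<sigma>7 aH x y = (if (x, y) = e then \<sigma> aH x y + step_size W1 W2 e else \<sigma> aH x y)"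
    by blast
  define h where "h = step_size W1 W2 e"
  note st = good_step[OF r pos iv pot inv'[unfolded c1'_def c2'_def] exists_positive_weight vec_of_nonzero e(1,2),
      folded c1'_def c2'_def h_def]
  define \<sigma>8 where "\<sigma>8 = upd aCnt 0 0 (real t + 1) \<sigma>7"
  have fr7: "\<sigma>7 k = \<sigma>6 k" if "k \<in> {aR, aPhi, aCnt, aB, aCol, aFro, aN}" for k
    unfolding \<sigma>7_def using that by (intro sem_frame) (auto simp: search_com_def writes_try)
  have eq: "sem step_com n \<rho> \<sigma> = \<sigma>8"
  proof -
    have "sem (put aBad (Const 0) ;; put aX (Const 1 +. Const 1 /. scal aR)) n \<rho> \<sigma> = \<sigma>1"
      using \<rho> \<sigma>(2) by (simp add: \<sigma>1_def upd_apply)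
    moreover have "sem (put aX (Const 1 /. scal aR -. Const 1)) n \<rho> \<sigma>2 = \<sigma>3"
      using \<rho> \<sigma>(2) by (simp add: \<sigma>3_def fr2 \<sigma>1_def upd_apply)
    moreover have "sem (put aFound (Const 0)) n \<rho> \<sigma>5 = \<sigma>6"
      using \<rho> by (simp add: \<sigma>6_def)
    moreover have "sem (put aCnt (scal aCnt +. Const 1)) n \<rho> \<sigma>7 = \<sigma>8"
      using \<rho> \<sigma>(4) by (simp add: \<sigma>8_def fr7 fr6)
    ultimately show ?thesis
      unfolding step_com_def search_com_def[symmetric] sem.simps(3) \<sigma>2_def[symmetric] \<sigma>4_def[symmetric]
        \<sigma>5_def[symmetric] \<sigma>7_def[symmetric]
      by (simp only: sem.simps(3) \<sigma>2_def[symmetric] \<sigma>4_def[symmetric] \<sigma>5_def[symmetric] \<sigma>7_def[symmetric])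
  qed
  define H' where "H' e = \<sigma>8 aH (fst e) (snd e)" for e
  have H': "H' e' = (if e' = e then H e' + h else H e')" for e'
    using upd_H[rule_format, of "fst e'" "snd e'"] by (simp add: H'_def \<sigma>8_def upd_apply H_def h_def)
  have c1'': "c1'(e := c1 e + (1 + 1 / r) * wt e + - h) = (\<lambda>e. (real t + 1) * (1 + 1 / r) * wt e - H' e)"
    by (auto simp: fun_eq_iff H' c1'_def c1_def algebra_simps)
  have c2'': "c2'(e := c2 e + - (1 - 1 / r) * wt e + h) = (\<lambda>e. H' e - (real t + 1) * (1 - 1 / r) * wt e)"
    by (auto simp: fun_eq_iff H' c2'_def c2_def algebra_simps)
  have b8: "blocks \<sigma>8 aW1 p q = rank_one W1 (- h) e p q" "blocks \<sigma>8 aW2 p q = rank_one W2 h e p q"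
    if "p \<in> I2" "q \<in> I2" for p q
    using upd_W[rule_format, OF that] by (simp_all add: \<sigma>8_def blocks_def upd_apply h_def)
  have "{e' \<in> E2. H' e' \<noteq> 0} \<subseteq> insert e {e' \<in> E2. H e' \<noteq> 0}" by (auto simp: H')
  then have "card {e' \<in> E2. H' e' \<noteq> 0} \<le> card (insert e {e' \<in> E2. H e' \<noteq> 0})"
    by (intro card_mono) auto
  also have "\<dots> \<le> Suc (card {e' \<in> E2. H e' \<noteq> 0})" by (rule card_insert_le_m1) auto
  finally have card': "card {e' \<in> E2. H' e' \<noteq> 0} \<le> t + 1" using card by simp
  have "env \<sigma>7" using env6 by (simp add: env_def fr7)
  then have env8: "env \<sigma>8" by (simp add: \<sigma>8_def env_upd)
  have 8: "\<sigma>8 aR 0 0 = r" "\<sigma>8 aPhi 0 0 = 1 / (r + 2)" "\<sigma>8 aCnt 0 0 = real t + 1"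
    using \<sigma> by (simp_all add: \<sigma>8_def upd_apply fr7 fr6)
  have "inverse_of u (\<lambda>e. (real t + 1) * (1 + 1 / r) * wt e - H' e) (blocks \<sigma>8 aW1)"
    using st(3) b8(1) unfolding c1'' by (rule inverse_of_cong)
  moreover have "inverse_of u (\<lambda>e. H' e - (real t + 1) * (1 - 1 / r) * wt e) (blocks \<sigma>8 aW2)"
    using st(4) b8(2) unfolding c2'' by (rule inverse_of_cong)
  moreover have "potential (blocks \<sigma>8 aW1) = potential (rank_one W1 (- h) e)"
    "potential (blocks \<sigma>8 aW2) = potential (rank_one W2 h e)"
    using b8 by (intro potential_cong; simp)+
  ultimately show ?thesis
    using st(1,2,5) env8 8 card' unfolding eq step_inv_def c1'' c2''
    by (simp add: u_def H'_def add.commute)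
qed

lemma n_pos: "0 < n"
  using fro_pos by (cases n) (auto simp: fro_sq_def)

text \<open>\<open>t\<close> counts slots and \<open>k\<close> is the limit, so
  \<open>min t k\<close> is the number of steps really performed.\<close>

lemma guarded_step_inv:
  assumes "step_inv r (min t k) \<sigma> \<and> \<sigma> aLim 0 0 = real k" "\<rho> 0 = 0" "1 \<le> r"
  shows "step_inv r (min (t + 1) k) (sem guarded_step n \<rho> \<sigma>) \<and> sem guarded_step n \<rho> \<sigma> aLim 0 0 = real k"
proof (cases "t < k")
  case True
  have cnt: "\<sigma> aCnt 0 0 = real t" using assms(1) True by (simp add: step_inv_def)
  have "aLim \<notin> writes step_com"
    by (simp add: step_com_def writes_shift writes_potential writes_try)
  then have "sem step_com n \<rho> \<sigma> aLim = \<sigma> aLim" by (rule sem_frame)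
  then show ?thesis
    using sem_step[of r t \<sigma> \<rho>] assms True cnt by (simp add: guarded_step_def min_def)
next
  case False
  then have "\<sigma> aCnt 0 0 = real k" using assms(1) by (simp add: step_inv_def min_def)
  moreover have "min t k = k" "min (t + 1) k = k" using False by auto
  ultimately show ?thesis using assms False by (simp add: guarded_step_def)
qed

lemma sem_main:
  assumes env: "env \<sigma>" and \<rho>: "\<rho> 0 = 0" and r: "\<sigma> aR 0 0 = real R" "1 \<le> R" "R \<le> n"
  defines "\<sigma>' \<equiv> sem main_com n \<rho> \<sigma>" and "k \<equiv> real (2 * n * R\<^sup>2)" and "u \<equiv> 4 * real n * (real R + 2)"
  shows "\<exists>H. card {e \<in> E2. H e \<noteq> 0} \<le> 2 * n * R\<^sup>2 \<and>
    posdef u (\<lambda>e. k * (1 + 1 / real R) * wt e - H e) \<and>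
    posdef u (\<lambda>e. H e - k * (1 - 1 / real R) * wt e) \<and>
    (\<forall>i<n. \<forall>j<n. \<sigma>' aA i j = H (i, j) * ratio i j / k)"
proof -
  define r where "r = real R"
  have r1: "1 \<le> r" using assms(4) by (simp add: r_def)
  define K where "K = 2 * n * R\<^sup>2"
  have u: "0 < u" using n_pos by (simp add: u_def)
  define \<sigma>1 where "\<sigma>1 = upd aU 0 0 u \<sigma>"
  define \<sigma>2 where "\<sigma>2 = sem (init_com aW1) n \<rho> \<sigma>1"
  define \<sigma>3 where "\<sigma>3 = sem (init_com aW2) n \<rho> \<sigma>2"
  define \<sigma>4 where "\<sigma>4 = sem (For 9 (For 10 (Assign aH 9 10 (Const 0)))) n \<rho> \<sigma>3"
  define \<sigma>5 where "\<sigma>5 = upd aLim 0 0 k (upd aCnt 0 0 0 (upd aPhi 0 0 (1 / (r + 2)) \<sigma>4))"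
  define \<sigma>6 where "\<sigma>6 = sem (For 2 (For 3 (For 4 (guarded_step ;; guarded_step)))) n \<rho> \<sigma>5"
  have fr2: "\<sigma>2 k = \<sigma>1 k" if "k \<notin> {24, 25, 26, 27}" for k
    unfolding \<sigma>2_def using that by (intro sem_frame) (simp add: writes_init)
  have fr3: "\<sigma>3 k = \<sigma>2 k" if "k \<notin> {28, 29, 30, 31}" for k
    unfolding \<sigma>3_def using that by (intro sem_frame) (simp add: writes_init)
  have fr4: "\<sigma>4 k = \<sigma>3 k" if "k \<noteq> aH" for k
    unfolding \<sigma>4_def using that by (intro sem_frame) simp
  have env1: "env \<sigma>1" using env by (simp add: \<sigma>1_def env_upd)
  have env2: "env \<sigma>2" using env1 by (simp add: env_def fr2)
  have env5: "env \<sigma>5" using env2 by (simp add: env_def fr3 fr4 \<sigma>5_def upd_apply upd_other)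
  have "blocks \<sigma>2 aW1 p q = (if p = q then 1 / (u * Gd p) else 0)" if "p \<in> I2" "q \<in> I2" for p q
    unfolding \<sigma>2_def using sem_init[of \<sigma>1 \<rho> aW1] env1 \<rho> that by (simp add: \<sigma>1_def upd_apply)
  moreover have "blocks \<sigma>5 aW1 = blocks \<sigma>2 aW1"
    by (simp add: blocks_def fun_eq_iff \<sigma>5_def upd_apply fr3 fr4)
  ultimately have W1: "blocks \<sigma>5 aW1 p q = (if p = q then 1 / (u * Gd p) else 0)" if "p \<in> I2" "q \<in> I2" for p q
    using that by simp
  have "blocks \<sigma>3 aW2 p q = (if p = q then 1 / (u * Gd p) else 0)" if "p \<in> I2" "q \<in> I2" for p q
    unfolding \<sigma>3_def using sem_init[of \<sigma>2 \<rho> aW2] env2 \<rho> that by (simp add: fr2 \<sigma>1_def upd_apply)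
  moreover have "blocks \<sigma>5 aW2 = blocks \<sigma>3 aW2"
    by (simp add: blocks_def fun_eq_iff \<sigma>5_def upd_apply fr4)
  ultimately have W2: "blocks \<sigma>5 aW2 p q = (if p = q then 1 / (u * Gd p) else 0)" if "p \<in> I2" "q \<in> I2" for p q
    using that by simp
  have Z1: "inverse_of u (\<lambda>_. 0) (blocks \<sigma>5 aW1)" by (rule inverse_of_zero[OF u]) (rule W1)
  have Z2: "inverse_of u (\<lambda>_. 0) (blocks \<sigma>5 aW2)" by (rule inverse_of_zero[OF u]) (rule W2)
  have "\<forall>(x, y)\<in>E2. \<sigma>4 aH x y = 0"
    unfolding \<sigma>4_def by (rule sem_For2_set) (auto simp: upd_apply)
  then have H0: "\<sigma>5 aH (fst e) (snd e) = 0" if "e \<in> E2" for e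
    using that by (auto simp: \<sigma>5_def upd_apply)
  have "step_inv r 0 \<sigma>5"
    unfolding step_inv_def
  proof (intro conjI)
    show "\<sigma>5 aR 0 0 = r" using assms(3) by (simp add: \<sigma>5_def upd_apply fr4 fr3 fr2 \<sigma>1_def r_def)
    show "posdef (4 * real n * (r + 2)) (\<lambda>e. real 0 * (1 + 1 / r) * wt e - \<sigma>5 aH (fst e) (snd e))"
      using posdef_zero[OF u] unfolding u_def r_def by (rule posdef_cong) (drule H0, simp)
    show "posdef (4 * real n * (r + 2)) (\<lambda>e. \<sigma>5 aH (fst e) (snd e) - real 0 * (1 - 1 / r) * wt e)"
      using posdef_zero[OF u] unfolding u_def r_def by (rule posdef_cong) (drule H0, simp)
    show "inverse_of (4 * real n * (r + 2)) (\<lambda>e. real 0 * (1 + 1 / r) * wt e - \<sigma>5 aH (fst e) (snd e)) (blocks \<sigma>5 aW1)"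
      using Z1 unfolding u_def r_def by (rule inverse_of_coeff_cong) (drule H0, simp)
    show "inverse_of (4 * real n * (r + 2)) (\<lambda>e. \<sigma>5 aH (fst e) (snd e) - real 0 * (1 - 1 / r) * wt e) (blocks \<sigma>5 aW2)"
      using Z2 unfolding u_def r_def by (rule inverse_of_coeff_cong) (drule H0, simp)
    have "potential (blocks \<sigma>5 aW1) + potential (blocks \<sigma>5 aW2) \<le> 2 * real n / u + 2 * real n / u"
    proof (rule add_mono)
      show "potential (blocks \<sigma>5 aW1) \<le> 2 * real n / u" using initial_potential[OF u, of "blocks \<sigma>5 aW1"] W1 by simp
      show "potential (blocks \<sigma>5 aW2) \<le> 2 * real n / u" using initial_potential[OF u, of "blocks \<sigma>5 aW2"] W2 by simp
    qed
    also have "\<dots> = (4 * real n * 1) / (4 * real n * (r + 2))"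
    proof -
      have "2 * real n + 2 * real n = 4 * real n * 1" by simp
      then show ?thesis unfolding add_divide_distrib[symmetric] u_def r_def by (rule arg_cong)
    qed
    also have "\<dots> = 1 / (r + 2)" using n_pos by (intro nonzero_mult_divide_mult_cancel_left) simp
    finally show "potential (blocks \<sigma>5 aW1) + potential (blocks \<sigma>5 aW2) \<le> 1 / (r + 2)" .
    have "{e \<in> E2. \<sigma>5 aH (fst e) (snd e) \<noteq> 0} = {}" using H0 by blast
    then show "card {e \<in> E2. \<sigma>5 aH (fst e) (snd e) \<noteq> 0} \<le> 0" by (simp only: card.empty)
  qed (use env5 in \<open>simp_all add: \<sigma>5_def upd_apply\<close>)
  then have start: "step_inv r (min 0 K) \<sigma>5 \<and> \<sigma>5 aLim 0 0 = real K"
    by (simp add: \<sigma>5_def upd_apply k_def K_def)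
  define Q where "Q t s \<longleftrightarrow> step_inv r (min t K) s \<and> s aLim 0 0 = real K" for t and s :: store
  have Q1: "Q (t + 1) (sem guarded_step n \<rho>' s)" if "Q t s" "\<rho>' 0 = 0" for t s \<rho>'
    using guarded_step_inv[of r t K s \<rho>'] that r1 by (simp add: Q_def)
  have Q2: "Q (t + 2) (sem (guarded_step ;; guarded_step) n \<rho>' s)" if "Q t s" "\<rho>' 0 = 0" for t s \<rho>'
  proof -
    have "Q (t + 1) (sem guarded_step n \<rho>' s)" by (rule Q1) (use that in auto)
    then have "Q (t + 1 + 1) (sem guarded_step n \<rho>' (sem guarded_step n \<rho>' s))"
      by (rule Q1) (use that in auto)
    then show ?thesis by simp
  qed
  have Q3: "Q (t + n * 2) (sem (For 4 (guarded_step ;; guarded_step)) n \<rho>' s)" if "Q t s" "\<rho>' 0 = 0" for t s \<rho>'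
  proof (rule sem_For_count[where P = Q])
    fix t' m s' assume "Q t' s'"
    then show "Q (t' + 2) (sem (guarded_step ;; guarded_step) n (\<rho>'(4 := m)) s')"
      by (rule Q2) (use that in simp)
  qed (rule that(1))
  have Q4: "Q (t + n * (n * 2)) (sem (For 3 (For 4 (guarded_step ;; guarded_step))) n \<rho>' s)" if "Q t s" "\<rho>' 0 = 0" for t s \<rho>'
  proof (rule sem_For_count[where P = Q])
    fix t' m s' assume "Q t' s'"
    then show "Q (t' + n * 2) (sem (For 4 (guarded_step ;; guarded_step)) n (\<rho>'(3 := m)) s')"
      by (rule Q3) (use that in simp)
  qed (rule that(1))
  have "Q (0 + n * (n * (n * 2))) \<sigma>6"
    unfolding \<sigma>6_def
  proof (rule sem_For_count[where P = Q])
    fix t' m s' assume "Q t' s'"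
    then show "Q (t' + n * (n * 2)) (sem (For 3 (For 4 (guarded_step ;; guarded_step))) n (\<rho>(2 := m)) s')"
      by (rule Q4) (use \<rho> in simp)
  qed (use start in \<open>simp add: Q_def\<close>)
  \<comment> \<open>R \<le> n guarantees that the 2 n^3 slots of the triple loop suffice for 2 n R^2
    steps.\<close>
  moreover have "K \<le> n * (n * (n * 2))"
  proof -
    have "R\<^sup>2 \<le> n\<^sup>2" using assms(5) by (rule power_mono) simp
    then have "2 * n * R\<^sup>2 \<le> 2 * n * n\<^sup>2" by (rule mult_left_mono) simp
    then show ?thesis by (simp add: K_def power2_eq_square mult_ac)
  qed
  ultimately have inv6: "step_inv r K \<sigma>6" "\<sigma>6 aLim 0 0 = real K" by (simp_all add: Q_def min.absorb2)
  define H where "H e = \<sigma>6 aH (fst e) (snd e)" for e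
  define c7 where "c7 = Assign aA 9 10 (Arr aB 9 10 *. Arr aH 9 10 /. scal aLim)"
  have "(\<forall>(x, y)\<in>E2. sem (For 9 (For 10 c7)) n \<rho> \<sigma>6 aA x y = H (x, y) * ratio x y / k) \<and>
     (\<forall>k. k \<noteq> aA \<longrightarrow> sem (For 9 (For 10 c7)) n \<rho> \<sigma>6 k = \<sigma>6 k)"
  proof (rule sem_For2_set[where P = "\<lambda>D s. (\<forall>(x, y)\<in>D. s aA x y = H (x, y) * ratio x y / k) \<and> (\<forall>k. k \<noteq> aA \<longrightarrow> s k = \<sigma>6 k)"])
    fix D x y s assume xy: "x < n" "y < n" and "(\<forall>(x, y)\<in>D. s aA x y = H (x, y) * ratio x y / k) \<and> (\<forall>k. k \<noteq> aA \<longrightarrow> s k = \<sigma>6 k)"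
    moreover from this have "s k = \<sigma>6 k" if "k \<noteq> aA" for k using that by simp
    then have "sem c7 n (\<rho>(9 := x, 10 := y)) s = upd aA x y (H (x, y) * ratio x y / k) s"
      using inv6 xy \<rho> by (simp add: c7_def step_inv_def env_def H_def K_def k_def mult.commute)
    ultimately show "(\<forall>(x', y')\<in>insert (x, y) D. sem c7 n (\<rho>(9 := x, 10 := y)) s aA x' y' = H (x', y') * ratio x' y' / k) \<and>
      (\<forall>k. k \<noteq> aA \<longrightarrow> sem c7 n (\<rho>(9 := x, 10 := y)) s k = \<sigma>6 k)"
      by (auto simp: upd_apply upd_other)
  qed simp
  moreover have "\<sigma>' = sem (For 9 (For 10 c7)) n \<rho> \<sigma>6"
  proof -
    have e4: "\<sigma>4 aN 0 0 = real n" "\<sigma>4 aR 0 0 = r" using env2 assms(3)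
      by (simp_all add: fr4 fr3 env_def) (simp add: fr2 \<sigma>1_def upd_apply r_def)
    have "sem (put aU (Const 4 *. scal aN *. (scal aR +. Const 2))) n \<rho> \<sigma> = \<sigma>1"
      using \<rho> env assms(3) by (simp add: \<sigma>1_def u_def env_def)
    moreover have "sem (put aPhi (Const 1 /. (scal aR +. Const 2)) ;; put aCnt (Const 0) ;;
        put aLim (Const 2 *. scal aN *. scal aR *. scal aR)) n \<rho> \<sigma>4 = \<sigma>5"
      using \<rho> e4 by (simp add: \<sigma>5_def k_def r_def upd_apply power2_eq_square mult.assoc)
    ultimately show ?thesis
      unfolding \<sigma>'_def main_com_def c7_def
      by (simp only: sem.simps(3) \<sigma>2_def[symmetric] \<sigma>3_def[symmetric] \<sigma>4_def[symmetric] \<sigma>6_def[symmetric])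
  qed
  ultimately have A': "\<sigma>' aA i j = H (i, j) * ratio i j / k" if "i < n" "j < n" for i j
    using that by auto
  show ?thesis
    by (rule exI[of _ H]) (use inv6 A' in \<open>simp_all add: step_inv_def H_def[abs_def] K_def k_def u_def r_def\<close>)
qed

section \<open>Choosing the round\<close>

definition passes :: "real \<Rightarrow> bool" where
  "passes s \<longleftrightarrow> posdef (s + 4) (\<lambda>e. (- s) * wt e)"

lemma sem_test:
  assumes env: "env \<sigma>" and \<rho>: "\<rho> 0 = 0" and s: "0 \<le> \<sigma> aR 0 0 * \<sigma> aEps 0 0"
  defines "\<sigma>' \<equiv> sem test_com n \<rho> \<sigma>"
  shows "\<sigma>' aBad 0 0 = (if passes (\<sigma> aR 0 0 * \<sigma> aEps 0 0) then 0 else 1)" "env \<sigma>'"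
    "\<And>k. k \<in> {aR, aEps, aA, aDone} \<Longrightarrow> \<sigma>' k = \<sigma> k"
proof -
  define s where "s = \<sigma> aR 0 0 * \<sigma> aEps 0 0"
  have pos: "0 < s + 4" using s by (simp add: s_def)
  define \<sigma>1 where "\<sigma>1 = upd aU 0 0 (s + 4) \<sigma>"
  define \<sigma>2 where "\<sigma>2 = sem (init_com aW1) n \<rho> \<sigma>1"
  define \<sigma>3 where "\<sigma>3 = upd aX 0 0 (- s) (upd aBad 0 0 0 \<sigma>2)"
  have fr2: "\<sigma>2 k = \<sigma>1 k" if "k \<notin> {24, 25, 26, 27}" for k
    unfolding \<sigma>2_def using that by (intro sem_frame) (simp add: writes_init)
  have env1: "env \<sigma>1" using env by (simp add: \<sigma>1_def env_upd)
  have env3: "env \<sigma>3" using env1 by (simp add: env_def fr2 \<sigma>3_def upd_apply upd_other)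
  have "blocks \<sigma>2 aW1 p q = (if p = q then 1 / ((s + 4) * Gd p) else 0)" if "p \<in> I2" "q \<in> I2" for p q
    unfolding \<sigma>2_def using sem_init[of \<sigma>1 \<rho> aW1] env1 \<rho> that by (simp add: \<sigma>1_def upd_apply)
  moreover have "blocks \<sigma>3 aW1 = blocks \<sigma>2 aW1"
    by (simp add: blocks_def fun_eq_iff \<sigma>3_def upd_apply)
  ultimately have W: "inverse_of (s + 4) (\<lambda>_. 0) (blocks \<sigma>3 aW1)"
    by (intro inverse_of_zero[OF pos]) simp
  have x: "\<sigma>3 aX 0 0 = - s" "\<sigma>3 aBad 0 0 = 0" by (simp_all add: \<sigma>3_def upd_apply)
  have eq: "\<sigma>' = sem (shift_com aW1) n \<rho> \<sigma>3"
  proof -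
    have "sem (put aU (scal aR *. scal aEps +. Const 4)) n \<rho> \<sigma> = \<sigma>1"
      using \<rho> by (simp add: \<sigma>1_def s_def)
    moreover have "sem (put aBad (Const 0) ;; put aX (Const 0 -. scal aR *. scal aEps)) n \<rho> \<sigma>2 = \<sigma>3"
      using \<rho> by (simp add: \<sigma>3_def fr2 \<sigma>1_def upd_apply s_def)
    ultimately show ?thesis
      unfolding \<sigma>'_def test_com_def by (simp only: sem.simps(3) \<sigma>2_def[symmetric])
  qed
  note sh = sem_shift[of \<sigma>3 \<rho> aW1 "s + 4" "\<lambda>_. 0", unfolded x, folded eq, OF env3 \<rho> _ _ posdef_zero[OF pos] W]
  show "\<sigma>' aBad 0 0 = (if passes (\<sigma> aR 0 0 * \<sigma> aEps 0 0) then 0 else 1)"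
    using sh(1-3) unfolding passes_def s_def[symmetric] by auto
  show "env \<sigma>'" unfolding eq using env3 by (rule env_frame) (simp add: writes_shift)
  show "\<sigma>' k = \<sigma> k" if "k \<in> {aR, aEps, aA, aDone}" for k
  proof -
    have "\<sigma>' k = \<sigma>3 k" unfolding eq using that by (intro sem_frame) (auto simp: writes_shift)
    then show ?thesis using that by (auto simp: \<sigma>3_def fr2 \<sigma>1_def upd_other)
  qed
qed

lemma passes_zero: "passes 0"
  unfolding passes_def by (rule posdef_cong[OF posdef_zero]) auto

text \<open>\<open>R\<close> is the round in which the barrier method ran. The failed test at R and
  the passed one at R - 1 confine R from both sides, before the operator norm is mentioned.\<close>

definition sparsified :: "real \<Rightarrow> (nat \<Rightarrow> nat \<Rightarrow> real) \<Rightarrow> bool" where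
  "sparsified \<epsilon> X \<longleftrightarrow> (\<exists>R H. 1 \<le> R \<and> R \<le> n \<and> \<not> passes (real R * \<epsilon>) \<and> passes (real (R - 1) * \<epsilon>) \<and>
     card {e \<in> E2. H e \<noteq> 0} \<le> 2 * n * R\<^sup>2 \<and>
     posdef (4 * real n * (real R + 2)) (\<lambda>e. real (2 * n * R\<^sup>2) * (1 + 1 / real R) * wt e - H e) \<and>
     posdef (4 * real n * (real R + 2)) (\<lambda>e. H e - real (2 * n * R\<^sup>2) * (1 - 1 / real R) * wt e) \<and>
     (\<forall>i<n. \<forall>j<n. X i j = H (i, j) * ratio i j / real (2 * n * R\<^sup>2)))"

definition round_inv :: "real \<Rightarrow> nat \<Rightarrow> store \<Rightarrow> bool" where
  "round_inv \<epsilon> m \<sigma> \<longleftrightarrow> env \<sigma> \<and> \<sigma> aEps 0 0 = \<epsilon> \<and> \<sigma> aR 0 0 = real m \<and> m \<le> n \<and>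
     (\<sigma> aDone 0 0 = 0 \<and> (\<forall>i<n. \<forall>j<n. \<sigma> aA i j = A i j) \<and> (\<forall>r<m. passes (real r * \<epsilon>)) \<or>
      \<sigma> aDone 0 0 = 1 \<and> sparsified \<epsilon> (\<sigma> aA))"

lemma writes_main: "writes main_com \<inter> {aB, aCol, aFro, aN, aEps, aR, aDone} = {}"
  by (auto simp: main_com_def guarded_step_def step_com_def writes_init writes_shift writes_potential writes_try)

lemma sem_round:
  assumes inv: "round_inv \<epsilon> m \<sigma>" and m: "m < n" and \<rho>: "\<rho> 0 = 0" and \<epsilon>: "0 < \<epsilon>"
  shows "round_inv \<epsilon> (m + 1) (sem round_com n \<rho> \<sigma>)"
proof -
  define attempt where "attempt = IfLess (scal aDone) (Const 1)
       (test_com ;; IfLess (scal aBad) (Const 1) Skip (main_com ;; put aDone (Const 1))) Skip"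
  define \<sigma>' where "\<sigma>' = sem attempt n \<rho> \<sigma>"
  have \<sigma>: "env \<sigma>" "\<sigma> aEps 0 0 = \<epsilon>" "\<sigma> aR 0 0 = real m" using inv by (simp_all add: round_inv_def)
  have "env \<sigma>' \<and> \<sigma>' aEps 0 0 = \<epsilon> \<and> \<sigma>' aR 0 0 = real m \<and>
     (\<sigma>' aDone 0 0 = 0 \<and> (\<forall>i<n. \<forall>j<n. \<sigma>' aA i j = A i j) \<and> (\<forall>r<m + 1. passes (real r * \<epsilon>)) \<or>
      \<sigma>' aDone 0 0 = 1 \<and> sparsified \<epsilon> (\<sigma>' aA))"
  proof (cases "\<sigma> aDone 0 0 = 0")
    case False
    then have "\<sigma> aDone 0 0 = 1" "sparsified \<epsilon> (\<sigma> aA)" using inv by (simp_all add: round_inv_def)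
    then show ?thesis using \<sigma> \<rho> by (simp add: \<sigma>'_def attempt_def)
  next
    case True
    then have A: "\<forall>i<n. \<forall>j<n. \<sigma> aA i j = A i j" "\<forall>r<m. passes (real r * \<epsilon>)"
      using inv by (simp_all add: round_inv_def)
    define \<sigma>1 where "\<sigma>1 = sem test_com n \<rho> \<sigma>"
    have bad: "\<sigma>1 aBad 0 0 = (if passes (real m * \<epsilon>) then 0 else 1)" and env1: "env \<sigma>1"
      and fr1: "\<And>k. k \<in> {aR, aEps, aA, aDone} \<Longrightarrow> \<sigma>1 k = \<sigma> k"
      using sem_test[of \<sigma> \<rho>] \<sigma> \<rho> \<epsilon> by (simp_all add: \<sigma>1_def)
    show ?thesis
    proof (cases "passes (real m * \<epsilon>)")
      case p: True
      then have "\<sigma>' = \<sigma>1" using True \<rho> bad by (simp add: \<sigma>'_def attempt_def \<sigma>1_def)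
      then show ?thesis using True p A \<sigma> env1 fr1 by (auto simp: less_Suc_eq)
    next
      case False
      define \<sigma>2 where "\<sigma>2 = sem main_com n \<rho> \<sigma>1"
      have eq: "\<sigma>' = upd aDone 0 0 1 \<sigma>2"
        using True \<rho> bad False by (simp add: \<sigma>'_def attempt_def \<sigma>1_def \<sigma>2_def)
      \<comment> \<open>The test in round 0 always passes, so the parameter is at least 1 and its
        reciprocal is a genuine one.\<close>
      have m1: "1 \<le> m" using False passes_zero by (cases m) auto
      have env2: "env \<sigma>2" unfolding \<sigma>2_def using env1 writes_main by (intro env_frame) auto
      have fr2: "\<sigma>2 k = \<sigma>1 k" if "k \<in> {aEps, aR}" for k
        unfolding \<sigma>2_def using that writes_main by (intro sem_frame) auto
      have "\<sigma>1 aR 0 0 = real m" using fr1 \<sigma> by simp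
      note main = sem_main[of \<sigma>1 \<rho> m, folded \<sigma>2_def, OF env1 \<rho> this m1 less_imp_le[OF m]]
      have "passes (real (m - 1) * \<epsilon>)" using A(2)[rule_format, of "m - 1"] m1 by simp
      then have "sparsified \<epsilon> (\<sigma>2 aA)"
        unfolding sparsified_def using False m m1 main by (intro exI[of _ m]) simp
      then show ?thesis using env2 \<sigma> fr1 fr2 by (simp add: eq env_upd upd_apply upd_other)
    qed
  qed
  moreover have "sem round_com n \<rho> \<sigma> = upd aR 0 0 (\<sigma>' aR 0 0 + 1) \<sigma>'"
    using \<rho> by (simp add: round_com_def attempt_def \<sigma>'_def)
  ultimately show ?thesis
    using m unfolding round_inv_def by (auto simp: env_upd upd_apply upd_other)
qed

lemma sem_rounds:
  assumes "env \<sigma>" "\<sigma> aEps 0 0 = \<epsilon>" "\<sigma> aR 0 0 = 0" "\<sigma> aDone 0 0 = 0" "\<forall>i<n. \<forall>j<n. \<sigma> aA i j = A i j"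
    and \<rho>: "\<rho> 0 = 0" and \<epsilon>: "0 < \<epsilon>"
  shows "round_inv \<epsilon> n (sem (For 1 round_com) n \<rho> \<sigma>)"
proof -
  define f where "f m = sem round_com n (\<rho>(1 := m))" for m
  have "round_inv \<epsilon> m (fold f [0..<m] \<sigma>)" if "m \<le> n" for m
    using that
  proof (induction m)
    case 0
    then show ?case using assms by (simp add: round_inv_def)
  next
    case (Suc m)
    then show ?case using sem_round[of \<epsilon> m _ "\<rho>(1 := m)"] \<rho> \<epsilon> by (simp add: f_def)
  qed
  then show ?thesis by (simp add: f_def[abs_def])
qed

text \<open>The operator norm enters as the least constant N in the bilinear bound:
  \<open>N_bound\<close> makes the test succeed for small s, \<open>N_least\<close> turns a passed
  test into a bound on s N.\<close>

context
  fixes N :: real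
  assumes N_bound: "\<And>x y. bil n A x y \<le> N * (sqrt (sqn n x) * sqrt (sqn n y))"
    and N_least: "\<And>C. 0 \<le> C \<Longrightarrow> (\<And>x y. bil n A x y \<le> C * (sqrt (sqn n x) * sqrt (sqn n y))) \<Longrightarrow> N \<le> C"
    and N_pos: "0 < N" and N_le: "N \<le> sqrt (fro_sq n A)"
begin

lemma passes_imp_le:
  assumes "passes s" "0 \<le> s"
  shows "s * N \<le> 4 * sqrt (fro_sq n A)"
proof (cases "s = 0")
  case True
  then show ?thesis using fro_pos by simp
next
  case False
  then have s: "0 < s" using assms(2) by simp
  have "N \<le> 4 * sqrt (fro_sq n A) / s"
  proof (rule N_least)
    fix x y
    show "bil n A x y \<le> 4 * sqrt (fro_sq n A) / s * (sqrt (sqn n x) * sqrt (sqn n y))"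
      using bil_le_of_posdef[of s x y] assms s by (simp add: passes_def field_simps)
  qed (use s fro_pos in simp)
  then show ?thesis using s by (simp add: field_simps)
qed

lemma not_passes_imp_ge:
  assumes "\<not> passes s" "0 \<le> s"
  shows "4 * sqrt (fro_sq n A) \<le> s * N"
  using posdef_test[OF assms(2) N_bound] N_pos assms(1) unfolding passes_def by force

text \<open>With \<eta> = \<epsilon> N / F the two tests say (R - 1) \<eta> \<le> 4 \<le> R \<eta>.
  As \<eta> < 1, this gives 4 \<le> R and R \<eta> \<le> 5. The latter bounds 2 n R^2 by 50 n /
  \<eta>^2; the former bounds the error by 4 F / R, which is at most \<epsilon> N.\<close>

lemma sparsified_bounds:
  assumes sp: "sparsified \<epsilon> X" and \<epsilon>: "0 < \<epsilon>" "\<epsilon> < 1"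
  shows "real (card {e \<in> E2. X (fst e) (snd e) \<noteq> 0}) \<le> 50 * real n * fro_sq n A / (\<epsilon>\<^sup>2 * N\<^sup>2)"
    and "bil n (\<lambda>i j. A i j - X i j) x y \<le> \<epsilon> * N * (sqrt (sqn n x) * sqrt (sqn n y))"
proof -
  obtain R H where R: "1 \<le> R" "R \<le> n" "\<not> passes (real R * \<epsilon>)" "passes (real (R - 1) * \<epsilon>)"
    and card: "card {e \<in> E2. H e \<noteq> 0} \<le> 2 * n * R\<^sup>2"
    and pos: "posdef (4 * real n * (real R + 2)) (\<lambda>e. real (2 * n * R\<^sup>2) * (1 + 1 / real R) * wt e - H e)"
     "posdef (4 * real n * (real R + 2)) (\<lambda>e. H e - real (2 * n * R\<^sup>2) * (1 - 1 / real R) * wt e)"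
    and X: "\<forall>i<n. \<forall>j<n. X i j = H (i, j) * ratio i j / real (2 * n * R\<^sup>2)"
    using sp unfolding sparsified_def by blast
  define F where "F = sqrt (fro_sq n A)"
  have F: "0 < F" "F\<^sup>2 = fro_sq n A" "N \<le> F" using fro_pos N_le by (simp_all add: F_def)
  define \<eta> where "\<eta> = \<epsilon> * N / F"
  have \<eta>: "0 < \<eta>" "\<eta> < 1"
  proof -
    show "0 < \<eta>" using \<epsilon> N_pos F by (simp add: \<eta>_def)
    have "\<epsilon> * N < 1 * F" using \<epsilon> N_pos F by (intro mult_less_le_imp_less) auto
    then show "\<eta> < 1" using F by (simp add: \<eta>_def)
  qed
  define r where "r = real R"
  have hi: "(r - 1) * \<eta> \<le> 4"
    using passes_imp_le[OF R(4)] \<epsilon> F R(1) by (simp add: \<eta>_def r_def F_def[symmetric] field_simps of_nat_diff)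
  have lo: "4 \<le> r * \<eta>"
    using not_passes_imp_ge[OF R(3)] \<epsilon> F by (simp add: \<eta>_def r_def F_def[symmetric] field_simps)
  have r: "4 \<le> r"
  proof -
    have "r * \<eta> \<le> r * 1" using \<eta> by (intro mult_left_mono) (auto simp: r_def)
    then show ?thesis using lo by simp
  qed
  have n: "0 < real n" using n_pos by simp
  define k where "k = 2 * real n * r\<^sup>2"
  have k: "real (2 * n * R\<^sup>2) = k" "0 < k" using n r by (simp_all add: k_def r_def)
  have "{e \<in> E2. X (fst e) (snd e) \<noteq> 0} \<subseteq> {e \<in> E2. H e \<noteq> 0}"
    using X by auto
  then have "card {e \<in> E2. X (fst e) (snd e) \<noteq> 0} \<le> card {e \<in> E2. H e \<noteq> 0}"
    by (intro card_mono) auto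
  then have "card {e \<in> E2. X (fst e) (snd e) \<noteq> 0} \<le> 2 * n * R\<^sup>2" using card by linarith
  then have "real (card {e \<in> E2. X (fst e) (snd e) \<noteq> 0}) \<le> k"
    unfolding k(1)[symmetric] by (rule of_nat_mono)
  also have "k \<le> 2 * real n * (5 / \<eta>)\<^sup>2"
  proof -
    have "r * \<eta> \<le> 5" using hi \<eta> by (simp add: algebra_simps)
    then have "r \<le> 5 / \<eta>" using \<eta> by (simp add: field_simps)
    then show ?thesis unfolding k_def using r n by (intro mult_left_mono power_mono) auto
  qed
  also have "\<dots> = 50 * real n * fro_sq n A / (\<epsilon>\<^sup>2 * N\<^sup>2)"
    by (simp add: \<eta>_def F(2)[symmetric] power_divide power_mult_distrib)
  finally show "real (card {e \<in> E2. X (fst e) (snd e) \<noteq> 0}) \<le> 50 * real n * fro_sq n A / (\<epsilon>\<^sup>2 * N\<^sup>2)" .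
  define u where "u = 4 * real n * (r + 2)"
  define P where "P = sqrt (sqn n x) * sqrt (sqn n y)"
  have P: "0 \<le> P" by (simp add: P_def sqn_nonneg)
  have "k * bil n (\<lambda>i j. A i j - X i j) x y = - bil n (\<lambda>i j. H (i, j) * ratio i j - k * A i j) x y"
    unfolding bil_def sum_distrib_left sum_negf[symmetric]
    using X k by (intro sum.cong refl) (auto simp: field_simps)
  also have "\<dots> \<le> (u + k * (1 / r)) * F * P"
    using final_error[OF pos[unfolded k(1), folded r_def], of x y, folded u_def F_def P_def] k r by simp
  also have "\<dots> \<le> k * (\<epsilon> * N) * P"
  proof (intro mult_right_mono P)
    have "u + k * (1 / r) \<le> k * (4 / r)"
    proof -
      \<comment> \<open>Here r \<ge> 4 enters: u = 4 n r + 8 n \<le> 6 n r, and k / r = 2 n r,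
        together at most 8 n r = 4 k / r.\<close>
      have "real n * 8 \<le> real n * (2 * r)" using r by (intro mult_left_mono) auto
      then have "u \<le> 6 * (real n * r)" by (simp add: u_def algebra_simps)
      moreover have e: "k * (1 / r) = 2 * (real n * r)" "k * (4 / r) = 8 * (real n * r)"
        using r by (simp_all add: k_def power2_eq_square)
      ultimately show ?thesis unfolding e by linarith
    qed
    moreover have "4 / r \<le> \<eta>" using lo r by (simp add: field_simps)
    then have "k * (4 / r) \<le> k * \<eta>" using k by (intro mult_left_mono) auto
    ultimately have "(u + k * (1 / r)) * F \<le> k * \<eta> * F" using F by (intro mult_right_mono) auto
    then show "(u + k * (1 / r)) * F \<le> k * (\<epsilon> * N)" using F by (simp add: \<eta>_def)
  qed
  finally have "k * bil n (\<lambda>i j. A i j - X i j) x y \<le> k * (\<epsilon> * N * P)" by (simp add: mult.assoc)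
  then show "bil n (\<lambda>i j. A i j - X i j) x y \<le> \<epsilon> * N * (sqrt (sqn n x) * sqrt (sqn n y))"
    using k(2) by (simp add: P_def)
qed

text \<open>If even round n - 1 passes, then n \<eta> \<le> 5 for \<eta> = \<epsilon> N / F, so
  \<epsilon> is so small that all n^2 entries may be kept.\<close>

lemma all_pass_bound:
  assumes "\<forall>r<n. passes (real r * \<epsilon>)" and \<epsilon>: "0 < \<epsilon>" "\<epsilon> < 1"
  shows "(real n)\<^sup>2 \<le> 50 * real n * fro_sq n A / (\<epsilon>\<^sup>2 * N\<^sup>2)"
proof -
  define F where "F = sqrt (fro_sq n A)"
  have F: "0 < F" "F\<^sup>2 = fro_sq n A" "N \<le> F" using fro_pos N_le by (simp_all add: F_def)
  define \<eta> where "\<eta> = \<epsilon> * N / F"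
  have \<eta>: "0 < \<eta>" "\<eta> < 1"
  proof -
    show "0 < \<eta>" using \<epsilon> N_pos F by (simp add: \<eta>_def)
    have "\<epsilon> * N < 1 * F" using \<epsilon> N_pos F by (intro mult_less_le_imp_less) auto
    then show "\<eta> < 1" using F by (simp add: \<eta>_def)
  qed
  have "passes (real (n - 1) * \<epsilon>)" using assms(1)[rule_format, of "n - 1"] n_pos by simp
  then have "(real n - 1) * \<eta> \<le> 4"
    using passes_imp_le[of "real (n - 1) * \<epsilon>"] \<epsilon> F n_pos
    by (simp add: \<eta>_def F_def[symmetric] field_simps of_nat_diff)
  then have "real n * \<eta> \<le> 5" using \<eta> by (simp add: algebra_simps)
  then have "real n * \<eta>\<^sup>2 \<le> 5 * 1"
    unfolding power2_eq_square mult.assoc[symmetric] using \<eta> n_pos by (intro mult_mono) auto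
  then have "real n \<le> 50 / \<eta>\<^sup>2" using \<eta> by (simp add: field_simps)
  then have "real n * real n \<le> real n * (50 / \<eta>\<^sup>2)" by (intro mult_left_mono) auto
  also have "\<dots> = 50 * real n * fro_sq n A / (\<epsilon>\<^sup>2 * N\<^sup>2)"
    by (simp add: \<eta>_def F(2)[symmetric] power_divide power_mult_distrib)
  finally show ?thesis by (simp add: power2_eq_square)
qed

end

end

section \<open>Operator norms and the main theorem\<close>

lemma sem_setup:
  fixes \<sigma> :: store and n :: nat and \<rho> :: "nat \<Rightarrow> nat"
  assumes \<rho>: "\<rho> 0 = 0"
  defines "\<sigma>' \<equiv> sem setup_com n \<rho> \<sigma>"
  shows "\<And>j. j < n \<Longrightarrow> \<sigma>' aCol 0 j = col_sq n (\<sigma> aA) j"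
    "\<sigma>' aFro 0 0 = fro_sq n (\<sigma> aA)" "\<sigma>' aN 0 0 = real n"
    "\<And>i j. i < n \<Longrightarrow> j < n \<Longrightarrow> \<sigma>' aB i j = \<sigma> aA i j / col_sq n (\<sigma> aA) j"
    "\<sigma>' aR 0 0 = 0" "\<sigma>' aDone 0 0 = 0" "\<sigma>' aA = \<sigma> aA" "\<sigma>' aEps = \<sigma> aEps"
proof -
  let ?A = "\<sigma> aA"
  define c1 where "c1 = put aN (scal aN +. Const 1)"
  define c2 where "c2 = Assign aCol 0 6 (Const 0)"
  define c3 where "c3 = Assign aCol 0 6 (Arr aCol 0 6 +. Arr aA 5 6 *. Arr aA 5 6)"
  define c4 where "c4 = put aFro (scal aFro +. Arr aCol 0 6)"
  define c5 where "c5 = Assign aB 5 6 (Arr aA 5 6 /. Arr aCol 0 6)"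
  define \<sigma>1 where "\<sigma>1 = sem (For 5 c1) n \<rho> (upd aN 0 0 0 \<sigma>)"
  define \<sigma>2 where "\<sigma>2 = sem (For 6 c2) n \<rho> \<sigma>1"
  define \<sigma>3 where "\<sigma>3 = sem (For 5 (For 6 c3)) n \<rho> \<sigma>2"
  define \<sigma>4 where "\<sigma>4 = sem (For 6 c4) n \<rho> (upd aFro 0 0 0 \<sigma>3)"
  define \<sigma>5 where "\<sigma>5 = sem (For 5 (For 6 c5)) n \<rho> \<sigma>4"
  have eq: "\<sigma>' = upd aDone 0 0 0 (upd aR 0 0 0 \<sigma>5)"
    unfolding \<sigma>'_def setup_com_def c1_def[symmetric] c2_def[symmetric] c3_def[symmetric]
      c4_def[symmetric] c5_def[symmetric] sem.simps(3)
    by (simp add: \<rho> \<sigma>5_def \<sigma>4_def \<sigma>3_def \<sigma>2_def \<sigma>1_def)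
  have fr1: "\<sigma>1 k = \<sigma> k" if "k \<noteq> aN" for k
  proof -
    have "\<sigma>1 k = upd aN 0 0 0 \<sigma> k"
      unfolding \<sigma>1_def using that by (intro sem_frame) (simp add: c1_def)
    then show ?thesis using that by (simp add: upd_other)
  qed
  have fr2: "\<sigma>2 k = \<sigma>1 k" if "k \<noteq> aCol" for k
    unfolding \<sigma>2_def using that by (intro sem_frame) (simp add: c2_def)
  have fr3: "\<sigma>3 k = \<sigma>2 k" if "k \<noteq> aCol" for k
    unfolding \<sigma>3_def using that by (intro sem_frame) (simp add: c3_def)
  have fr4: "\<sigma>4 k = \<sigma>3 k" if "k \<noteq> aFro" for k
  proof -
    have "\<sigma>4 k = upd aFro 0 0 0 \<sigma>3 k"
      unfolding \<sigma>4_def using that by (intro sem_frame) (simp add: c4_def)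
    then show ?thesis using that by (simp add: upd_other)
  qed
  have fr5: "\<sigma>5 k = \<sigma>4 k" if "k \<noteq> aB" for k
    unfolding \<sigma>5_def using that by (intro sem_frame) (simp add: c5_def)
  have "\<sigma>1 aN 0 0 = real (0 + n * 1)"
    unfolding \<sigma>1_def
    by (rule sem_For_count[where P = "\<lambda>t s. s aN 0 0 = real t"]) (auto simp: upd_apply c1_def \<rho>)
  then have N: "\<sigma>1 aN 0 0 = real n" by simp
  have "\<forall>j\<in>{..<n}. \<sigma>2 aCol 0 j = 0"
    unfolding \<sigma>2_def
    by (rule sem_For_set[where P = "\<lambda>D s. \<forall>j\<in>D. s aCol 0 j = 0"]) (auto simp: upd_apply c2_def \<rho>)
  then have col0: "\<sigma>2 aCol 0 j = 0" if "j < n" for j using that by simp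
  define Q where "Q D s \<longleftrightarrow> finite D \<and> s aA = ?A \<and>
      (\<forall>j<n. s aCol 0 j = (\<Sum>e\<in>D. if snd e = j then (?A (fst e) j)\<^sup>2 else 0))"
    for D :: "(nat \<times> nat) set" and s :: store
  have "Q ({..<n} \<times> {..<n}) \<sigma>3"
    unfolding \<sigma>3_def
  proof (rule sem_For2_set)
    show "Q {} \<sigma>2" by (simp add: Q_def col0 fr2 fr1)
  next
    fix D x y s assume "x < n" "y < n" "(x, y) \<notin> D" "Q D s"
    moreover from this have "sem c3 n (\<rho>(5 := x, 6 := y)) s = upd aCol 0 y (s aCol 0 y + (?A x y)\<^sup>2) s"
      by (simp add: Q_def c3_def \<rho> power2_eq_square)
    ultimately show "Q (insert (x, y) D) (sem c3 n (\<rho>(5 := x, 6 := y)) s)"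
      by (simp add: Q_def upd_apply upd_other)
  qed
  moreover have "(\<Sum>e\<in>{..<n} \<times> {..<n}. if snd e = j then (?A (fst e) j)\<^sup>2 else 0) = col_sq n ?A j" if "j < n" for j
  proof -
    have "(\<Sum>e\<in>{..<n} \<times> {..<n}. if snd e = j then (?A (fst e) j)\<^sup>2 else 0) =
        (\<Sum>i<n. \<Sum>j'<n. if j' = j then (?A i j)\<^sup>2 else 0)"
      unfolding sum.cartesian_product by (intro sum.cong refl) (simp add: split_def)
    then show ?thesis using that by (simp add: col_sq_def)
  qed
  ultimately have col: "\<sigma>3 aCol 0 j = col_sq n ?A j" if "j < n" for j
    using that by (simp add: Q_def)
  have "\<sigma>4 aFro 0 0 = (\<Sum>j<n. col_sq n ?A j) \<and> \<sigma>4 aCol = \<sigma>3 aCol \<and> finite {..<n}"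
    unfolding \<sigma>4_def
  proof (rule sem_For_set[where P = "\<lambda>D s. s aFro 0 0 = (\<Sum>j\<in>D. col_sq n ?A j) \<and> s aCol = \<sigma>3 aCol \<and> finite D"])
    fix D m s assume "m < n" "m \<notin> D" "s aFro 0 0 = (\<Sum>j\<in>D. col_sq n ?A j) \<and> s aCol = \<sigma>3 aCol \<and> finite D"
    then show "sem c4 n (\<rho>(6 := m)) s aFro 0 0 = (\<Sum>j\<in>insert m D. col_sq n ?A j) \<and>
        sem c4 n (\<rho>(6 := m)) s aCol = \<sigma>3 aCol \<and> finite (insert m D)"
      by (simp add: c4_def \<rho> upd_apply upd_other col)
  qed (simp add: upd_apply upd_other)
  then have fro: "\<sigma>4 aFro 0 0 = fro_sq n ?A" by (simp add: fro_sq_def)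
  have "(\<forall>(i, j)\<in>{..<n} \<times> {..<n}. \<sigma>5 aB i j = ?A i j / col_sq n ?A j) \<and> \<sigma>5 aA = \<sigma>4 aA \<and> \<sigma>5 aCol = \<sigma>4 aCol"
    unfolding \<sigma>5_def
  proof (rule sem_For2_set[where P = "\<lambda>D s. (\<forall>(i, j)\<in>D. s aB i j = ?A i j / col_sq n ?A j) \<and> s aA = \<sigma>4 aA \<and> s aCol = \<sigma>4 aCol"])
    fix D x y s assume xy: "x < n" "y < n" and
      s: "(\<forall>(i, j)\<in>D. s aB i j = ?A i j / col_sq n ?A j) \<and> s aA = \<sigma>4 aA \<and> s aCol = \<sigma>4 aCol"
    have "sem c5 n (\<rho>(5 := x, 6 := y)) s = upd aB x y (?A x y / col_sq n ?A y) s"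
      using xy s by (simp add: c5_def \<rho> fr4 fr3 fr2 fr1 col)
    then show "(\<forall>(i, j)\<in>insert (x, y) D. sem c5 n (\<rho>(5 := x, 6 := y)) s aB i j = ?A i j / col_sq n ?A j) \<and>
        sem c5 n (\<rho>(5 := x, 6 := y)) s aA = \<sigma>4 aA \<and> sem c5 n (\<rho>(5 := x, 6 := y)) s aCol = \<sigma>4 aCol"
      using s by (auto simp: upd_apply upd_other)
  qed simp
  then have B: "\<sigma>5 aB i j = ?A i j / col_sq n ?A j" if "i < n" "j < n" for i j
    using that by auto
  show "\<sigma>' aCol 0 j = col_sq n ?A j" if "j < n" for j
    using that by (simp add: eq upd_apply fr5 fr4 col)
  show "\<sigma>' aFro 0 0 = fro_sq n ?A" "\<sigma>' aN 0 0 = real n" "\<sigma>' aR 0 0 = 0" "\<sigma>' aDone 0 0 = 0"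
    "\<sigma>' aA = ?A" "\<sigma>' aEps = \<sigma> aEps"
    by (simp_all add: eq upd_apply upd_other fr5 fr4 fr3 fr2 fro N) (simp_all add: fr1)
  show "\<sigma>' aB i j = ?A i j / col_sq n ?A j" if "i < n" "j < n" for i j
    using that by (simp add: eq upd_apply B)
qed

section \<open>The operator norm as the least bilinear bound\<close>

definition entries :: "real mat \<Rightarrow> nat \<Rightarrow> nat \<Rightarrow> real" where
  "entries A i j = A $$ (i, j)"

lemma euclidean_norm_eq: "x \<in> carrier_vec n \<Longrightarrow> euclidean_norm x = sqrt (sqn n (\<lambda>i. x $ i))"
  by (simp add: euclidean_norm_def scalar_prod_def sqn_def power2_eq_square lessThan_atLeast0)

lemma frobenius_norm_eq:
  assumes "A \<in> carrier_mat n n"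
  shows "(frobenius_norm A)\<^sup>2 = fro_sq n (entries A)"
proof -
  have "(\<Sum>i<n. \<Sum>j<n. (A $$ (i, j))\<^sup>2) = fro_sq n (entries A)"
    unfolding fro_sq_def col_sq_def entries_def by (rule sum.swap)
  moreover have "0 \<le> (\<Sum>i<n. \<Sum>j<n. (A $$ (i, j))\<^sup>2)" by (intro sum_nonneg) auto
  ultimately show ?thesis using assms by (simp add: frobenius_norm_def)
qed

text \<open>\<open>bil_le_geometric\<close> for the identity matrix with F = 1 and K = 1 / 2, where
  its hypothesis is x y \<le> (x^2 + y^2) / 2 in each coordinate.\<close>

lemma cauchy_schwarz_sum:
  fixes a c :: "nat \<Rightarrow> real"
  shows "(\<Sum>j<n. a j * c j) \<le> sqrt (sqn n a) * sqrt (sqn n c)"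
proof -
  have "bil n (\<lambda>i j. if i = j then 1 else 0) a c \<le> 2 * (1 / 2) * 1 * (sqrt (sqn n a) * sqrt (sqn n c))"
  proof (rule bil_le_geometric)
    fix x y
    have "bil n (\<lambda>i j. if i = j then 1 else 0) x y = (\<Sum>i<n. x i * y i)"
      by (simp add: bil_def if_distrib if_distribR cong: if_cong)
    also have "\<dots> \<le> (\<Sum>i<n. 1 / 2 * ((x i)\<^sup>2 + (y i)\<^sup>2))"
    proof (rule sum_mono)
      fix i
      show "x i * y i \<le> 1 / 2 * ((x i)\<^sup>2 + (y i)\<^sup>2)"
        using zero_le_power2[of "x i - y i"] by (simp add: power2_diff)
    qed
    also have "\<dots> = 1 / 2 * (1\<^sup>2 * sqn n x + sqn n y)"
      by (simp add: sqn_def sum.distrib flip: sum_distrib_left sum_divide_distrib)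
    finally show "bil n (\<lambda>i j. if i = j then 1 else 0) x y \<le> 1 / 2 * (1\<^sup>2 * sqn n x + sqn n y)" .
  qed simp
  moreover have "bil n (\<lambda>i j. if i = j then 1 else 0) a c = (\<Sum>i<n. a i * c i)"
    by (simp add: bil_def if_distrib if_distribR cong: if_cong)
  ultimately show ?thesis by simp
qed

context
  fixes n :: nat and A :: "real mat"
  assumes A: "A \<in> carrier_mat n n"
begin

lemma mult_vec_index: "x \<in> carrier_vec n \<Longrightarrow> i < n \<Longrightarrow> (A *\<^sub>v x) $ i = (\<Sum>j<n. A $$ (i, j) * x $ j)"
  using A by (simp add: scalar_prod_def lessThan_atLeast0)

lemma bil_entries:
  assumes "y \<in> carrier_vec n"
  shows "bil n (entries A) x (\<lambda>j. y $ j) = (\<Sum>i<n. x i * (A *\<^sub>v y) $ i)"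
  unfolding bil_def entries_def
  by (intro sum.cong refl) (simp add: mult_vec_index[OF assms] sum_distrib_left mult_ac)

text \<open>Take x = A y: then |A y|^2 = x^T A y \<le> C |A y| |y|, and one factor cancels.\<close>

lemma euclidean_norm_mult_le:
  assumes C: "\<And>x y. bil n (entries A) x y \<le> C * (sqrt (sqn n x) * sqrt (sqn n y))" and y: "y \<in> carrier_vec n"
  shows "euclidean_norm (A *\<^sub>v y) \<le> C * euclidean_norm y"
proof -
  let ?z = "\<lambda>i. (A *\<^sub>v y) $ i"
  have Ay: "A *\<^sub>v y \<in> carrier_vec n" using A y by simp
  define S where "S = sqrt (sqn n ?z)"
  have S: "0 \<le> S" by (simp add: S_def sqn_nonneg)
  have "S\<^sup>2 = bil n (entries A) ?z (\<lambda>j. y $ j)"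
    unfolding bil_entries[OF y] by (simp add: S_def sqn_nonneg sqn_def power2_eq_square)
       (simp add: sqn_def power2_eq_square sum_nonneg)
  also have "\<dots> \<le> C * (S * sqrt (sqn n (\<lambda>j. y $ j)))" unfolding S_def by (rule C)
  finally have "S * S \<le> S * (C * euclidean_norm y)"
    using euclidean_norm_eq[OF y] by (simp add: power2_eq_square mult_ac)
  \<comment> \<open>The sign of \<open>C\<close> is not given; the bounds for (y, y) and (- y, y)
    add up to 0 \<le> 2 C |y|^2. This settles the case A y = 0.\<close>
  moreover have "0 \<le> C * euclidean_norm y"
  proof -
    have "0 \<le> C * (sqrt (sqn n (\<lambda>j. y $ j)) * sqrt (sqn n (\<lambda>j. y $ j)))"
      using C[of "\<lambda>_. 0" "\<lambda>j. y $ j"] C[of "\<lambda>j. y $ j" "\<lambda>j. y $ j"] C[of "\<lambda>j. - y $ j" "\<lambda>j. y $ j"]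
      by (simp add: bil_def sqn_def sum_negf)
    then have "0 \<le> (C * euclidean_norm y) * euclidean_norm y"
      by (simp only: euclidean_norm_eq[OF y] mult.assoc)
    moreover have "0 \<le> euclidean_norm y" by (simp add: euclidean_norm_eq[OF y] sqn_nonneg)
    ultimately show ?thesis by (cases "euclidean_norm y = 0") (auto simp: zero_le_mult_iff)
  qed
  ultimately have "S \<le> C * euclidean_norm y"
    using S by (cases "S = 0") auto
  then show ?thesis by (simp add: euclidean_norm_eq[OF Ay] S_def)
qed

text \<open>Cauchy--Schwarz in every row, then once more across the rows.\<close>

lemma bil_le_frobenius: "bil n (entries A) x y \<le> sqrt (fro_sq n (entries A)) * (sqrt (sqn n x) * sqrt (sqn n y))"
proof -
  define row where "row i = sqrt (sqn n (entries A i))" for i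
  have "bil n (entries A) x y = (\<Sum>i<n. x i * (\<Sum>j<n. entries A i j * y j))"
    unfolding bil_def by (intro sum.cong refl) (simp add: sum_distrib_left mult_ac)
  also have "\<dots> \<le> (\<Sum>i<n. \<bar>x i\<bar> * (row i * sqrt (sqn n y)))"
  proof (rule sum_mono)
    fix i
    have "\<bar>\<Sum>j<n. entries A i j * y j\<bar> \<le> row i * sqrt (sqn n y)"
      using cauchy_schwarz_sum[of "entries A i" y n] cauchy_schwarz_sum[of "\<lambda>j. - entries A i j" y n]
      by (auto simp: row_def abs_le_iff sum_negf sqn_def)
    then have "\<bar>x i\<bar> * \<bar>\<Sum>j<n. entries A i j * y j\<bar> \<le> \<bar>x i\<bar> * (row i * sqrt (sqn n y))"
      by (rule mult_left_mono) simp
    then show "x i * (\<Sum>j<n. entries A i j * y j) \<le> \<bar>x i\<bar> * (row i * sqrt (sqn n y))"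
      unfolding abs_mult[symmetric] by linarith
  qed
  also have "\<dots> = (\<Sum>i<n. \<bar>x i\<bar> * row i) * sqrt (sqn n y)"
    by (simp add: sum_distrib_right mult.assoc)
  also have "\<dots> \<le> (sqrt (sqn n (\<lambda>i. \<bar>x i\<bar>)) * sqrt (sqn n row)) * sqrt (sqn n y)"
    by (intro mult_right_mono cauchy_schwarz_sum) (simp add: sqn_nonneg)
  also have "sqn n (\<lambda>i. \<bar>x i\<bar>) = sqn n x" by (simp add: sqn_def)
  also have "sqn n row = fro_sq n (entries A)"
    unfolding fro_sq_def col_sq_def by (subst sum.swap) (simp add: sqn_def row_def sum_nonneg)
  finally show ?thesis by (simp add: mult_ac)
qed

lemma operator_norm_bdd:
  "bdd_above {euclidean_norm (A *\<^sub>v x) | x. x \<in> carrier_vec (dim_col A) \<and> euclidean_norm x = 1}"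
  using euclidean_norm_mult_le[OF bil_le_frobenius] A by (intro bdd_aboveI[of _ "sqrt (fro_sq n (entries A))"]) fastforce

lemma euclidean_norm_mult:
  assumes y: "y \<in> carrier_vec n"
  shows "euclidean_norm (A *\<^sub>v y) \<le> operator_norm A * euclidean_norm y"
proof (cases "euclidean_norm y = 0")
  case True
  then show ?thesis using euclidean_norm_mult_le[OF bil_le_frobenius y] by simp
next
  case False
  define s where "s = euclidean_norm y"
  have s: "0 < s" using False euclidean_norm_eq[OF y] sqn_nonneg[of n "\<lambda>i. y $ i"] by (simp add: s_def)
  have nrm: "euclidean_norm (c \<cdot>\<^sub>v z) = \<bar>c\<bar> * euclidean_norm z" for c and z :: "real vec"
    by (simp add: euclidean_norm_def real_sqrt_mult flip: mult.assoc)
  define x where "x = (1 / s) \<cdot>\<^sub>v y"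
  have x: "x \<in> carrier_vec n" "euclidean_norm x = 1" using y s by (simp_all add: x_def nrm s_def)
  have "euclidean_norm (A *\<^sub>v x) \<le> operator_norm A"
    unfolding operator_norm_def using x A by (intro cSup_upper operator_norm_bdd) auto
  moreover have "A *\<^sub>v x = (1 / s) \<cdot>\<^sub>v (A *\<^sub>v y)"
    unfolding x_def by (rule mult_mat_vec[OF A y])
  ultimately show ?thesis using s by (simp add: nrm field_simps s_def)
qed

lemma bil_le_operator_norm:
  "bil n (entries A) x y \<le> operator_norm A * (sqrt (sqn n x) * sqrt (sqn n y))"
proof -
  define v where "v = vec n y"
  have v: "v \<in> carrier_vec n" by (simp add: v_def)
  have Av: "A *\<^sub>v v \<in> carrier_vec n" using A v by simp
  have vy: "sqn n (\<lambda>j. v $ j) = sqn n y" by (simp add: sqn_def v_def)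
  have "bil n (entries A) x y = bil n (entries A) x (\<lambda>j. v $ j)"
    by (simp add: bil_def v_def)
  also have "\<dots> \<le> sqrt (sqn n x) * euclidean_norm (A *\<^sub>v v)"
    unfolding bil_entries[OF v] euclidean_norm_eq[OF Av] by (rule cauchy_schwarz_sum)
  also have "\<dots> \<le> sqrt (sqn n x) * (operator_norm A * euclidean_norm v)"
    by (intro mult_left_mono euclidean_norm_mult v) (simp add: sqn_nonneg)
  finally show ?thesis by (simp add: euclidean_norm_eq[OF v] vy mult_ac)
qed

text \<open>The set under the supremum is nonempty because n \<ge> 1. Together with
  \<open>bil_le_operator_norm\<close> this makes the operator norm the least bilinear bound.\<close>

lemma operator_norm_le:
  assumes "1 \<le> n" and C: "\<And>x y. bil n (entries A) x y \<le> C * (sqrt (sqn n x) * sqrt (sqn n y))"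
  shows "operator_norm A \<le> C"
  unfolding operator_norm_def
proof (rule cSup_least)
  have "unit_vec n 0 \<in> carrier_vec n" "euclidean_norm (unit_vec n 0) = 1"
    using assms(1) by (simp_all add: euclidean_norm_def)
  then show "{euclidean_norm (A *\<^sub>v x) | x. x \<in> carrier_vec (dim_col A) \<and> euclidean_norm x = 1} \<noteq> {}"
    using carrier_matD(2)[OF A] by blast
qed (use euclidean_norm_mult_le[OF C] A in fastforce)

end

text \<open>Equivalent to e^3 \<le> 2^5; the bound exp (1 / 4) \<le> 21 / 16, raised to the power
  12, is sharp enough. The value 3 / 5 suffices for the numerical comparisons below.\<close>

lemma three_fifths_le_ln_2: "3 / 5 \<le> ln (2 :: real)"
proof -
  have "exp (1 / 4 :: real) \<le> 1 + 1 / 4 + (1 / 4)\<^sup>2"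
    by (rule exp_bound) auto
  then have "exp (1 / 4 :: real) ^ 12 \<le> (1 + 1 / 4 + (1 / 4)\<^sup>2) ^ 12"
    by (rule power_mono) simp
  also have "(1 + 1 / 4 + (1 / 4 :: real)\<^sup>2) ^ 12 \<le> 2 ^ 5"
    by (simp add: power2_eq_square power_divide)
  also have "exp (1 / 4 :: real) ^ 12 = exp 3"
    by (simp flip: exp_of_nat_mult)
  finally have "3 \<le> ln (2 ^ 5 :: real)" by (subst ln_ge_iff) auto
  then show ?thesis using ln_realpow[of 2 5] by simp
qed

lemma ln_ge_power_2:
  assumes "2 ^ k \<le> x"
  shows "3 / 5 * real k \<le> ln x"
proof -
  have "3 / 5 * real k \<le> real k * ln 2"
    using mult_left_mono[OF three_fifths_le_ln_2, of "real k"] by simp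
  also have "\<dots> = ln (2 ^ k)" by (simp add: ln_realpow)
  also have "\<dots> \<le> ln x" using assms by (subst ln_le_cancel_iff) (auto intro: less_le_trans[of 0 "2 ^ k"])
  finally show ?thesis .
qed

text \<open>For n \<le> 8 use 2 n \<ge> 2, which gives 14 * 3 / 5 = 8.4; for 9 \<le> n \<le> 31 use
  2 n \<ge> 16, which gives 14 * 12 / 5 = 33.6.\<close>

lemma small_dimension_bound:
  assumes "1 \<le> n" "n \<le> 31"
  shows "real n \<le> 14 * ln (2 * real n)"
proof (cases "n \<le> 8")
  case True
  then show ?thesis using ln_ge_power_2[of 1 "2 * real n"] assms by simp
next
  case False
  then show ?thesis using ln_ge_power_2[of 4 "2 * real n"] assms by simp
qed

text \<open>32 is the first n with 2 n \<ge> 2^6, and 14 * 18 / 5 = 50.4. This fixes the threshold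
  in the program.\<close>

lemma large_dimension_bound: "32 \<le> n \<Longrightarrow> 50 \<le> 14 * ln (2 * real n)"
  using ln_ge_power_2[of 6 "2 * real n"] by simp

lemma bil_cong: "(\<And>i j. i < n \<Longrightarrow> j < n \<Longrightarrow> C i j = C' i j) \<Longrightarrow> bil n C x y = bil n C' x y"
  unfolding bil_def by (intro sum.cong refl) simp

text \<open>The bilinear form at x = A_ij e_i and y = e_j is A_ij^2, so a nonpositive norm would
  make every entry vanish.\<close>

lemma operator_norm_pos:
  assumes A: "A \<in> carrier_mat n n" and "0 < fro_sq n (entries A)"
  shows "0 < operator_norm A"
proof (rule ccontr)
  assume neg: "\<not> ?thesis"
  have "entries A i j = 0" if ij: "i < n" "j < n" for i j
  proof -
    let ?x = "\<lambda>k. if k = i then entries A i j else 0" and ?y = "\<lambda>k. if k = j then 1 else (0 :: real)"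
    have "bil n (entries A) ?x ?y = (\<Sum>k<n. if k = i then entries A i j * entries A i j else 0)"
      unfolding bil_def
    proof (intro sum.cong refl)
      fix k
      have "(\<Sum>l<n. entries A k l * ?x k * ?y l) = (\<Sum>l<n. if l = j then entries A k l * ?x k else 0)"
        by (intro sum.cong) auto
      then show "(\<Sum>l<n. entries A k l * ?x k * ?y l) = (if k = i then entries A i j * entries A i j else 0)"
        using ij by auto
    qed
    then have "(entries A i j)\<^sup>2 = bil n (entries A) ?x ?y"
      using ij by (simp add: power2_eq_square)
    also have "\<dots> \<le> operator_norm A * (sqrt (sqn n ?x) * sqrt (sqn n ?y))"
      by (rule bil_le_operator_norm[OF A])
    also have "\<dots> \<le> 0" using neg by (intro mult_nonpos_nonneg mult_nonneg_nonneg) (auto simp: sqn_nonneg)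
    finally show ?thesis by simp
  qed
  then have "fro_sq n (entries A) = 0" by (simp add: fro_sq_def col_sq_def)
  then show False using assms(2) by simp
qed

lemma operator_norm_nonneg:
  assumes A: "A \<in> carrier_mat n n" and "1 \<le> n"
  shows "0 \<le> operator_norm A"
proof -
  have e: "unit_vec n 0 \<in> carrier_vec n" "euclidean_norm (unit_vec n 0) = 1"
    using assms(2) by (simp_all add: euclidean_norm_def)
  have "A *\<^sub>v unit_vec n 0 \<in> carrier_vec n" using A by simp
  then have "0 \<le> euclidean_norm (A *\<^sub>v unit_vec n 0)" by (simp add: euclidean_norm_eq sqn_nonneg)
  also have "\<dots> \<le> operator_norm A" using euclidean_norm_mult[OF A e(1)] e(2) by simp
  finally show ?thesis .
qed

text \<open>Sparsity has three possible reasons: there are no nonzero entries at all, n^2 is within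
  the bound (small dimension, or all tests passed), or the barrier method ran.\<close>

lemma sparsify_correct:
  fixes \<sigma> :: store and n :: nat and \<rho> :: "nat \<Rightarrow> nat" and A :: "real mat"
  assumes A: "A \<in> carrier_mat n n" and n: "1 \<le> n" and \<epsilon>: "0 < \<epsilon>" "\<epsilon> < 1"
    and eps: "\<sigma> aEps 0 0 = \<epsilon>" and \<sigma>: "\<And>i j. i < n \<Longrightarrow> j < n \<Longrightarrow> \<sigma> aA i j = A $$ (i, j)" and \<rho>: "\<rho> 0 = 0"
  defines "X \<equiv> sem sparsify_com n \<rho> \<sigma> aA" and "N \<equiv> operator_norm A" and "f \<equiv> fro_sq n (entries A)"
  shows "real (card {e \<in> {..<n} \<times> {..<n}. X (fst e) (snd e) \<noteq> 0}) \<le> 14 * real n * ln (2 * real n) * f / (\<epsilon>\<^sup>2 * N\<^sup>2)"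
    and "bil n (\<lambda>i j. entries A i j - X i j) x y \<le> \<epsilon> * N * (sqrt (sqn n x) * sqrt (sqn n y))"
proof -
  let ?A = "\<sigma> aA"
  have eqA: "?A i j = entries A i j" if "i < n" "j < n" for i j using \<sigma> that by (simp add: entries_def)
  have f: "f = fro_sq n ?A" unfolding f_def fro_sq_def col_sq_def using eqA by simp
  have bilA: "bil n ?A x y = bil n (entries A) x y" for x y by (rule bil_cong) (rule eqA)
  define \<sigma>1 where "\<sigma>1 = sem setup_com n \<rho> \<sigma>"
  note prep = sem_setup[where \<sigma> = \<sigma> and n = n and \<rho> = \<rho>, OF \<rho>, folded \<sigma>1_def]
  have X: "X = (if 31 < real n \<and> 0 < f then sem (For 1 round_com) n \<rho> \<sigma>1 aA else ?A)"
    using prep(2,3,7) \<rho> by (simp add: X_def sparsify_com_def \<sigma>1_def[symmetric] f)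
  have N0: "0 \<le> N" unfolding N_def by (rule operator_norm_nonneg[OF A n])
  have f0: "0 \<le> f" by (simp add: f_def fro_sq_def col_sq_def sum_nonneg)
  have same: "bil n (\<lambda>i j. entries A i j - ?A i j) x y \<le> \<epsilon> * N * (sqrt (sqn n x) * sqrt (sqn n y))" for x y
  proof -
    have "bil n (\<lambda>i j. entries A i j - ?A i j) x y = 0" unfolding bil_def using eqA by simp
    then show ?thesis using \<epsilon> N0 by (simp add: sqn_nonneg)
  qed
  let ?nz = "\<lambda>X :: nat \<Rightarrow> nat \<Rightarrow> real. real (card {e \<in> {..<n} \<times> {..<n}. X (fst e) (snd e) \<noteq> 0})"
  have all: "?nz X \<le> (real n)\<^sup>2" for X
  proof -
    have "card {e \<in> {..<n} \<times> {..<n}. X (fst e) (snd e) \<noteq> 0} \<le> card ({..<n} \<times> {..<n})"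
      by (intro card_mono) auto
    then have "?nz X \<le> real (card ({..<n} \<times> {..<n}))" by (rule of_nat_mono)
    then show ?thesis by (simp add: power2_eq_square)
  qed
  have "?nz X \<le> 14 * real n * ln (2 * real n) * f / (\<epsilon>\<^sup>2 * N\<^sup>2) \<and>
    (\<forall>x y. bil n (\<lambda>i j. entries A i j - X i j) x y \<le> \<epsilon> * N * (sqrt (sqn n x) * sqrt (sqn n y)))"
  proof (cases "0 < f")
    case False
    then have X': "X = ?A" and fz: "f = 0" using f0 by (auto simp: X)
    have "?A i j = 0" if "i < n" "j < n" for i j
    proof -
      have "col_sq n ?A j = 0" using fz that unfolding f fro_sq_def
        by (subst (asm) sum_nonneg_eq_0_iff) (auto simp: col_sq_def sum_nonneg)
      then show ?thesis using that unfolding col_sq_def by (subst (asm) sum_nonneg_eq_0_iff) auto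
    qed
    then have "{e \<in> {..<n} \<times> {..<n}. ?A (fst e) (snd e) \<noteq> 0} = {}" by auto
    then have "?nz ?A = 0" by (simp only: card.empty of_nat_0)
    then show ?thesis using same fz X' by simp
  next
    case True
    have N: "0 < N" unfolding N_def using True by (intro operator_norm_pos[OF A]) (simp add: f_def)
    have NF: "N \<le> sqrt f" unfolding N_def f_def by (intro operator_norm_le[OF A n] bil_le_frobenius[OF A])
    interpret sampled_matrix n ?A by unfold_locales (use True f in simp)
    \<comment> \<open>\<open>q\<close> is sr(A) / \<epsilon>^2; it is at least 1 because the
      operator norm is at most F and \<epsilon> < 1. So in small dimensions n^2 \<le> 14 n ln (2 n)
      is enough.\<close>
    define q where "q = f / (\<epsilon>\<^sup>2 * N\<^sup>2)"
    have q: "1 \<le> q"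
    proof -
      have "N\<^sup>2 \<le> (sqrt f)\<^sup>2" using NF N0 by (intro power_mono) auto
      moreover have "\<epsilon>\<^sup>2 \<le> 1" using \<epsilon> by (simp add: power_le_one)
      then have "\<epsilon>\<^sup>2 * N\<^sup>2 \<le> 1 * N\<^sup>2" by (intro mult_right_mono) auto
      ultimately have "\<epsilon>\<^sup>2 * N\<^sup>2 \<le> f" using True by simp
      then show ?thesis using \<epsilon> N by (simp add: q_def)
    qed
    have rhs: "14 * real n * ln (2 * real n) * f / (\<epsilon>\<^sup>2 * N\<^sup>2) = real n * (14 * ln (2 * real n)) * q"
      by (simp add: q_def)
    show ?thesis
    proof (cases "31 < n")
      case False
      then have X': "X = ?A" by (simp add: X)
      have "?nz ?A \<le> real n * real n * 1" using all[of ?A] by (simp add: power2_eq_square)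
      also have "\<dots> \<le> real n * (14 * ln (2 * real n)) * q"
        using small_dimension_bound[OF n] False q by (intro mult_mono mult_nonneg_nonneg) auto
      finally show ?thesis using same X' rhs by simp
    next
      case big: True
      have X': "X = sem (For 1 round_com) n \<rho> \<sigma>1 aA" using True big by (simp add: X)
      have env: "env \<sigma>1" using prep(1-4) by (simp add: env_def ratio_def)
      have "round_inv \<epsilon> n (sem (For 1 round_com) n \<rho> \<sigma>1)"
        using prep(5-8) eps \<rho> \<epsilon> by (intro sem_rounds env) simp_all
      then consider "\<forall>i<n. \<forall>j<n. X i j = ?A i j" "\<forall>r<n. passes (real r * \<epsilon>)" | "sparsified \<epsilon> X"
        unfolding round_inv_def X' by blast
      moreover have Nb: "bil n ?A x y \<le> N * (sqrt (sqn n x) * sqrt (sqn n y))" for x y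
        unfolding bilA N_def by (rule bil_le_operator_norm[OF A])
      have Nl: "N \<le> C" if "\<And>x y. bil n ?A x y \<le> C * (sqrt (sqn n x) * sqrt (sqn n y))" for C
        unfolding N_def using that unfolding bilA by (intro operator_norm_le[OF A n])
      have Nf: "N \<le> sqrt (fro_sq n ?A)" using NF f by simp
      have large: "50 * real n * fro_sq n ?A / (\<epsilon>\<^sup>2 * N\<^sup>2) \<le> 14 * real n * ln (2 * real n) * f / (\<epsilon>\<^sup>2 * N\<^sup>2)"
      proof -
        have "50 * (real n * q) \<le> 14 * ln (2 * real n) * (real n * q)"
          using large_dimension_bound[of n] big q by (intro mult_right_mono) auto
        then show ?thesis by (simp add: q_def f mult_ac)
      qed
      ultimately show ?thesis
      proof cases
        case 1
        have "(real n)\<^sup>2 \<le> 50 * real n * fro_sq n ?A / (\<epsilon>\<^sup>2 * N\<^sup>2)"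
        proof (rule all_pass_bound[OF _ _ N Nf 1(2) \<epsilon>])
          show "bil n ?A x y \<le> N * (sqrt (sqn n x) * sqrt (sqn n y))" for x y by (rule Nb)
          show "N \<le> C" if "\<And>x y. bil n ?A x y \<le> C * (sqrt (sqn n x) * sqrt (sqn n y))" for C
            using that by (rule Nl)
        qed
        then have "?nz X \<le> 50 * real n * fro_sq n ?A / (\<epsilon>\<^sup>2 * N\<^sup>2)"
          using all[of X] by linarith
        moreover have "bil n (\<lambda>i j. entries A i j - X i j) x y = bil n (\<lambda>i j. entries A i j - ?A i j) x y" for x y
          using 1(1) by (intro bil_cong) simp
        ultimately show ?thesis using order_trans[OF _ large] same by (simp only: simp_thms)
      next
        case 2
        have Nl': "N \<le> C" if "0 \<le> C" "\<And>x y. bil n ?A x y \<le> C * (sqrt (sqn n x) * sqrt (sqn n y))" for C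
          using that(2) by (rule Nl)
        note bounds = sparsified_bounds[of N, OF Nb _ N Nf 2 \<epsilon>]
        have "?nz X \<le> 50 * real n * fro_sq n ?A / (\<epsilon>\<^sup>2 * N\<^sup>2)"
          by (rule bounds(1)) (rule Nl')
        moreover have "bil n (\<lambda>i j. ?A i j - X i j) x y \<le> \<epsilon> * N * (sqrt (sqn n x) * sqrt (sqn n y))" for x y
          by (rule bounds(2)) (rule Nl')
        moreover have "bil n (\<lambda>i j. entries A i j - X i j) x y = bil n (\<lambda>i j. ?A i j - X i j) x y" for x y
          using eqA by (intro bil_cong) simp
        ultimately show ?thesis using order_trans[OF _ large] by (simp only: simp_thms)
      qed
    qed
  qed
  then show "?nz X \<le> 14 * real n * ln (2 * real n) * f / (\<epsilon>\<^sup>2 * N\<^sup>2)"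
    "bil n (\<lambda>i j. entries A i j - X i j) x y \<le> \<epsilon> * N * (sqrt (sqn n x) * sqrt (sqn n y))"
    by blast+
qed

theorem theorem8:
  shows "\<exists>(P :: program) (q :: nat poly).
    \<forall>(n :: nat) (A :: real mat) (\<epsilon> :: real).
      1 \<le> n \<longrightarrow> A \<in> carrier_mat n n \<longrightarrow> 0 < \<epsilon> \<longrightarrow> \<epsilon> < 1 \<longrightarrow>
      (\<exists>A' \<in> carrier_mat n n.
         outputs_within P n A \<epsilon> (poly q n) A' \<and>
         real (num_nonzero A') \<le> 28 * real n * ln (sqrt (2 * real n)) * stable_rank A / \<epsilon>\<^sup>2 \<and>
         operator_norm (A - A') \<le> \<epsilon> * operator_norm A)"
proof (intro exI allI impI)
  fix n :: nat and A :: "real mat" and \<epsilon> :: real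
  assume n: "1 \<le> n" and A: "A \<in> carrier_mat n n" and \<epsilon>: "0 < \<epsilon>" "\<epsilon> < 1"
  let ?P = "prelude @ compile sparsify_com 11" and ?q = "[:8, 4:] + cost sparsify_com"
  obtain \<sigma> where out: "outputs_within ?P n A \<epsilon> (poly ?q n)
      (mat n n (\<lambda>(i, j). sem sparsify_com n (\<lambda>_. 0) \<sigma> aA i j))"
    and \<sigma>: "\<sigma> aEps 0 0 = \<epsilon>" "\<And>i j. i < n \<Longrightarrow> j < n \<Longrightarrow> \<sigma> aA i j = A $$ (i, j)"
    using compiled_program_outputs[OF n wf_sparsify, of A \<epsilon>] by metis
  define X where "X = sem sparsify_com n (\<lambda>_. 0) \<sigma> aA"
  define A' where "A' = mat n n (\<lambda>(i, j). X i j)"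
  note bounds = sparsify_correct[OF A n \<epsilon> \<sigma>, where \<rho> = "\<lambda>_. 0", folded X_def]
  have A': "A' \<in> carrier_mat n n" by (simp add: A'_def)
  have "{(i, j). i < dim_row A' \<and> j < dim_col A' \<and> A' $$ (i, j) \<noteq> 0} =
      {e \<in> {..<n} \<times> {..<n}. X (fst e) (snd e) \<noteq> 0}"
    by (auto simp: A'_def)
  then have "real (num_nonzero A') \<le> 14 * real n * ln (2 * real n) * fro_sq n (entries A) / (\<epsilon>\<^sup>2 * (operator_norm A)\<^sup>2)"
    using bounds(1) by (simp add: num_nonzero_def)
  \<comment> \<open>The square root inside the logarithm accounts for the factor 2 between 14 and
    28.\<close>
  also have "\<dots> = 28 * real n * ln (sqrt (2 * real n)) * stable_rank A / \<epsilon>\<^sup>2"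
    using n by (simp add: stable_rank_def frobenius_norm_eq[OF A] ln_sqrt mult_ac)
  finally have nz: "real (num_nonzero A') \<le> 28 * real n * ln (sqrt (2 * real n)) * stable_rank A / \<epsilon>\<^sup>2" .
  have "operator_norm (A - A') \<le> \<epsilon> * operator_norm A"
  proof (rule operator_norm_le[OF _ n])
    show "A - A' \<in> carrier_mat n n" using A' by (rule minus_carrier_mat)
    fix x y
    have "bil n (entries (A - A')) x y = bil n (\<lambda>i j. entries A i j - X i j) x y"
      using A A' by (intro bil_cong) (simp add: entries_def A'_def)
    then show "bil n (entries (A - A')) x y \<le> \<epsilon> * operator_norm A * (sqrt (sqn n x) * sqrt (sqn n y))"
      using bounds(2) by simp
  qed
  with nz out A' show "\<exists>A' \<in> carrier_mat n n. outputs_within ?P n A \<epsilon> (poly ?q n) A' \<and>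
      real (num_nonzero A') \<le> 28 * real n * ln (sqrt (2 * real n)) * stable_rank A / \<epsilon>\<^sup>2 \<and>
      operator_norm (A - A') \<le> \<epsilon> * operator_norm A"
    unfolding A'_def X_def by blast
qed

end
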